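(* Let $(\Sigma,D,T)$ be a torsion free affine surface equipped with a (nonzero) nilpotent $(1,1)$-tensor field $T$. If $T$ is parallel ($DT=0$), then: (i) $\ker T$ is a parallel one-dimensional distribution whose integral curves are geodesics of $(\Sigma,D)$. (ii) The symmetric part of the Ricci tensor, $\rho^D_{sym}$, is zero or of rank one and recurrent, i.e., $D\rho^D_{sym}=\eta\otimes\rho^D_{sym}$ for some one-form $\eta$.
   Context: A torsion free affine surface $(\Sigma,D)$ is a smooth surface $\Sigma$ with a torsion free affine connection $D$. Its Ricci tensor is $\rho^D(X,Y)=\operatorname{tr}\{Z\mapsto R^D(Z,X)Y\}$ with $R^D(X,Y)=[D_X,D_Y]-D_{[X,Y]}$, and $\rho^D_{sym}(X,Y)=\frac12\{\rho^D(X,Y)+\rho^D(Y,X)\}$. A $(1,1)$-tensor field $T$ on a surface is nilpotent if $T^2=0$. A distribution is parallel if it is invariant under $D_X$ for all vector fields $X$.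
   Formalization: In (ii), "zero or of rank one" is meant pointwise, and the one-form η with Dρ_sym = η⊗ρ_sym is claimed only on the open set where ρ_sym ≠ 0 (a global η can fail to exist); "nonzero" means T is not identically zero on any connected component. *)

theory Defs
  imports "HOL-Analysis.Analysis"
begin

section \<open>Smooth maps between Euclidean spaces\<close>

text \<open>Iterated differentiability, one direction at a time. Only used for open sets, where
  \<open>smooth_on\<close> is the usual notion of a \<open>C\<^sup>\<infinity>\<close> map.\<close>

primrec times_diff_on ::
    "nat \<Rightarrow> 'a::real_normed_vector set \<Rightarrow> ('a \<Rightarrow> 'b::real_normed_vector) \<Rightarrow> bool" where
  "times_diff_on 0 S f \<longleftrightarrow> continuous_on S f"
| "times_diff_on (Suc k) S f \<longleftrightarrow>
     (\<forall>x\<in>S. f differentiable (at x)) \<and>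
     (\<forall>v. times_diff_on k S (\<lambda>x. frechet_derivative f (at x) v))"

definition smooth_on :: "'a::real_normed_vector set \<Rightarrow> ('a \<Rightarrow> 'b::real_normed_vector) \<Rightarrow> bool" where
  "smooth_on S f \<longleftrightarrow> (\<forall>k. times_diff_on k S f)"


section \<open>Smooth surfaces\<close>

text \<open>The underlying space of the surface is the whole (arbitrary) type \<open>'a\<close>, Hausdorff and second
  countable by its sort. A chart is a pair of a domain and a coordinate map; values of the coordinate
  map outside the domain are irrelevant.\<close>

type_synonym 'a chart = "'a set \<times> ('a \<Rightarrow> real ^ 2)"

definition chart_inv :: "'a chart \<Rightarrow> real ^ 2 \<Rightarrow> 'a" where
  "chart_inv c = inv_into (fst c) (snd c)"

definition coord :: "'a chart \<Rightarrow> 2 \<Rightarrow> 'a \<Rightarrow> real" where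
  "coord c i = (\<lambda>q. snd c q $ i)"

definition smooth_surface ::
    "'a::{t2_space,second_countable_topology} chart set \<Rightarrow> bool" where
  "smooth_surface A \<longleftrightarrow>
     (\<Union>c\<in>A. fst c) = UNIV \<and>
     (\<forall>c\<in>A. open (fst c) \<and> open (snd c ` fst c) \<and>
        homeomorphism (fst c) (snd c ` fst c) (snd c) (chart_inv c)) \<and>
     (\<forall>c\<in>A. \<forall>c'\<in>A. smooth_on (snd c ` (fst c \<inter> fst c')) (snd c' \<circ> chart_inv c))"

definition smooth_fun_on :: "'a::topological_space chart set \<Rightarrow> 'a set \<Rightarrow> ('a \<Rightarrow> real) \<Rightarrow> bool" where
  "smooth_fun_on A U f \<longleftrightarrow>
     open U \<and> (\<forall>c\<in>A. smooth_on (snd c ` (U \<inter> fst c)) (f \<circ> chart_inv c))"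

definition smooth_near :: "'a::topological_space chart set \<Rightarrow> 'a \<Rightarrow> ('a \<Rightarrow> real) \<Rightarrow> bool" where
  "smooth_near A p f \<longleftrightarrow> (\<exists>U. p \<in> U \<and> smooth_fun_on A U f)"


section \<open>Tangent vectors and vector fields\<close>

text \<open>A tangent vector at \<open>p\<close> is a directional derivative at \<open>p\<close>, acting on functions that are smooth
  near \<open>p\<close>; by convention it is \<open>0\<close> on all other functions, so that equality of tangent vectors is
  equality of HOL functions.\<close>

type_synonym 'a tangent = "('a \<Rightarrow> real) \<Rightarrow> real"
type_synonym 'a field = "'a \<Rightarrow> 'a tangent"

definition dir_deriv ::
    "'a::topological_space chart set \<Rightarrow> 'a chart \<Rightarrow> 'a \<Rightarrow> real ^ 2 \<Rightarrow> 'a tangent" where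
  "dir_deriv A c p w =
     (\<lambda>f. if smooth_near A p f
          then frechet_derivative (f \<circ> chart_inv c) (at (snd c p)) w else 0)"

definition tangent_space :: "'a::topological_space chart set \<Rightarrow> 'a \<Rightarrow> 'a tangent set" where
  "tangent_space A p = {dir_deriv A c p w | c w. c \<in> A \<and> p \<in> fst c}"

definition coord_vec ::
    "'a::topological_space chart set \<Rightarrow> 'a chart \<Rightarrow> 2 \<Rightarrow> 'a field" where
  "coord_vec A c i = (\<lambda>p. dir_deriv A c p (axis i 1))"

definition zero_vec :: "'a tangent" where
  "zero_vec = (\<lambda>f. 0)"

definition add_vec :: "'a tangent \<Rightarrow> 'a tangent \<Rightarrow> 'a tangent" where
  "add_vec u v = (\<lambda>f. u f + v f)"

definition scale_vec :: "real \<Rightarrow> 'a tangent \<Rightarrow> 'a tangent" where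
  "scale_vec a v = (\<lambda>f. a * v f)"

definition vector_fields :: "'a::topological_space chart set \<Rightarrow> 'a field set" where
  "vector_fields A =
     {X. (\<forall>p. X p \<in> tangent_space A p) \<and>
         (\<forall>U f. smooth_fun_on A U f \<longrightarrow> smooth_fun_on A U (\<lambda>p. X p f))}"

definition add_field :: "'a field \<Rightarrow> 'a field \<Rightarrow> 'a field" where
  "add_field X Y = (\<lambda>p. add_vec (X p) (Y p))"

definition scale_field :: "('a \<Rightarrow> real) \<Rightarrow> 'a field \<Rightarrow> 'a field" where
  "scale_field f X = (\<lambda>p. scale_vec (f p) (X p))"

definition lie_bracket ::
    "'a::topological_space chart set \<Rightarrow> 'a field \<Rightarrow> 'a field \<Rightarrow> 'a field" where
  "lie_bracket A X Y =
     (\<lambda>p f. if smooth_near A p f then X p (\<lambda>q. Y q f) - Y p (\<lambda>q. X q f) else 0)"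

definition chart_at :: "'a chart set \<Rightarrow> 'a \<Rightarrow> 'a chart" where
  "chart_at A p = (SOME c. c \<in> A \<and> p \<in> fst c)"

definition extend_vec :: "'a::topological_space chart set \<Rightarrow> 'a \<Rightarrow> 'a tangent \<Rightarrow> 'a field" where
  "extend_vec A p v = (SOME X. X \<in> vector_fields A \<and> X p = v)"


section \<open>Affine connections\<close>

definition affine_connection ::
    "'a::topological_space chart set \<Rightarrow> ('a field \<Rightarrow> 'a field \<Rightarrow> 'a field) \<Rightarrow> bool" where
  "affine_connection A D \<longleftrightarrow>
     (\<forall>X\<in>vector_fields A. \<forall>Y\<in>vector_fields A. D X Y \<in> vector_fields A) \<and>
     (\<forall>X\<in>vector_fields A. \<forall>X'\<in>vector_fields A. \<forall>Y\<in>vector_fields A.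
        D (add_field X X') Y = add_field (D X Y) (D X' Y)) \<and>
     (\<forall>f. \<forall>X\<in>vector_fields A. \<forall>Y\<in>vector_fields A. smooth_fun_on A UNIV f \<longrightarrow>
        D (scale_field f X) Y = scale_field f (D X Y)) \<and>
     (\<forall>X\<in>vector_fields A. \<forall>Y\<in>vector_fields A. \<forall>Y'\<in>vector_fields A.
        D X (add_field Y Y') = add_field (D X Y) (D X Y')) \<and>
     (\<forall>f. \<forall>X\<in>vector_fields A. \<forall>Y\<in>vector_fields A. smooth_fun_on A UNIV f \<longrightarrow>
        D X (scale_field f Y) = add_field (scale_field (\<lambda>p. X p f) Y) (scale_field f (D X Y)))"

definition torsion_free ::
    "'a::topological_space chart set \<Rightarrow> ('a field \<Rightarrow> 'a field \<Rightarrow> 'a field) \<Rightarrow> bool" where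
  "torsion_free A D \<longleftrightarrow>
     (\<forall>X\<in>vector_fields A. \<forall>Y\<in>vector_fields A. \<forall>p f.
        D X Y p f - D Y X p f = lie_bracket A X Y p f)"

definition curvature ::
    "'a::topological_space chart set \<Rightarrow> ('a field \<Rightarrow> 'a field \<Rightarrow> 'a field) \<Rightarrow>
     'a field \<Rightarrow> 'a field \<Rightarrow> 'a field \<Rightarrow> 'a field" where
  "curvature A D X Y Z =
     (\<lambda>p f. D X (D Y Z) p f - D Y (D X Z) p f - D (lie_bracket A X Y) Z p f)"

text \<open>The trace of an endomorphism of the tangent space at \<open>p\<close>, as the sum of \<open>dx\<^sup>i (L \<partial>\<^sub>i)\<close> in some
  chart around \<open>p\<close>; it does not depend on the chart.\<close>

definition tangent_trace ::
    "'a::topological_space chart set \<Rightarrow> 'a \<Rightarrow> ('a tangent \<Rightarrow> 'a tangent) \<Rightarrow> real" where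
  "tangent_trace A p L =
     (\<Sum>i\<in>UNIV. L (coord_vec A (chart_at A p) i p) (coord (chart_at A p) i))"

text \<open>Curvature is tensorial, so the endomorphism \<open>z \<mapsto> R(z,X)Y\<close> of the tangent space may be
  evaluated with any vector field extending \<open>z\<close>.\<close>

definition ricci ::
    "'a::topological_space chart set \<Rightarrow> ('a field \<Rightarrow> 'a field \<Rightarrow> 'a field) \<Rightarrow>
     'a field \<Rightarrow> 'a field \<Rightarrow> 'a \<Rightarrow> real" where
  "ricci A D X Y = (\<lambda>p. tangent_trace A p (\<lambda>z. curvature A D (extend_vec A p z) X Y p))"

definition sym_ricci ::
    "'a::topological_space chart set \<Rightarrow> ('a field \<Rightarrow> 'a field \<Rightarrow> 'a field) \<Rightarrow>
     'a field \<Rightarrow> 'a field \<Rightarrow> 'a \<Rightarrow> real" where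
  "sym_ricci A D X Y = (\<lambda>p. (ricci A D X Y p + ricci A D Y X p) / 2)"


section \<open>Tensor fields\<close>

definition endo_field ::
    "'a::topological_space chart set \<Rightarrow> ('a \<Rightarrow> 'a tangent \<Rightarrow> 'a tangent) \<Rightarrow> bool" where
  "endo_field A T \<longleftrightarrow>
     (\<forall>p. \<forall>u\<in>tangent_space A p. T p u \<in> tangent_space A p) \<and>
     (\<forall>p. \<forall>u\<in>tangent_space A p. \<forall>v\<in>tangent_space A p.
        T p (add_vec u v) = add_vec (T p u) (T p v)) \<and>
     (\<forall>p a. \<forall>u\<in>tangent_space A p. T p (scale_vec a u) = scale_vec a (T p u)) \<and>
     (\<forall>X\<in>vector_fields A. (\<lambda>p. T p (X p)) \<in> vector_fields A)"

definition nilpotent_endo ::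
    "'a::topological_space chart set \<Rightarrow> ('a \<Rightarrow> 'a tangent \<Rightarrow> 'a tangent) \<Rightarrow> bool" where
  "nilpotent_endo A T \<longleftrightarrow> (\<forall>p. \<forall>v\<in>tangent_space A p. T p (T p v) = zero_vec)"

text \<open>\<open>T\<close> does not vanish identically on any connected component of the surface. If the surface is
  connected, this says just that \<open>T\<close> is not the zero tensor field.\<close>

definition nonzero_endo ::
    "'a::topological_space chart set \<Rightarrow> ('a \<Rightarrow> 'a tangent \<Rightarrow> 'a tangent) \<Rightarrow> bool" where
  "nonzero_endo A T \<longleftrightarrow>
     (\<forall>p. \<exists>q\<in>connected_component_set UNIV p. \<exists>v\<in>tangent_space A q. T q v \<noteq> zero_vec)"

text \<open>\<open>(D\<^sub>X T) Y = D\<^sub>X (T Y) - T (D\<^sub>X Y)\<close>\<close>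

definition cov_deriv_endo ::
    "('a field \<Rightarrow> 'a field \<Rightarrow> 'a field) \<Rightarrow> ('a \<Rightarrow> 'a tangent \<Rightarrow> 'a tangent) \<Rightarrow>
     'a field \<Rightarrow> 'a field \<Rightarrow> 'a field" where
  "cov_deriv_endo D T X Y = (\<lambda>p f. D X (\<lambda>q. T q (Y q)) p f - T p (D X Y p) f)"

definition parallel_endo ::
    "'a::topological_space chart set \<Rightarrow> ('a field \<Rightarrow> 'a field \<Rightarrow> 'a field) \<Rightarrow>
     ('a \<Rightarrow> 'a tangent \<Rightarrow> 'a tangent) \<Rightarrow> bool" where
  "parallel_endo A D T \<longleftrightarrow>
     (\<forall>X\<in>vector_fields A. \<forall>Y\<in>vector_fields A. \<forall>p. cov_deriv_endo D T X Y p = zero_vec)"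

text \<open>Tensor fields of type \<open>(0,2)\<close> are given by their values on pairs of vector fields.
  \<open>cov_deriv_form\<close> is \<open>(D\<^sub>X h)(Y,Z) = X(h(Y,Z)) - h(D\<^sub>X Y,Z) - h(Y,D\<^sub>X Z)\<close>.\<close>

definition cov_deriv_form ::
    "('a field \<Rightarrow> 'a field \<Rightarrow> 'a field) \<Rightarrow> ('a field \<Rightarrow> 'a field \<Rightarrow> 'a \<Rightarrow> real) \<Rightarrow>
     'a field \<Rightarrow> 'a field \<Rightarrow> 'a field \<Rightarrow> 'a \<Rightarrow> real" where
  "cov_deriv_form D h X Y Z = (\<lambda>p. X p (h Y Z) - h (D X Y) Z p - h Y (D X Z) p)"

definition form_zero_at ::
    "'a::topological_space chart set \<Rightarrow> ('a field \<Rightarrow> 'a field \<Rightarrow> 'a \<Rightarrow> real) \<Rightarrow> 'a \<Rightarrow> bool" where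
  "form_zero_at A h p \<longleftrightarrow> (\<forall>X\<in>vector_fields A. \<forall>Y\<in>vector_fields A. h X Y p = 0)"

text \<open>The rank at \<open>p\<close> of the bilinear form defined by \<open>h\<close> on the tangent space, i.e. the rank of its
  matrix in the basis of coordinate vectors of some chart.\<close>

definition form_rank ::
    "'a::topological_space chart set \<Rightarrow> ('a field \<Rightarrow> 'a field \<Rightarrow> 'a \<Rightarrow> real) \<Rightarrow> 'a \<Rightarrow> nat" where
  "form_rank A h p =
     rank (\<chi> i j. h (extend_vec A p (coord_vec A (chart_at A p) i p))
                   (extend_vec A p (coord_vec A (chart_at A p) j p)) p :: real ^ 2 ^ 2)"

definition one_form_on ::
    "'a::topological_space chart set \<Rightarrow> 'a set \<Rightarrow> ('a \<Rightarrow> 'a tangent \<Rightarrow> real) \<Rightarrow> bool" where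
  "one_form_on A U \<eta> \<longleftrightarrow>
     (\<forall>p\<in>U. \<forall>u\<in>tangent_space A p. \<forall>v\<in>tangent_space A p.
        \<eta> p (add_vec u v) = \<eta> p u + \<eta> p v) \<and>
     (\<forall>p\<in>U. \<forall>a. \<forall>u\<in>tangent_space A p. \<eta> p (scale_vec a u) = a * \<eta> p u) \<and>
     (\<forall>X\<in>vector_fields A. smooth_fun_on A U (\<lambda>p. \<eta> p (X p)))"

definition recurrent_on ::
    "'a::topological_space chart set \<Rightarrow> ('a field \<Rightarrow> 'a field \<Rightarrow> 'a field) \<Rightarrow>
     ('a field \<Rightarrow> 'a field \<Rightarrow> 'a \<Rightarrow> real) \<Rightarrow> 'a set \<Rightarrow> bool" where
  "recurrent_on A D h U \<longleftrightarrow>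
     (\<exists>\<eta>. one_form_on A U \<eta> \<and>
        (\<forall>X\<in>vector_fields A. \<forall>Y\<in>vector_fields A. \<forall>Z\<in>vector_fields A. \<forall>p\<in>U.
           cov_deriv_form D h X Y Z p = \<eta> p (X p) * h Y Z p))"


section \<open>Distributions, curves and geodesics\<close>

definition endo_kernel ::
    "'a::topological_space chart set \<Rightarrow> ('a \<Rightarrow> 'a tangent \<Rightarrow> 'a tangent) \<Rightarrow> 'a \<Rightarrow> 'a tangent set" where
  "endo_kernel A T p = {v \<in> tangent_space A p. T p v = zero_vec}"

definition line_distribution ::
    "'a::topological_space chart set \<Rightarrow> ('a \<Rightarrow> 'a tangent set) \<Rightarrow> bool" where
  "line_distribution A L \<longleftrightarrow>
     (\<forall>p. \<exists>X\<in>vector_fields A. \<exists>V. open V \<and> p \<in> V \<and>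
        (\<forall>q\<in>V. X q \<noteq> zero_vec \<and> L q = {scale_vec a (X q) | a. True}))"

definition parallel_distribution ::
    "'a::topological_space chart set \<Rightarrow> ('a field \<Rightarrow> 'a field \<Rightarrow> 'a field) \<Rightarrow>
     ('a \<Rightarrow> 'a tangent set) \<Rightarrow> bool" where
  "parallel_distribution A D L \<longleftrightarrow>
     (\<forall>X\<in>vector_fields A. \<forall>Y\<in>vector_fields A. (\<forall>p. Y p \<in> L p) \<longrightarrow> (\<forall>p. D X Y p \<in> L p))"

definition smooth_curve :: "'a::topological_space chart set \<Rightarrow> real set \<Rightarrow> (real \<Rightarrow> 'a) \<Rightarrow> bool" where
  "smooth_curve A I \<gamma> \<longleftrightarrow>
     open I \<and> is_interval I \<and> continuous_on I \<gamma> \<and>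
     (\<forall>U f. smooth_fun_on A U f \<longrightarrow> smooth_on {t\<in>I. \<gamma> t \<in> U} (f \<circ> \<gamma>))"

definition velocity :: "'a::topological_space chart set \<Rightarrow> (real \<Rightarrow> 'a) \<Rightarrow> real \<Rightarrow> 'a tangent" where
  "velocity A \<gamma> t = (\<lambda>f. if smooth_near A (\<gamma> t) f then deriv (f \<circ> \<gamma>) t else 0)"

text \<open>Integral curves of a line distribution: regular curves tangent to it, in an arbitrary
  parametrization.\<close>

definition integral_curve ::
    "'a::topological_space chart set \<Rightarrow> ('a \<Rightarrow> 'a tangent set) \<Rightarrow> real set \<Rightarrow> (real \<Rightarrow> 'a) \<Rightarrow> bool" where
  "integral_curve A L I \<gamma> \<longleftrightarrow>
     smooth_curve A I \<gamma> \<and>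
     (\<forall>t\<in>I. velocity A \<gamma> t \<in> L (\<gamma> t) \<and> velocity A \<gamma> t \<noteq> zero_vec)"

text \<open>As connections act on globally defined vector fields, Christoffel symbols are formed with
  global vector fields that agree with the coordinate fields near \<open>p\<close>. Such fields exist by bump
  functions, and the choice does not matter since connections are local.\<close>

definition extend_coord ::
    "'a::topological_space chart set \<Rightarrow> 'a chart \<Rightarrow> 'a \<Rightarrow> 2 \<Rightarrow> 'a field" where
  "extend_coord A c p i =
     (SOME X. X \<in> vector_fields A \<and>
        (\<exists>V. open V \<and> p \<in> V \<and> V \<subseteq> fst c \<and> (\<forall>q\<in>V. X q = coord_vec A c i q)))"

definition christoffel ::
    "'a::topological_space chart set \<Rightarrow> ('a field \<Rightarrow> 'a field \<Rightarrow> 'a field) \<Rightarrow>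
     'a chart \<Rightarrow> 'a \<Rightarrow> 2 \<Rightarrow> 2 \<Rightarrow> 2 \<Rightarrow> real" where
  "christoffel A D c p i j k = D (extend_coord A c p i) (extend_coord A c p j) p (coord c k)"

definition geodesic ::
    "'a::topological_space chart set \<Rightarrow> ('a field \<Rightarrow> 'a field \<Rightarrow> 'a field) \<Rightarrow>
     real set \<Rightarrow> (real \<Rightarrow> 'a) \<Rightarrow> bool" where
  "geodesic A D I \<gamma> \<longleftrightarrow>
     smooth_curve A I \<gamma> \<and>
     (\<forall>t\<in>I. \<forall>c\<in>A. \<gamma> t \<in> fst c \<longrightarrow>
        (\<forall>k. deriv (deriv (coord c k \<circ> \<gamma>)) t +
             (\<Sum>i\<in>UNIV. \<Sum>j\<in>UNIV. christoffel A D c (\<gamma> t) i j k *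
                deriv (coord c i \<circ> \<gamma>) t * deriv (coord c j \<circ> \<gamma>) t) = 0))"

text \<open>The curve becomes a geodesic after a change of parameter.\<close>

definition unparam_geodesic ::
    "'a::topological_space chart set \<Rightarrow> ('a field \<Rightarrow> 'a field \<Rightarrow> 'a field) \<Rightarrow>
     real set \<Rightarrow> (real \<Rightarrow> 'a) \<Rightarrow> bool" where
  "unparam_geodesic A D I \<gamma> \<longleftrightarrow>
     (\<exists>J s. open J \<and> is_interval J \<and> bij_betw s J I \<and> smooth_on J s \<and>
        (\<forall>t\<in>J. deriv s t \<noteq> 0) \<and> geodesic A D J (\<gamma> \<circ> s))"

end

theory Submission
  imports Defs
begin

text \<open>
  \<^bold>\<open>The kernel.\<close> In a chart, \<open>DT = 0\<close> is a homogeneous linear first order system for the components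
  of \<open>T\<close>. So the set of zeros of \<open>T\<close> is open (\<open>T_zero_set_open\<close>), it is closed by continuity, and a
  \<open>T\<close> that is nonzero on every component vanishes nowhere (\<open>T_nonzero\<close>). As \<open>T\<^sup>2 = 0\<close>, every \<open>e\<^sub>1\<close> with
  \<open>T e\<^sub>1 \<noteq> 0\<close> gives a basis \<open>e\<^sub>1, e\<^sub>2 = T e\<^sub>1\<close> of the tangent plane, and \<open>ker T\<close> is the line of \<open>e\<^sub>2\<close>
  (\<open>adapted_frame\<close>, \<open>kernel_adapted\<close>). It is parallel because \<open>T (D\<^sub>X Y) = D\<^sub>X (T Y)\<close>.

  \<^bold>\<open>Integral curves.\<close> If \<open>\<gamma>'\<close> lies in the parallel line field \<open>ker T\<close>, so does \<open>D\<^bsub>\<gamma>'\<^esub> \<gamma>'\<close>; hence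
  \<open>D\<^bsub>\<gamma>'\<^esub> \<gamma>' = f \<gamma>'\<close> for a smooth function \<open>f\<close> of the parameter
  (\<open>integral_curve_locally_pregeodesic\<close>). A change of parameter \<open>s\<close> with \<open>s'' = - f(s) s'\<^sup>2\<close> makes
  \<open>\<gamma> \<circ> s\<close> a geodesic (\<open>reparametrization\<close>).

  \<^bold>\<open>Ricci tensor.\<close> The endomorphism \<open>R(e\<^sub>1,e\<^sub>2)\<close> commutes with \<open>T\<close> (\<open>curvature_T\<close>), so it has the form
  \<open>\<alpha> Id + \<beta> T\<close>. Taking traces in the basis \<open>e\<^sub>1, e\<^sub>2\<close>, the part \<open>\<alpha> Id\<close> contributes only to the
  antisymmetric part of the Ricci tensor, and the symmetric part is \<open>- \<beta> \<theta> \<otimes> \<theta>\<close>, where \<open>\<theta>\<close> is the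
  covector with kernel \<open>ker T\<close> and \<open>\<theta>(e\<^sub>1) = 1\<close>. So it vanishes as soon as one argument is in \<open>ker T\<close>
  (\<open>sym_ricci_kernel\<close>), and its rank is at most one. As \<open>ker T\<close> is parallel, the covariant derivative of the
  symmetric Ricci tensor in any direction vanishes on \<open>ker T\<close> as well. Symmetric bilinear forms on a plane
  that vanish on the same line are proportional, which is recurrence
  (\<open>D_sym_ricci_proportional\<close>).

  The connection acts on global vector fields only. Bump functions extend functions and
  coordinate fields from a neighbourhood of a point to the whole surface, and expressions that are
  linear over the smooth functions depend only on the values of their arguments at the point
  (\<open>tensorial_comb\<close>). This makes the computations above possible in local frames.
\<close>

section \<open>Calculus of smooth maps\<close>

lemma frechet_derivative_eqI: "(f has_derivative f') (at x) \<Longrightarrow> frechet_derivative f (at x) = f'"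
  by (metis frechet_derivative_at)

lemma times_diff_on_cong:
  assumes "open S" "\<And>x. x \<in> S \<Longrightarrow> f x = g x" "times_diff_on k S f"
  shows "times_diff_on k S g"
  using assms(2,3)
proof (induction k arbitrary: f g)
  case 0 then show ?case by (auto cong: continuous_on_cong)
next
  case (Suc k)
  have der: "(g has_derivative frechet_derivative f (at x)) (at x)" if "x \<in> S" for x
  proof (rule has_derivative_transform_within_open[OF _ \<open>open S\<close> that])
    show "(f has_derivative frechet_derivative f (at x)) (at x)"
      using Suc.prems(2) that by (auto simp: frechet_derivative_works)
  qed (use Suc.prems in auto)
  have eq: "frechet_derivative f (at x) = frechet_derivative g (at x)" if "x \<in> S" for x
    using frechet_derivative_eqI[OF der[OF that]] by simp
  have "times_diff_on k S (\<lambda>x. frechet_derivative g (at x) v)" for v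
    by (rule Suc.IH[of "\<lambda>x. frechet_derivative f (at x) v"]) (use Suc.prems eq in auto)
  then show ?case using der by (auto simp: differentiable_def)
qed

text \<open>As \<open>frechet_derivative\<close> is defined by choice, derivatives are usually known only as some explicit
  \<open>f'\<close> on \<open>S\<close>; this is the form of the recursion that such an \<open>f'\<close> can use.\<close>

lemma times_diff_on_SucI:
  assumes "open S" "\<And>x. x \<in> S \<Longrightarrow> (f has_derivative f' x) (at x)"
    and "\<And>v. times_diff_on k S (\<lambda>x. f' x v)"
  shows "times_diff_on (Suc k) S f"
proof -
  have eq: "f' x = frechet_derivative f (at x)" if "x \<in> S" for x
    using frechet_derivative_eqI[OF assms(2)[OF that]] by simp
  have "times_diff_on k S (\<lambda>x. frechet_derivative f (at x) v)" for v
    by (rule times_diff_on_cong[OF \<open>open S\<close> _ assms(3)[of v]]) (simp add: eq)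
  then show ?thesis using assms(2) by (auto simp: differentiable_def)
qed

lemma times_diff_on_SucD:
  assumes "times_diff_on (Suc k) S f"
  shows "\<And>x. x \<in> S \<Longrightarrow> (f has_derivative frechet_derivative f (at x)) (at x)"
    and "times_diff_on k S (\<lambda>x. frechet_derivative f (at x) v)"
  using assms by (auto simp: frechet_derivative_works)

lemma times_diff_on_lower: "times_diff_on (Suc k) S f \<Longrightarrow> times_diff_on k S f"
proof (induction k arbitrary: f)
  case 0
  then show ?case
    by (auto intro!: differentiable_imp_continuous_on differentiable_at_imp_differentiable_on)
next
  case (Suc k)
  have "times_diff_on k S (\<lambda>x. frechet_derivative f (at x) v)" for v
    by (rule Suc.IH) (use Suc.prems in \<open>simp only: times_diff_on.simps(2)[of "Suc k"]\<close>)
  then show ?case using Suc.prems by simp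
qed

lemma times_diff_on_subset:
  assumes "T \<subseteq> S" "times_diff_on k S f"
  shows "times_diff_on k T f"
  using assms(2)
  by (induction k arbitrary: f) (use assms(1) in \<open>auto intro: continuous_on_subset\<close>)

lemma times_diff_on_local:
  assumes "open S" "\<And>x. x \<in> S \<Longrightarrow> \<exists>U. open U \<and> x \<in> U \<and> times_diff_on k U f"
  shows "times_diff_on k S f"
  using assms(2)
proof (induction k arbitrary: f)
  case 0
  then have "\<And>x. x \<in> S \<Longrightarrow> isCont f x"
    by (metis continuous_on_eq_continuous_at times_diff_on.simps(1))
  then show ?case by (auto intro: continuous_at_imp_continuous_on)
next
  case (Suc k)
  show ?case unfolding times_diff_on.simps
  proof (intro conjI ballI allI)
    fix x assume "x \<in> S" then show "f differentiable at x"
      using Suc.prems by force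
  next
    fix v show "times_diff_on k S (\<lambda>x. frechet_derivative f (at x) v)"
      by (rule Suc.IH) (use Suc.prems in force)
  qed
qed

lemma times_diff_on_const: "open S \<Longrightarrow> times_diff_on k S (\<lambda>x. c)"
proof (induction k arbitrary: c)
  case (Suc k)
  then show ?case by (intro times_diff_on_SucI[where f' = "\<lambda>x v. 0"]) auto
qed auto

lemma times_diff_on_add:
  assumes "open S" "times_diff_on k S f" "times_diff_on k S g"
  shows "times_diff_on k S (\<lambda>x. f x + g x)"
  using assms(2,3)
proof (induction k arbitrary: f g)
  case 0 then show ?case by (auto intro: continuous_on_add)
next
  case (Suc k)
  show ?case
    by (rule times_diff_on_SucI[OF \<open>open S\<close> has_derivative_add[OF times_diff_on_SucD(1)[OF Suc.prems(1)] times_diff_on_SucD(1)[OF Suc.prems(2)]]])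
      (intro Suc.IH times_diff_on_SucD(2) Suc.prems | assumption)+
qed

lemma times_diff_on_linear:
  assumes "bounded_linear L" "open S" "times_diff_on k S f"
  shows "times_diff_on k S (\<lambda>x. L (f x))"
  using assms(3)
proof (induction k arbitrary: f)
  case 0 then show ?case using assms(1) by (auto intro: bounded_linear.continuous_on)
next
  case (Suc k)
  show ?case
    by (rule times_diff_on_SucI[OF \<open>open S\<close> bounded_linear.has_derivative[OF assms(1) times_diff_on_SucD(1)[OF Suc.prems(1)]]])
      (intro Suc.IH times_diff_on_SucD(2) Suc.prems | assumption)+
qed

lemma times_diff_on_id: "open S \<Longrightarrow> times_diff_on k S (\<lambda>x. x)"
proof (cases k)
  case (Suc n)
  assume "open S" then show ?thesis unfolding Suc
    by (intro times_diff_on_SucI[where f' = "\<lambda>x v. v"]) (auto intro: times_diff_on_const)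
qed auto

lemma times_diff_on_mult:
  fixes f g :: "'a::real_normed_vector \<Rightarrow> real"
  assumes "open S" "times_diff_on k S f" "times_diff_on k S g"
  shows "times_diff_on k S (\<lambda>x. f x * g x)"
  using assms(2,3)
proof (induction k arbitrary: f g)
  case 0 then show ?case by (auto intro: continuous_on_mult)
next
  case (Suc k)
  show ?case
    by (rule times_diff_on_SucI[OF \<open>open S\<close> has_derivative_mult[OF times_diff_on_SucD(1)[OF Suc.prems(1)] times_diff_on_SucD(1)[OF Suc.prems(2)]]])
      (intro times_diff_on_add[OF \<open>open S\<close>] Suc.IH times_diff_on_SucD(2) times_diff_on_lower[OF Suc.prems(1)]
        times_diff_on_lower[OF Suc.prems(2)] Suc.prems | assumption)+
qed

lemma times_diff_on_sum:
  assumes "open S" "\<And>i. i \<in> I \<Longrightarrow> times_diff_on k S (f i)"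
  shows "times_diff_on k S (\<lambda>x. \<Sum>i\<in>I. f i x)"
  using assms(2)
  by (induction I rule: infinite_finite_induct)
    (auto intro: times_diff_on_add[OF \<open>open S\<close>] times_diff_on_const[OF \<open>open S\<close>])

text \<open>The derivative of \<open>f \<circ> g\<close> at \<open>x\<close> in direction \<open>v\<close> is the sum over the basis vectors \<open>b\<close> of
  \<open>(g'(x) v \<bullet> b) (\<partial>\<^sub>b f)(g x)\<close>, to which the induction hypothesis and the product rule apply.
  The statement for each single \<open>k\<close> is what the regularity of inverse functions needs.\<close>

lemma times_diff_on_compose:
  fixes f :: "'b::euclidean_space \<Rightarrow> real"
  assumes "open S" "open T" "g ` S \<subseteq> T" "times_diff_on k T f" "times_diff_on k S g"
  shows "times_diff_on k S (\<lambda>x. f (g x))"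
  using assms(4,5)
proof (induction k arbitrary: f)
  case 0 then show ?case using assms(3) by (auto intro: continuous_on_compose2)
next
  case (Suc k)
  define f' where "f' x v = (\<Sum>b\<in>Basis. (frechet_derivative g (at x) v \<bullet> b) * frechet_derivative f (at (g x)) b)" for x v
  have "((\<lambda>x. f (g x)) has_derivative f' x) (at x)" if "x \<in> S" for x
  proof -
    have gx: "g x \<in> T" using that assms(3) by auto
    have l: "linear (frechet_derivative f (at (g x)))"
      using times_diff_on_SucD(1)[OF Suc.prems(1) gx] has_derivative_linear by blast
    have der: "((\<lambda>x. f (g x)) has_derivative (\<lambda>v. frechet_derivative f (at (g x)) (frechet_derivative g (at x) v))) (at x)"
      by (rule has_derivative_compose[OF times_diff_on_SucD(1)[OF Suc.prems(2) that] times_diff_on_SucD(1)[OF Suc.prems(1) gx]])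
    have eq: "frechet_derivative f (at (g x)) w = (\<Sum>b\<in>Basis. (w \<bullet> b) * frechet_derivative f (at (g x)) b)" for w
    proof -
      have "frechet_derivative f (at (g x)) (\<Sum>b\<in>Basis. (w \<bullet> b) *\<^sub>R b)
          = (\<Sum>b\<in>Basis. (w \<bullet> b) * frechet_derivative f (at (g x)) b)"
        by (simp only: linear_sum[OF l] linear_scale[OF l] real_scaleR_def)
      then show ?thesis by (simp only: euclidean_representation)
    qed
    have "(\<lambda>v. frechet_derivative f (at (g x)) (frechet_derivative g (at x) v)) = f' x"
      unfolding f'_def by (intro ext eq)
    with der show ?thesis by simp
  qed
  moreover have "times_diff_on k S (\<lambda>x. f' x v)" for v
    unfolding f'_def
    by (intro times_diff_on_sum times_diff_on_mult \<open>open S\<close> Suc.IH times_diff_on_SucD(2)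
        times_diff_on_linear[OF bounded_linear_inner_left] Suc.prems times_diff_on_lower[OF Suc.prems(2)])
  ultimately show ?case by (rule times_diff_on_SucI[OF \<open>open S\<close>])
qed

lemma smooth_on_cong: "open S \<Longrightarrow> (\<And>x. x \<in> S \<Longrightarrow> f x = g x) \<Longrightarrow> smooth_on S f \<Longrightarrow> smooth_on S g"
  using times_diff_on_cong[of S f g] by (auto simp: smooth_on_def)

lemma smooth_on_subset: "T \<subseteq> S \<Longrightarrow> smooth_on S f \<Longrightarrow> smooth_on T f"
  using times_diff_on_subset[of T S _ f] by (auto simp: smooth_on_def)

lemma smooth_on_local:
  "open S \<Longrightarrow> (\<And>x. x \<in> S \<Longrightarrow> \<exists>U. open U \<and> x \<in> U \<and> smooth_on U f) \<Longrightarrow> smooth_on S f"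
  unfolding smooth_on_def by (intro allI times_diff_on_local) blast+

lemma smooth_on_const: "open S \<Longrightarrow> smooth_on S (\<lambda>x. c)"
  by (simp add: smooth_on_def times_diff_on_const)

lemma smooth_on_id: "open S \<Longrightarrow> smooth_on S (\<lambda>x. x)"
  by (simp add: smooth_on_def times_diff_on_id)

lemma smooth_on_add: "open S \<Longrightarrow> smooth_on S f \<Longrightarrow> smooth_on S g \<Longrightarrow> smooth_on S (\<lambda>x. f x + g x)"
  by (simp add: smooth_on_def times_diff_on_add)

lemma smooth_on_mult:
  fixes f g :: "'a::real_normed_vector \<Rightarrow> real"
  shows "open S \<Longrightarrow> smooth_on S f \<Longrightarrow> smooth_on S g \<Longrightarrow> smooth_on S (\<lambda>x. f x * g x)"
  by (simp add: smooth_on_def times_diff_on_mult)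

lemma smooth_on_linear:
  "bounded_linear L \<Longrightarrow> open S \<Longrightarrow> smooth_on S f \<Longrightarrow> smooth_on S (\<lambda>x. L (f x))"
  by (simp add: smooth_on_def times_diff_on_linear)

lemma smooth_on_compose:
  fixes f :: "'b::euclidean_space \<Rightarrow> real"
  shows "open S \<Longrightarrow> open T \<Longrightarrow> g ` S \<subseteq> T \<Longrightarrow> smooth_on T f \<Longrightarrow> smooth_on S g \<Longrightarrow> smooth_on S (\<lambda>x. f (g x))"
  unfolding smooth_on_def by (intro allI times_diff_on_compose[of S T]) simp_all

lemma smooth_on_imp_continuous_on: "smooth_on S f \<Longrightarrow> continuous_on S f"
  unfolding smooth_on_def by (metis times_diff_on.simps(1))

lemma smooth_on_has_derivative:
  "smooth_on S f \<Longrightarrow> x \<in> S \<Longrightarrow> (f has_derivative frechet_derivative f (at x)) (at x)"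
  using times_diff_on_SucD(1)[of 0 S f x] by (simp add: smooth_on_def)

lemma smooth_on_frechet: "smooth_on S f \<Longrightarrow> smooth_on S (\<lambda>x. frechet_derivative f (at x) v)"
  using times_diff_on_SucD(2)[of _ S f v] by (simp add: smooth_on_def)

lemma DERIV_inverse_power:
  assumes "x \<noteq> (0::real)"
  shows "((\<lambda>x. inverse x ^ n) has_real_derivative (- real n * inverse x ^ Suc n)) (at x)"
proof -
  have "((\<lambda>x. inverse x ^ n) has_real_derivative of_nat n * (- (inverse x ^ 2) * inverse x ^ (n - Suc 0))) (at x)"
    using DERIV_power[OF DERIV_inverse] assms by (simp add: numeral_2_eq_2)
  moreover have "of_nat n * (- (inverse x ^ 2) * inverse x ^ (n - Suc 0)) = - real n * inverse x ^ Suc n"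
    by (cases n) (simp_all add: power2_eq_square algebra_simps)
  ultimately show ?thesis by (simp only:)
qed

text \<open>All powers are treated at once since differentiation raises the exponent.\<close>

lemma smooth_on_inverse_power: "smooth_on (- {0::real}) (\<lambda>x. inverse x ^ n)"
proof -
  have "times_diff_on k (- {0::real}) (\<lambda>x. inverse x ^ n)" for k
  proof (induction k arbitrary: n)
    case 0 then show ?case by (auto intro!: continuous_intros)
  next
    case (Suc k)
    have "((\<lambda>x. inverse x ^ n) has_derivative (\<lambda>v. v * (- real n * inverse x ^ Suc n))) (at x)"
      if "x \<in> - {0::real}" for x
      using has_field_derivative_imp_has_derivative[OF DERIV_inverse_power[of x n]] that
      by (subst mult.commute) auto
    moreover have "times_diff_on k (- {0::real}) (\<lambda>x. v * (- real n * inverse x ^ Suc n))" for v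
      by (intro times_diff_on_mult times_diff_on_const Suc.IH) auto
    ultimately show ?case by (intro times_diff_on_SucI) auto
  qed
  then show ?thesis by (simp add: smooth_on_def)
qed

lemma smooth_on_divide:
  fixes f g :: "'a::real_normed_vector \<Rightarrow> real"
  assumes "open S" "smooth_on S f" "smooth_on S g" "\<And>x. x \<in> S \<Longrightarrow> g x \<noteq> 0"
  shows "smooth_on S (\<lambda>x. f x / g x)"
proof -
  have "smooth_on S (\<lambda>x. inverse (g x) ^ 1)"
    by (rule smooth_on_compose[OF \<open>open S\<close> _ _ smooth_on_inverse_power]) (use assms in auto)
  then show ?thesis using smooth_on_mult[OF assms(1,2)] by (simp add: divide_inverse)
qed

lemma smooth_on_exp: "smooth_on UNIV (exp :: real \<Rightarrow> real)"
proof -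
  have "times_diff_on k UNIV (exp :: real \<Rightarrow> real)" for k
  proof (induction k)
    case 0 then show ?case by (auto intro!: continuous_intros)
  next
    case (Suc k)
    have "(exp has_derivative (\<lambda>v. v * exp x)) (at x)" for x :: real
      by (auto intro!: derivative_eq_intros)
    moreover have "times_diff_on k UNIV (\<lambda>x::real. v * exp x)" for v
      by (intro times_diff_on_mult times_diff_on_const Suc.IH) auto
    ultimately show ?case by (intro times_diff_on_SucI) auto
  qed
  then show ?thesis by (simp add: smooth_on_def)
qed

section \<open>Bump functions\<close>

text \<open>The functions \<open>exp(-1/t) / t\<^sup>n\<close>, extended by \<open>0\<close> to \<open>t \<le> 0\<close>. Their span is closed under
  differentiation, which makes \<open>exp(-1/t)\<close> smooth at \<open>0\<close>.\<close>

definition flat_exp :: "nat \<Rightarrow> real \<Rightarrow> real" where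
  "flat_exp n t = (if t > 0 then exp (- inverse t) * inverse t ^ n else 0)"

lemma flat_exp_tendsto_0: "((\<lambda>h. flat_exp n h / h) \<longlongrightarrow> 0) (at 0)"
proof -
  have "((\<lambda>y. y ^ Suc n / exp y) \<longlongrightarrow> (0::real)) at_top"
    by (rule tendsto_power_div_exp_0)
  then have "((\<lambda>h. inverse h ^ Suc n / exp (inverse h)) \<longlongrightarrow> (0::real)) (at_right 0)"
    by (rule filterlim_compose[OF _ filterlim_inverse_at_top_right])
  then have r: "((\<lambda>h. flat_exp n h / h) \<longlongrightarrow> 0) (at_right 0)"
    by (rule Lim_transform_eventually)
      (auto simp: eventually_at_filter flat_exp_def exp_minus field_simps)
  have l: "((\<lambda>h. flat_exp n h / h) \<longlongrightarrow> 0) (at_left 0)"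
    by (rule Lim_transform_eventually[OF tendsto_const])
      (auto simp: eventually_at_filter flat_exp_def)
  show ?thesis using l r by (simp add: filterlim_split_at)
qed

lemma flat_exp_deriv:
  "(flat_exp n has_real_derivative (flat_exp (n + 2) t - real n * flat_exp (n + 1) t)) (at t)"
proof -
  consider "t > 0" | "t < 0" | "t = 0" by linarith
  then show ?thesis
  proof cases
    case 1
    have "((\<lambda>t. exp (- inverse t) * inverse t ^ n) has_real_derivative
        (flat_exp (n + 2) t - real n * flat_exp (n + 1) t)) (at t)"
      by (rule derivative_eq_intros DERIV_inverse_power refl | use 1 in \<open>simp add: flat_exp_def power2_eq_square algebra_simps; fail\<close>)+
    moreover have "open {0::real<..}" by simp
    ultimately show ?thesis
      using has_field_derivative_transform_within_open[of "\<lambda>t. exp (- inverse t) * inverse t ^ n" _ t "{0<..}" "flat_exp n"] 1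
      by (auto simp: flat_exp_def)
  next
    case 2
    have "((\<lambda>_. 0::real) has_real_derivative 0) (at t)" by simp
    then show ?thesis using 2
        has_field_derivative_transform_within_open[of "\<lambda>_. 0" 0 t "{..<0}" "flat_exp n"]
      by (auto simp: flat_exp_def)
  next
    case 3
    then show ?thesis using flat_exp_tendsto_0[of n]
      by (simp add: DERIV_def flat_exp_def[of _ 0])
  qed
qed

lemma smooth_on_flat_exp: "smooth_on UNIV (flat_exp n)"
proof -
  have "times_diff_on k UNIV (flat_exp n)" for k
  proof (induction k arbitrary: n)
    case 0
    show ?case using DERIV_isCont[OF flat_exp_deriv]
      by (auto intro: continuous_at_imp_continuous_on)
  next
    case (Suc k)
    have "(flat_exp n has_derivative (\<lambda>v. v * (flat_exp (n + 2) t + (- real n) * flat_exp (n + 1) t))) (at t)" for t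
      using flat_exp_deriv[of n t] by (simp add: has_field_derivative_def mult.commute[of _ "_ - _"] mult_commute_abs)
    moreover have "times_diff_on k UNIV (\<lambda>t. v * (flat_exp (n + 2) t + (- real n) * flat_exp (n + 1) t))" for v
      by (intro times_diff_on_mult times_diff_on_add times_diff_on_const Suc.IH) auto
    ultimately show ?case by (intro times_diff_on_SucI) auto
  qed
  then show ?thesis by (simp add: smooth_on_def)
qed

lemma flat_exp_0_pos: "t > 0 \<Longrightarrow> flat_exp 0 t > 0" and flat_exp_0_nonneg: "flat_exp 0 t \<ge> 0"
  and flat_exp_nonpos: "t \<le> 0 \<Longrightarrow> flat_exp n t = 0"
  by (auto simp: flat_exp_def)

lemma smooth_on_inner_self: 
  fixes a :: "'a::euclidean_space"
  shows "smooth_on UNIV (\<lambda>x. (x - a) \<bullet> (x - a))"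
proof -
  have "smooth_on UNIV (\<lambda>x. \<Sum>b\<in>Basis. ((x - a) \<bullet> b) * ((x - a) \<bullet> b))"
    unfolding smooth_on_def
    by (intro allI times_diff_on_sum times_diff_on_mult times_diff_on_linear[OF bounded_linear_inner_left])
      (auto intro!: times_diff_on_add[of _ _ _ "\<lambda>_. - a", simplified] times_diff_on_const times_diff_on_id)
  then show ?thesis by (simp add: euclidean_inner[of "_ - a" "_ - a"])
qed

text \<open>The quotient \<open>g(p) / (g(p) + g(q))\<close> with \<open>g(t) = exp(-1/t)\<close>, \<open>p = r\<^sup>2 - \<bar>x - a\<bar>\<^sup>2\<close> and
  \<open>q = \<bar>x - a\<bar>\<^sup>2 - r\<^sup>2/4\<close>. The denominator is positive since \<open>p + q > 0\<close>.\<close>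

lemma euclidean_bump_function:
  fixes a :: "'a::euclidean_space"
  assumes "r > 0"
  obtains \<psi> :: "'a \<Rightarrow> real" where "smooth_on UNIV \<psi>"
    "\<And>x. x \<in> ball a (r / 2) \<Longrightarrow> \<psi> x = 1" "\<And>x. x \<notin> ball a r \<Longrightarrow> \<psi> x = 0"
proof -
  let ?N = "\<lambda>x. (x - a) \<bullet> (x - a)"
  let ?p = "\<lambda>x. r\<^sup>2 - ?N x" and ?q = "\<lambda>x. ?N x - r\<^sup>2 / 4"
  let ?chi = "\<lambda>x. flat_exp 0 (?p x) / (flat_exp 0 (?p x) + flat_exp 0 (?q x))"
  have sp: "smooth_on UNIV (\<lambda>x. flat_exp 0 (?p x))"
    by (rule smooth_on_compose[OF _ _ _ smooth_on_flat_exp])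
      (use smooth_on_add[OF _ smooth_on_const smooth_on_mult[OF _ smooth_on_const smooth_on_inner_self], of "r\<^sup>2" "-1" a] in auto)
  have sq: "smooth_on UNIV (\<lambda>x. flat_exp 0 (?q x))"
    by (rule smooth_on_compose[OF _ _ _ smooth_on_flat_exp])
      (use smooth_on_add[OF _ smooth_on_inner_self smooth_on_const, of a "- r\<^sup>2/4"] in auto)
  have pos: "flat_exp 0 (?p x) + flat_exp 0 (?q x) > 0" for x
  proof (cases "?p x > 0")
    case True then show ?thesis by (simp add: add_pos_nonneg flat_exp_0_pos flat_exp_0_nonneg)
  next
    case False
    then have "?N x \<ge> r\<^sup>2" by simp
    then have "?q x > 0" using zero_less_power[OF assms, of 2] by linarith
    then show ?thesis by (simp add: add_nonneg_pos flat_exp_0_pos flat_exp_0_nonneg)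
  qed
  have N: "?N x = (dist a x)\<^sup>2" for x
    by (simp add: dist_norm norm_minus_commute[of a] power2_norm_eq_inner)
  show ?thesis
  proof (rule that)
    show "smooth_on UNIV ?chi"
      by (rule smooth_on_divide[OF _ sp smooth_on_add[OF _ sp sq]]) (use pos in \<open>auto simp: less_imp_neq[symmetric]\<close>)
    show "?chi x = 1" if "x \<in> ball a (r/2)" for x
    proof -
      have "(dist a x)\<^sup>2 \<le> (r/2)\<^sup>2" using that by (intro power_mono) auto
      then have "flat_exp 0 (?q x) = 0" by (intro flat_exp_nonpos) (simp add: N power_divide)
      then show ?thesis using pos[of x] by simp
    qed
    show "?chi x = 0" if "x \<notin> ball a r" for x
    proof -
      have "r\<^sup>2 \<le> (dist a x)\<^sup>2" using that assms by (intro power_mono) auto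
      then show ?thesis by (simp add: N flat_exp_nonpos)
    qed
  qed
qed

section \<open>Smooth functions and tangent vectors on a surface\<close>

locale surface =
  fixes A :: "'a::{t2_space,second_countable_topology} chart set"
  assumes smooth_surface: "smooth_surface A"
begin

lemma chart_cover: obtains c where "c \<in> A" "p \<in> fst c"
proof -
  have "(\<Union>c\<in>A. fst c) = UNIV" using smooth_surface by (simp add: smooth_surface_def)
  then show ?thesis using that by blast
qed

lemma chart_at: "chart_at A p \<in> A" "p \<in> fst (chart_at A p)"
proof -
  obtain c where "c \<in> A" "p \<in> fst c" by (rule chart_cover)
  then have "\<exists>c. c \<in> A \<and> p \<in> fst c" by blast
  from someI_ex[OF this] show "chart_at A p \<in> A" "p \<in> fst (chart_at A p)"
    by (simp_all add: chart_at_def)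
qed

lemma
  assumes "c \<in> A"
  shows open_chart_domain: "open (fst c)"
    and chart_homeomorphism: "homeomorphism (fst c) (snd c ` fst c) (snd c) (chart_inv c)"
    and open_chart_range: "open (snd c ` fst c)"
  using assms smooth_surface by (simp_all add: smooth_surface_def)

lemma chart_inv_left: "c \<in> A \<Longrightarrow> q \<in> fst c \<Longrightarrow> chart_inv c (snd c q) = q"
  using chart_homeomorphism homeomorphism_apply1 by blast

lemma open_chart_image:
  assumes "c \<in> A" "open U"
  shows "open (snd c ` (U \<inter> fst c))"
proof -
  have "openin (top_of_set (snd c ` fst c)) (snd c ` (fst c \<inter> U))"
    by (rule homeomorphism_imp_open_map[OF chart_homeomorphism[OF assms(1)]]) (simp add: assms openin_open_Int)
  then show ?thesis using open_chart_range[OF assms(1)] by (simp add: openin_open_eq Int_commute)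
qed

lemma smooth_transition:
  "c \<in> A \<Longrightarrow> c' \<in> A \<Longrightarrow> smooth_on (snd c ` (fst c \<inter> fst c')) (snd c' \<circ> chart_inv c)"
  using smooth_surface by (simp add: smooth_surface_def)

lemma smooth_fun_on_cong:
  assumes "smooth_fun_on A U f" "\<And>q. q \<in> U \<Longrightarrow> f q = g q"
  shows "smooth_fun_on A U g"
  unfolding smooth_fun_on_def
proof (intro conjI ballI)
  show "open U" using assms(1) by (simp add: smooth_fun_on_def)
  fix c assume "c \<in> A"
  show "smooth_on (snd c ` (U \<inter> fst c)) (g \<circ> chart_inv c)"
  proof (rule smooth_on_cong)
    show "smooth_on (snd c ` (U \<inter> fst c)) (f \<circ> chart_inv c)"
      using assms(1) \<open>c \<in> A\<close> by (simp add: smooth_fun_on_def)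
  qed (use open_chart_image[OF \<open>c \<in> A\<close> \<open>open U\<close>] assms(2) chart_inv_left[OF \<open>c \<in> A\<close>] in auto)
qed

lemma smooth_fun_on_subset:
  assumes "smooth_fun_on A U f" "open V" "V \<subseteq> U"
  shows "smooth_fun_on A V f"
  unfolding smooth_fun_on_def
proof (intro conjI ballI)
  fix c assume "c \<in> A"
  then have "smooth_on (snd c ` (U \<inter> fst c)) (f \<circ> chart_inv c)"
    using assms(1) by (simp add: smooth_fun_on_def)
  then show "smooth_on (snd c ` (V \<inter> fst c)) (f \<circ> chart_inv c)"
    by (rule smooth_on_subset[rotated]) (use assms(3) in auto)
qed fact

lemma smooth_near_cong:
  assumes "smooth_near A p f" "open V" "p \<in> V" "\<And>q. q \<in> V \<Longrightarrow> f q = g q"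
  shows "smooth_near A p g"
proof -
  obtain U where U: "p \<in> U" "smooth_fun_on A U f" using assms(1) by (auto simp: smooth_near_def)
  then have "open U" by (simp add: smooth_fun_on_def)
  have "smooth_fun_on A (U \<inter> V) g"
    by (rule smooth_fun_on_cong[OF smooth_fun_on_subset[OF U(2)]]) (use \<open>open U\<close> assms in auto)
  then show ?thesis using U(1) assms(3) unfolding smooth_near_def by blast
qed

lemma smooth_fun_on_iff_near:
  "smooth_fun_on A U f \<longleftrightarrow> open U \<and> (\<forall>p\<in>U. smooth_near A p f)" (is "?L \<longleftrightarrow> ?R")
proof
  assume ?L then show ?R by (auto simp: smooth_near_def smooth_fun_on_def)
next
  assume R: ?R
  show ?L unfolding smooth_fun_on_def
  proof (intro conjI ballI)
    show "open U" using R by simp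
    fix c assume c: "c \<in> A"
    show "smooth_on (snd c ` (U \<inter> fst c)) (f \<circ> chart_inv c)"
    proof (rule smooth_on_local[OF open_chart_image[OF c \<open>open U\<close>]])
      fix x assume "x \<in> snd c ` (U \<inter> fst c)"
      then obtain q where q: "q \<in> U" "q \<in> fst c" "x = snd c q" by auto
      with R obtain V where V: "q \<in> V" "smooth_fun_on A V f" by (auto simp: smooth_near_def)
      then have "open V" "smooth_on (snd c ` (V \<inter> fst c)) (f \<circ> chart_inv c)"
        using c by (auto simp: smooth_fun_on_def)
      then show "\<exists>W. open W \<and> x \<in> W \<and> smooth_on W (f \<circ> chart_inv c)"
        using open_chart_image[OF c] q V(1) by blast
    qed
  qed
qed

lemma smooth_near_obtain:
  assumes "smooth_near A p f" "smooth_near A p g"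
  obtains U where "p \<in> U" "smooth_fun_on A U f" "smooth_fun_on A U g"
proof -
  obtain U V where U: "p \<in> U" "smooth_fun_on A U f" and V: "p \<in> V" "smooth_fun_on A V g"
    using assms by (auto simp: smooth_near_def)
  then have "open (U \<inter> V)" by (auto simp: smooth_fun_on_def)
  then show ?thesis
    using U(1) V(1) smooth_fun_on_subset[OF U(2)] smooth_fun_on_subset[OF V(2)] by (intro that[of "U \<inter> V"]) auto
qed

lemma smooth_near_const: "smooth_near A p (\<lambda>q. a)"
  unfolding smooth_near_def smooth_fun_on_def
  by (rule exI[of _ UNIV]) (auto simp: comp_def intro: smooth_on_const open_chart_range)

lemma smooth_near_add:
  assumes "smooth_near A p f" "smooth_near A p g"
  shows "smooth_near A p (\<lambda>q. f q + g q)"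
proof -
  obtain U where U: "p \<in> U" "smooth_fun_on A U f" "smooth_fun_on A U g"
    using smooth_near_obtain[OF assms] .
  then have "smooth_fun_on A U (\<lambda>q. f q + g q)"
    by (auto simp: smooth_fun_on_def comp_def intro!: smooth_on_add open_chart_image)
  with U(1) show ?thesis by (auto simp: smooth_near_def)
qed

lemma smooth_near_mult:
  assumes "smooth_near A p f" "smooth_near A p g"
  shows "smooth_near A p (\<lambda>q. f q * g q)"
proof -
  obtain U where U: "p \<in> U" "smooth_fun_on A U f" "smooth_fun_on A U g"
    using smooth_near_obtain[OF assms] .
  then have "smooth_fun_on A U (\<lambda>q. f q * g q)"
    by (auto simp: smooth_fun_on_def comp_def intro!: smooth_on_mult open_chart_image)
  with U(1) show ?thesis by (auto simp: smooth_near_def)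
qed

lemma smooth_near_minus: "smooth_near A p f \<Longrightarrow> smooth_near A p (\<lambda>q. - f q)"
  using smooth_near_mult[OF smooth_near_const[of p "-1"], of f] by simp

lemma smooth_near_diff:
  "smooth_near A p f \<Longrightarrow> smooth_near A p g \<Longrightarrow> smooth_near A p (\<lambda>q. f q - g q)"
  using smooth_near_add[OF _ smooth_near_minus, of p f g] by simp

lemma smooth_fun_on_continuous:
  assumes "smooth_fun_on A U f"
  shows "continuous_on U f"
proof -
  have "open U" using assms by (simp add: smooth_fun_on_def)
  have "isCont f p" if "p \<in> U" for p
  proof -
    obtain c where c: "c \<in> A" "p \<in> fst c" by (rule chart_cover)
    have "continuous_on (snd c ` (U \<inter> fst c)) (f \<circ> chart_inv c)"
      using assms c by (intro smooth_on_imp_continuous_on) (simp add: smooth_fun_on_def)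
    moreover have "continuous_on (U \<inter> fst c) (snd c)"
      using chart_homeomorphism[OF c(1)] by (meson continuous_on_subset homeomorphism_cont1 inf_le2)
    ultimately have "continuous_on (U \<inter> fst c) ((f \<circ> chart_inv c) \<circ> snd c)"
      by (rule continuous_on_compose[rotated])
    then have "continuous_on (U \<inter> fst c) f"
      by (rule continuous_on_eq) (use chart_inv_left c in auto)
    then show ?thesis using that c \<open>open U\<close> open_chart_domain[OF c(1)]
      by (meson IntI continuous_on_eq_continuous_at open_Int)
  qed
  then show ?thesis by (auto intro: continuous_at_imp_continuous_on)
qed

lemma smooth_near_isCont: "smooth_near A p f \<Longrightarrow> isCont f p"
  unfolding smooth_near_def
  by (metis continuous_on_eq_continuous_at smooth_fun_on_continuous smooth_fun_on_def)

lemma smooth_near_nonzero: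
  assumes "smooth_near A p f" "f p \<noteq> 0"
  obtains U where "open U" "p \<in> U" "smooth_fun_on A U f" "\<And>q. q \<in> U \<Longrightarrow> f q \<noteq> 0"
proof -
  obtain V where V: "p \<in> V" "smooth_fun_on A V f" using assms(1) by (auto simp: smooth_near_def)
  then have o: "open V" by (simp add: smooth_fun_on_def)
  have "open (V \<inter> f -` (- {0}))"
    by (rule continuous_open_preimage[OF smooth_fun_on_continuous[OF V(2)] o]) auto
  then show ?thesis using V assms(2)
    by (intro that[of "V \<inter> f -` (- {0})"]) (auto intro: smooth_fun_on_subset)
qed

lemma smooth_near_divide:
  assumes "smooth_near A p f" "smooth_near A p g" "g p \<noteq> 0"
  shows "smooth_near A p (\<lambda>q. f q / g q)"
proof -
  obtain U where U: "open U" "p \<in> U" "smooth_fun_on A U g" "\<And>q. q \<in> U \<Longrightarrow> g q \<noteq> 0"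
    by (rule smooth_near_nonzero[OF assms(2,3)]) (rule that)
  obtain V where V: "p \<in> V" "smooth_fun_on A V f" using assms(1) by (auto simp: smooth_near_def)
  have o: "open V" using V by (simp add: smooth_fun_on_def)
  have "smooth_fun_on A (U \<inter> V) f" "smooth_fun_on A (U \<inter> V) g"
    using smooth_fun_on_subset U V o by (auto simp: open_Int)
  then have "smooth_fun_on A (U \<inter> V) (\<lambda>q. f q / g q)"
    unfolding smooth_fun_on_def comp_def
  proof (intro conjI ballI smooth_on_divide open_chart_image)
    fix c x assume "c \<in> A" "x \<in> snd c ` (U \<inter> V \<inter> fst c)"
    then show "g (chart_inv c x) \<noteq> 0" using U(4) chart_inv_left[OF \<open>c \<in> A\<close>] by auto
  qed auto
  then show ?thesis using U V by (auto simp: smooth_near_def)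
qed

text \<open>Smoothness in one chart implies smoothness in all others, as the transition maps are smooth.\<close>

lemma smooth_fun_on_chartI:
  assumes c: "c \<in> A" and "open U" "U \<subseteq> fst c" "smooth_on (snd c ` U) (f \<circ> chart_inv c)"
  shows "smooth_fun_on A U f"
  unfolding smooth_fun_on_def
proof (intro conjI ballI)
  fix c' assume c': "c' \<in> A"
  have o: "open (snd c' ` (U \<inter> fst c'))" by (rule open_chart_image[OF c' \<open>open U\<close>])
  have oc: "open (snd c ` U)" using open_chart_image[OF c \<open>open U\<close>] assms(3) by (simp add: Int_absorb2)
  have "smooth_on (snd c' ` (U \<inter> fst c')) (\<lambda>x. (f \<circ> chart_inv c) ((snd c \<circ> chart_inv c') x))"
  proof (rule smooth_on_compose[OF o oc _ assms(4)])
    show "smooth_on (snd c' ` (U \<inter> fst c')) (snd c \<circ> chart_inv c')"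
      by (rule smooth_on_subset[OF _ smooth_transition[OF c' c]]) (use assms(3) in auto)
  qed (use chart_inv_left[OF c'] in auto)
  then show "smooth_on (snd c' ` (U \<inter> fst c')) (f \<circ> chart_inv c')"
    by (rule smooth_on_cong[OF o, rotated]) (use assms(3) chart_inv_left[OF c] chart_inv_left[OF c'] in \<open>auto simp: subset_iff\<close>)
qed fact

lemma smooth_fun_on_chart_pullback:
  assumes "c \<in> A" "smooth_on (snd c ` fst c) g"
  shows "smooth_fun_on A (fst c) (\<lambda>q. g (snd c q))"
proof (rule smooth_fun_on_chartI[OF assms(1)])
  show "smooth_on (snd c ` fst c) ((\<lambda>q. g (snd c q)) \<circ> chart_inv c)"
    by (rule smooth_on_cong[OF open_chart_range[OF assms(1)] _ assms(2)]) (auto simp: chart_inv_left[OF assms(1)])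
qed (use open_chart_domain assms in auto)

lemma smooth_near_coord:
  assumes "c \<in> A" "p \<in> fst c"
  shows "smooth_near A p (coord c i)"
proof -
  have "smooth_on (snd c ` fst c) (\<lambda>x. x $ i)"
    using smooth_on_linear[OF bounded_linear_vec_nth _ smooth_on_id] open_chart_range[OF assms(1)] by blast
  from smooth_fun_on_chart_pullback[OF assms(1) this] show ?thesis
    using assms by (auto simp: smooth_fun_on_iff_near coord_def)
qed

subsection \<open>Tangent vectors\<close>

lemma smooth_near_has_derivative:
  assumes "smooth_near A p f" "c \<in> A" "p \<in> fst c"
  shows "((f \<circ> chart_inv c) has_derivative frechet_derivative (f \<circ> chart_inv c) (at (snd c p))) (at (snd c p))"
  using assms by (auto simp: smooth_near_def smooth_fun_on_def intro: smooth_on_has_derivative)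

lemma dir_deriv_change_chart:
  assumes c: "c \<in> A" "p \<in> fst c" and c': "c' \<in> A" "p \<in> fst c'"
  shows "dir_deriv A c' p w = dir_deriv A c p (frechet_derivative (snd c \<circ> chart_inv c') (at (snd c' p)) w)"
proof
  fix f
  show "dir_deriv A c' p w f = dir_deriv A c p (frechet_derivative (snd c \<circ> chart_inv c') (at (snd c' p)) w) f"
  proof (cases "smooth_near A p f")
    case True
    let ?G = "snd c \<circ> chart_inv c'" and ?S = "snd c' ` (fst c' \<inter> fst c)"
    have o: "open ?S" using open_chart_image[OF c'(1) open_chart_domain[OF c(1)]] by (simp add: Int_commute)
    have x: "snd c' p \<in> ?S" using c c' by auto
    have Gx: "?G (snd c' p) = snd c p" using chart_inv_left c c' by simp
    have "((\<lambda>x. (f \<circ> chart_inv c) (?G x)) has_derivative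
        (\<lambda>v. frechet_derivative (f \<circ> chart_inv c) (at (snd c p)) (frechet_derivative ?G (at (snd c' p)) v))) (at (snd c' p))"
      by (rule has_derivative_compose[OF smooth_on_has_derivative[OF smooth_transition[OF c'(1) c(1)] x]])
        (unfold Gx, rule smooth_near_has_derivative[OF True c])
    then have "((f \<circ> chart_inv c') has_derivative
        (\<lambda>v. frechet_derivative (f \<circ> chart_inv c) (at (snd c p)) (frechet_derivative ?G (at (snd c' p)) v))) (at (snd c' p))"
      by (rule has_derivative_transform_within_open[OF _ o x]) (use chart_inv_left[OF c(1)] chart_inv_left[OF c'(1)] in auto)
    from frechet_derivative_eqI[OF this] show ?thesis using True by (simp add: dir_deriv_def)
  qed (simp add: dir_deriv_def)
qed

lemma tangent_space_iff:
  assumes "c \<in> A" "p \<in> fst c"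
  shows "v \<in> tangent_space A p \<longleftrightarrow> (\<exists>w. v = dir_deriv A c p w)"
  using assms dir_deriv_change_chart[OF assms] unfolding tangent_space_def by blast

lemma dir_deriv_add:
  assumes "c \<in> A" "p \<in> fst c"
  shows "dir_deriv A c p (w + w') = add_vec (dir_deriv A c p w) (dir_deriv A c p w')"
  using linear_add[OF has_derivative_linear[OF smooth_near_has_derivative[OF _ assms]]]
  by (auto simp: dir_deriv_def add_vec_def)

lemma dir_deriv_scale:
  assumes "c \<in> A" "p \<in> fst c"
  shows "dir_deriv A c p (a *\<^sub>R w) = scale_vec a (dir_deriv A c p w)"
  using linear_scale[OF has_derivative_linear[OF smooth_near_has_derivative[OF _ assms]]]
  by (auto simp: dir_deriv_def scale_vec_def)

lemma tangent_add: "u \<in> tangent_space A p \<Longrightarrow> v \<in> tangent_space A p \<Longrightarrow> add_vec u v \<in> tangent_space A p"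
  using chart_at by (auto simp: tangent_space_iff[OF chart_at] dir_deriv_add[symmetric])

lemma tangent_scale: "u \<in> tangent_space A p \<Longrightarrow> scale_vec a u \<in> tangent_space A p"
  using chart_at by (auto simp: tangent_space_iff[OF chart_at] dir_deriv_scale[symmetric])

lemma coord_vec_tangent: "c \<in> A \<Longrightarrow> p \<in> fst c \<Longrightarrow> coord_vec A c i p \<in> tangent_space A p"
  by (auto simp: tangent_space_iff coord_vec_def)

lemma zero_tangent: "zero_vec \<in> tangent_space A p"
  using tangent_scale[OF coord_vec_tangent[OF chart_at], where a = 0] 
  by (simp add: scale_vec_def zero_vec_def)

lemma tangent_nonsmooth: "v \<in> tangent_space A p \<Longrightarrow> \<not> smooth_near A p f \<Longrightarrow> v f = 0"
  by (auto simp: tangent_space_def dir_deriv_def)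

lemma tangent_cong:
  assumes "v \<in> tangent_space A p" "open V" "p \<in> V" "\<And>q. q \<in> V \<Longrightarrow> f q = g q"
  shows "v f = v g"
proof (cases "smooth_near A p f")
  case True
  then have g: "smooth_near A p g" using smooth_near_cong assms by blast
  obtain c w where c: "c \<in> A" "p \<in> fst c" and v: "v = dir_deriv A c p w"
    using assms(1) by (auto simp: tangent_space_def)
  have o: "open (snd c ` (V \<inter> fst c))" by (rule open_chart_image[OF c(1) assms(2)])
  have "((g \<circ> chart_inv c) has_derivative frechet_derivative (f \<circ> chart_inv c) (at (snd c p))) (at (snd c p))"
    by (rule has_derivative_transform_within_open[OF smooth_near_has_derivative[OF True c] o])
      (use c assms chart_inv_left[OF c(1)] in auto)
  from frechet_derivative_eqI[OF this] show ?thesis by (simp add: v dir_deriv_def True g)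
next
  case False
  then have "\<not> smooth_near A p g" using smooth_near_cong[of p g V f] assms by auto
  then show ?thesis using False tangent_nonsmooth assms(1) by metis
qed

lemma tangent_fun_add:
  assumes "v \<in> tangent_space A p" "smooth_near A p f" "smooth_near A p g"
  shows "v (\<lambda>q. f q + g q) = v f + v g"
proof -
  obtain c w where c: "c \<in> A" "p \<in> fst c" and v: "v = dir_deriv A c p w"
    using assms(1) by (auto simp: tangent_space_def)
  have "((\<lambda>q. f q + g q) \<circ> chart_inv c has_derivative (\<lambda>w. frechet_derivative (f \<circ> chart_inv c) (at (snd c p)) w
      + frechet_derivative (g \<circ> chart_inv c) (at (snd c p)) w)) (at (snd c p))"
    using has_derivative_add[OF smooth_near_has_derivative[OF assms(2) c] smooth_near_has_derivative[OF assms(3) c]]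
    by (simp add: comp_def)
  from frechet_derivative_eqI[OF this] show ?thesis
    by (simp add: v dir_deriv_def smooth_near_add assms(2,3))
qed

lemma tangent_fun_mult:
  assumes "v \<in> tangent_space A p" "smooth_near A p f" "smooth_near A p g"
  shows "v (\<lambda>q. f q * g q) = f p * v g + v f * g p"
proof -
  obtain c w where c: "c \<in> A" "p \<in> fst c" and v: "v = dir_deriv A c p w"
    using assms(1) by (auto simp: tangent_space_def)
  have "((\<lambda>q. f q * g q) \<circ> chart_inv c has_derivative (\<lambda>w. f p * frechet_derivative (g \<circ> chart_inv c) (at (snd c p)) w
      + frechet_derivative (f \<circ> chart_inv c) (at (snd c p)) w * g p)) (at (snd c p))"
    using has_derivative_mult[OF smooth_near_has_derivative[OF assms(2) c] smooth_near_has_derivative[OF assms(3) c]]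
    by (simp add: comp_def chart_inv_left[OF c])
  from frechet_derivative_eqI[OF this] show ?thesis
    by (simp add: v dir_deriv_def smooth_near_mult assms(2,3))
qed

lemma tangent_fun_const:
  assumes "v \<in> tangent_space A p"
  shows "v (\<lambda>q. a) = 0"
proof -
  obtain c w where v: "v = dir_deriv A c p w"
    using assms(1) by (auto simp: tangent_space_def)
  have "((\<lambda>q. a) \<circ> chart_inv c has_derivative (\<lambda>w. 0)) (at (snd c p))" by (simp add: comp_def)
  from frechet_derivative_eqI[OF this] show ?thesis by (simp add: v dir_deriv_def)
qed

lemma dir_deriv_coord:
  assumes c: "c \<in> A" "p \<in> fst c"
  shows "dir_deriv A c p w (coord c i) = w $ i"
proof -
  have "((coord c i \<circ> chart_inv c) has_derivative (\<lambda>w. w $ i)) (at (snd c p))"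
  proof (rule has_derivative_transform_within_open)
    show "((\<lambda>x. x $ i) has_derivative (\<lambda>w. w $ i)) (at (snd c p))"
      by (rule bounded_linear_imp_has_derivative[OF bounded_linear_vec_nth])
    show "open (snd c ` fst c)" by (rule open_chart_range[OF c(1)])
  qed (use c in \<open>auto simp: coord_def chart_inv_left\<close>)
  from frechet_derivative_eqI[OF this] show ?thesis
    by (simp add: dir_deriv_def smooth_near_coord[OF c])
qed

lemma coord_vec_coord:
  "c \<in> A \<Longrightarrow> p \<in> fst c \<Longrightarrow> coord_vec A c i p (coord c j) = (if i = j then 1 else 0)"
  by (simp add: coord_vec_def dir_deriv_coord axis_def)

lemma tangent_eqI:
  assumes "c \<in> A" "p \<in> fst c" "u \<in> tangent_space A p" "v \<in> tangent_space A p"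
    and "\<And>i. u (coord c i) = v (coord c i)"
  shows "u = v"
proof -
  obtain w w' where "u = dir_deriv A c p w" "v = dir_deriv A c p w'"
    using assms(3,4) by (auto simp: tangent_space_iff[OF assms(1,2)])
  moreover from this have "w = w'" using assms(5) by (simp add: dir_deriv_coord[OF assms(1,2)] vec_eq_iff)
  ultimately show ?thesis by simp
qed

lemma tangent_nonzero_coord:
  assumes "c \<in> A" "p \<in> fst c" "v \<in> tangent_space A p" "v \<noteq> zero_vec"
  obtains k where "v (coord c k) \<noteq> 0"
proof -
  have "\<exists>k. v (coord c k) \<noteq> 0"
  proof (rule ccontr)
    assume "\<not> ?thesis"
    then have "v = zero_vec"
      by (intro tangent_eqI[OF assms(1-3) zero_tangent]) (auto simp: zero_vec_def)
    with assms(4) show False by simp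
  qed
  with that show ?thesis by blast
qed

lemma tangent_expansion:
  assumes c: "c \<in> A" "p \<in> fst c" and v: "v \<in> tangent_space A p"
  shows "v = add_vec (scale_vec (v (coord c 1)) (coord_vec A c 1 p)) (scale_vec (v (coord c 2)) (coord_vec A c 2 p))"
proof (rule tangent_eqI[OF c v])
  fix i :: 2
  show "v (coord c i) = add_vec (scale_vec (v (coord c 1)) (coord_vec A c 1 p))
       (scale_vec (v (coord c 2)) (coord_vec A c 2 p)) (coord c i)"
    using exhaust_2[of i] by (auto simp: add_vec_def scale_vec_def coord_vec_coord[OF c])
qed (intro tangent_add tangent_scale coord_vec_tangent c)

subsection \<open>Vector fields\<close>

lemma vector_fieldsI:
  assumes "\<And>p. X p \<in> tangent_space A p"
    and "\<And>p f. smooth_near A p f \<Longrightarrow> smooth_near A p (\<lambda>q. X q f)"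
  shows "X \<in> vector_fields A"
  using assms by (auto simp: vector_fields_def smooth_fun_on_iff_near)

lemma field_tangent: "X \<in> vector_fields A \<Longrightarrow> X p \<in> tangent_space A p"
  by (simp add: vector_fields_def)

lemma field_smooth_near: "X \<in> vector_fields A \<Longrightarrow> smooth_near A p f \<Longrightarrow> smooth_near A p (\<lambda>q. X q f)"
  unfolding smooth_near_def vector_fields_def by blast

lemma smooth_UNIV_near: "smooth_fun_on A UNIV f \<Longrightarrow> smooth_near A p f"
  by (auto simp: smooth_near_def)

lemma add_field_closed: "X \<in> vector_fields A \<Longrightarrow> Y \<in> vector_fields A \<Longrightarrow> add_field X Y \<in> vector_fields A"
  by (rule vector_fieldsI)
    (auto simp: add_field_def add_vec_def field_smooth_near smooth_near_add dest: field_tangent[of X] field_tangent[of Y]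
      intro: tangent_add[unfolded add_vec_def])

lemma scale_field_closed: "smooth_fun_on A UNIV f \<Longrightarrow> X \<in> vector_fields A \<Longrightarrow> scale_field f X \<in> vector_fields A"
  by (rule vector_fieldsI)
    (auto simp: scale_field_def scale_vec_def field_smooth_near smooth_UNIV_near smooth_near_mult
      intro: tangent_scale[unfolded scale_vec_def] field_tangent)

lemma smooth_UNIV_const: "smooth_fun_on A UNIV (\<lambda>q. a)"
  by (simp add: smooth_fun_on_iff_near smooth_near_const)

lemma coord_vec_smooth_near:
  assumes c: "c \<in> A" "p \<in> fst c" and f: "smooth_near A p f"
  shows "smooth_near A p (\<lambda>q. coord_vec A c i q f)"
proof -
  obtain U where U: "p \<in> U" "smooth_fun_on A U f" using f by (auto simp: smooth_near_def)
  let ?U = "U \<inter> fst c"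
  have o: "open ?U" using U open_chart_domain[OF c(1)] by (auto simp: smooth_fun_on_def)
  have s: "smooth_on (snd c ` ?U) (f \<circ> chart_inv c)" using U c by (simp add: smooth_fun_on_def)
  have "smooth_fun_on A ?U (\<lambda>q. coord_vec A c i q f)"
  proof (rule smooth_fun_on_chartI[OF c(1) o])
    have eq: "frechet_derivative (f \<circ> chart_inv c) (at x) (axis i 1)
        = ((\<lambda>q. coord_vec A c i q f) \<circ> chart_inv c) x" if x: "x \<in> snd c ` ?U" for x
    proof -
      obtain q where q: "q \<in> U" "q \<in> fst c" "x = snd c q" using x by auto
      have "smooth_near A q f" using U q by (auto simp: smooth_near_def)
      then show ?thesis using q by (simp add: coord_vec_def dir_deriv_def chart_inv_left[OF c(1)])
    qed
    have "open (snd c ` ?U)" using open_chart_image[OF c(1) o] by (simp add: Int_absorb2)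
    then show "smooth_on (snd c ` ?U) ((\<lambda>q. coord_vec A c i q f) \<circ> chart_inv c)"
      using smooth_on_cong[OF _ eq smooth_on_frechet[OF s]] by blast
  qed auto
  then show ?thesis using U(1) c(2) by (auto simp: smooth_near_def)
qed

text \<open>A closed ball in a chart is compact, hence closed in the Hausdorff surface. So a bump function
  supported in it remains smooth when it is extended by \<open>0\<close>.\<close>

lemma bump_function:
  assumes "open U" "p \<in> U"
  obtains \<psi> V K where "smooth_fun_on A UNIV \<psi>" "open V" "p \<in> V" "V \<subseteq> K" "K \<subseteq> U" "closed K"
    "\<And>q. q \<in> V \<Longrightarrow> \<psi> q = 1" "\<And>q. q \<notin> K \<Longrightarrow> \<psi> q = 0"
proof -
  obtain c where c: "c \<in> A" "p \<in> fst c" by (rule chart_cover)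
  have "open (snd c ` (U \<inter> fst c))" "snd c p \<in> snd c ` (U \<inter> fst c)"
    using open_chart_image[OF c(1) assms(1)] c assms by auto
  then obtain r where r: "r > 0" "cball (snd c p) r \<subseteq> snd c ` (U \<inter> fst c)"
    using open_contains_cball by blast
  obtain \<phi> :: "real^2 \<Rightarrow> real" where \<phi>: "smooth_on UNIV \<phi>" "\<And>x. x \<in> ball (snd c p) (r/2) \<Longrightarrow> \<phi> x = 1"
      "\<And>x. x \<notin> ball (snd c p) r \<Longrightarrow> \<phi> x = 0"
    by (rule euclidean_bump_function[OF r(1), of "snd c p"]) (rule that)
  define K where "K = chart_inv c ` cball (snd c p) r"
  define V where "V = fst c \<inter> snd c -` ball (snd c p) (r/2)"
  define \<psi> where "\<psi> = (\<lambda>q. if q \<in> fst c then \<phi> (snd c q) else 0)"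
  have KU: "K \<subseteq> U \<inter> fst c" using r(2) chart_inv_left[OF c(1)] by (force simp: K_def)
  have "continuous_on (cball (snd c p) r) (chart_inv c)"
    using chart_homeomorphism[OF c(1)] r(2) by (meson continuous_on_subset homeomorphism_cont2 image_mono inf_le2)
  then have "compact K" unfolding K_def by (rule compact_continuous_image) simp
  then have "closed K" by (rule compact_imp_closed)
  have inK: "q \<in> K" if "q \<in> fst c" "snd c q \<in> cball (snd c p) r" for q
    using that chart_inv_left[OF c(1)] unfolding K_def by (metis imageI)
  have psi0: "\<psi> q = 0" if "q \<notin> K" for q
    using inK[of q] that \<phi>(3)[of "snd c q"] by (cases "dist (snd c p) (snd c q) < r") (auto simp: \<psi>_def)
  show ?thesis
  proof (rule that[of \<psi> V K])
    have "smooth_near A q \<psi>" for q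
    proof (cases "q \<in> fst c")
      case True
      have "smooth_fun_on A (fst c) (\<lambda>q. \<phi> (snd c q))"
        by (rule smooth_fun_on_chart_pullback[OF c(1)]) (rule smooth_on_subset[OF _ \<phi>(1)], simp)
      then have "smooth_fun_on A (fst c) \<psi>" by (rule smooth_fun_on_cong) (simp add: \<psi>_def)
      then show ?thesis using True by (auto simp: smooth_near_def)
    next
      case False
      then have "q \<in> - K" using KU by auto
      then show ?thesis using psi0 \<open>closed K\<close>
        by (intro smooth_near_cong[OF smooth_near_const[of q 0], of "- K"]) auto
    qed
    then show "smooth_fun_on A UNIV \<psi>" by (simp add: smooth_fun_on_iff_near)
    show "open V" unfolding V_def
      using chart_homeomorphism[OF c(1)] open_chart_domain[OF c(1)]
      by (intro continuous_open_preimage) (auto simp: homeomorphism_def)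
    show "p \<in> V" using c r by (simp add: V_def)
    show "V \<subseteq> K" using inK r(1) by (fastforce simp: V_def)
    show "\<And>q. q \<in> V \<Longrightarrow> \<psi> q = 1" using \<phi>(2) by (auto simp: V_def \<psi>_def)
  qed (use KU \<open>closed K\<close> psi0 in auto)
qed

lemma extend_smooth_function:
  assumes "smooth_near A p f"
  obtains g V where "smooth_fun_on A UNIV g" "open V" "p \<in> V" "\<And>q. q \<in> V \<Longrightarrow> g q = f q"
proof -
  obtain U where U: "p \<in> U" "smooth_fun_on A U f" using assms by (auto simp: smooth_near_def)
  then have o: "open U" by (simp add: smooth_fun_on_def)
  obtain \<psi> V K where b: "smooth_fun_on A UNIV \<psi>" "open V" "p \<in> V" "V \<subseteq> K" "K \<subseteq> U" "closed K"
    "\<And>q. q \<in> V \<Longrightarrow> \<psi> q = 1" "\<And>q. q \<notin> K \<Longrightarrow> \<psi> q = 0"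
    using bump_function[OF o U(1)] by metis
  define g where "g = (\<lambda>q. if q \<in> U then \<psi> q * f q else 0)"
  have "smooth_near A q g" for q
  proof (cases "q \<in> U")
    case True
    have "smooth_near A q (\<lambda>q. \<psi> q * f q)"
      using True U(2) by (intro smooth_near_mult smooth_UNIV_near[OF b(1)]) (auto simp: smooth_near_def)
    then show ?thesis by (rule smooth_near_cong[OF _ o True]) (simp add: g_def)
  next
    case False
    then have "q \<in> - K" using b by auto
    then show ?thesis using b
      by (intro smooth_near_cong[OF smooth_near_const[of q 0], of "- K"]) (auto simp: g_def)
  qed
  then show ?thesis using b
    by (intro that[of g V]) (auto simp: smooth_fun_on_iff_near g_def)
qed

text \<open>The choice operators \<open>extend_coord\<close> and \<open>extend_vec\<close> pick fields with the intended properties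
  because \<open>\<psi> \<partial>\<^sub>i\<close>, extended by \<open>0\<close>, is a field for a bump function \<open>\<psi>\<close> supported in the chart.\<close>

lemma extend_coord_field:
  assumes c: "c \<in> A" "p \<in> fst c"
  shows "\<exists>X. X \<in> vector_fields A \<and> (\<exists>V. open V \<and> p \<in> V \<and> V \<subseteq> fst c \<and> (\<forall>q\<in>V. X q = coord_vec A c i q))"
proof -
  obtain \<psi> V K where b: "smooth_fun_on A UNIV \<psi>" "open V" "p \<in> V" "V \<subseteq> K" "K \<subseteq> fst c" "closed K"
    "\<And>q. q \<in> V \<Longrightarrow> \<psi> q = 1" "\<And>q. q \<notin> K \<Longrightarrow> \<psi> q = 0"
    using bump_function[OF open_chart_domain[OF c(1)] c(2)] by metis
  define X where "X = (\<lambda>q. if q \<in> fst c then scale_vec (\<psi> q) (coord_vec A c i q) else zero_vec)"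
  have "X \<in> vector_fields A"
  proof (rule vector_fieldsI)
    show "X q \<in> tangent_space A q" for q
      using coord_vec_tangent[OF c(1)] by (auto simp: X_def tangent_scale zero_tangent)
    fix q f assume f: "smooth_near A q f"
    show "smooth_near A q (\<lambda>q. X q f)"
    proof (cases "q \<in> fst c")
      case True
      have "smooth_near A q (\<lambda>q. \<psi> q * coord_vec A c i q f)"
        using True f by (intro smooth_near_mult smooth_UNIV_near[OF b(1)] coord_vec_smooth_near c)
      then show ?thesis
        by (rule smooth_near_cong[OF _ open_chart_domain[OF c(1)] True]) (simp add: X_def scale_vec_def)
    next
      case False
      then have "q \<in> - K" using b by auto
      then show ?thesis using b
        by (intro smooth_near_cong[OF smooth_near_const[of q 0], of "- K"]) (auto simp: X_def scale_vec_def zero_vec_def)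
    qed
  qed
  moreover have "\<forall>q\<in>V. X q = coord_vec A c i q" using b by (auto simp: X_def scale_vec_def)
  ultimately show ?thesis using b by (intro exI[of _ X] conjI exI[of _ V]) auto
qed

lemma extend_coord:
  assumes "c \<in> A" "p \<in> fst c"
  shows "extend_coord A c p i \<in> vector_fields A"
    and "\<exists>V. open V \<and> p \<in> V \<and> V \<subseteq> fst c \<and> (\<forall>q\<in>V. extend_coord A c p i q = coord_vec A c i q)"
  using someI_ex[OF extend_coord_field[OF assms, of i]] by (simp_all add: extend_coord_def)

lemma extend_coord_at: "c \<in> A \<Longrightarrow> p \<in> fst c \<Longrightarrow> extend_coord A c p i p = coord_vec A c i p"
  using extend_coord(2) by blast

lemma extend_coord_frame:
  assumes "c \<in> A" "p \<in> fst c"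
  obtains V where "open V" "p \<in> V" "V \<subseteq> fst c"
    "\<And>q i. q \<in> V \<Longrightarrow> extend_coord A c p i q = coord_vec A c i q"
proof -
  obtain V where V: "open (V i)" "p \<in> V i" "V i \<subseteq> fst c" "\<And>q. q \<in> V i \<Longrightarrow> extend_coord A c p i q = coord_vec A c i q" for i
    using extend_coord(2)[OF assms] by metis
  show ?thesis
  proof (rule that[of "V 1 \<inter> V 2"])
    fix q and i :: 2 assume "q \<in> V 1 \<inter> V 2"
    then show "extend_coord A c p i q = coord_vec A c i q" using V(4) exhaust_2[of i] by auto
  qed (use V in auto)
qed

lemma extend_vec:
  assumes "v \<in> tangent_space A p"
  shows "extend_vec A p v \<in> vector_fields A" "extend_vec A p v p = v"
proof -
  let ?c = "chart_at A p"
  let ?X = "add_field (scale_field (\<lambda>_. v (coord ?c 1)) (extend_coord A ?c p 1))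
    (scale_field (\<lambda>_. v (coord ?c 2)) (extend_coord A ?c p 2))"
  have "?X \<in> vector_fields A"
    by (intro add_field_closed scale_field_closed smooth_UNIV_const extend_coord chart_at)
  moreover have "?X p = v"
    using tangent_expansion[OF chart_at assms] by (simp add: add_field_def scale_field_def extend_coord_at chart_at)
  ultimately have "\<exists>X. X \<in> vector_fields A \<and> X p = v" by blast
  from someI_ex[OF this] show "extend_vec A p v \<in> vector_fields A" "extend_vec A p v p = v"
    by (simp_all add: extend_vec_def)
qed

end

abbreviation comb :: "real \<Rightarrow> 'a tangent \<Rightarrow> real \<Rightarrow> 'a tangent \<Rightarrow> 'a tangent" where
  "comb a u b v \<equiv> add_vec (scale_vec a u) (scale_vec b v)"

context surface
begin

section \<open>Tensoriality\<close>

text \<open>Covectors at \<open>p\<close>, as functionals on global vector fields: linearity over the smooth functions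
  turns out to force dependence on the value at \<open>p\<close> only.\<close>

definition tensorial_at :: "'a \<Rightarrow> ('a field \<Rightarrow> real) \<Rightarrow> bool" where
  "tensorial_at p L \<longleftrightarrow>
     (\<forall>X\<in>vector_fields A. \<forall>Y\<in>vector_fields A. L (add_field X Y) = L X + L Y) \<and>
     (\<forall>f. \<forall>X\<in>vector_fields A. smooth_fun_on A UNIV f \<longrightarrow> L (scale_field f X) = f p * L X)"

lemma tensorial_atI:
  assumes "\<And>X Y. X \<in> vector_fields A \<Longrightarrow> Y \<in> vector_fields A \<Longrightarrow> L (add_field X Y) = L X + L Y"
    and "\<And>f X. X \<in> vector_fields A \<Longrightarrow> smooth_fun_on A UNIV f \<Longrightarrow> L (scale_field f X) = f p * L X"
  shows "tensorial_at p L"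
  using assms by (simp add: tensorial_at_def)

lemma tensorial_add:
  "tensorial_at p L \<Longrightarrow> X \<in> vector_fields A \<Longrightarrow> Y \<in> vector_fields A \<Longrightarrow> L (add_field X Y) = L X + L Y"
  by (simp add: tensorial_at_def)

lemma tensorial_scale:
  "tensorial_at p L \<Longrightarrow> X \<in> vector_fields A \<Longrightarrow> smooth_fun_on A UNIV f \<Longrightarrow> L (scale_field f X) = f p * L X"
  by (simp add: tensorial_at_def)

lemma tensorial_sum:
  assumes "\<And>i. i \<in> I \<Longrightarrow> tensorial_at p (L i)"
  shows "tensorial_at p (\<lambda>X. \<Sum>i\<in>I. L i X)"
proof (rule tensorial_atI)
  fix X Y assume XY: "X \<in> vector_fields A" "Y \<in> vector_fields A"
  show "(\<Sum>i\<in>I. L i (add_field X Y)) = (\<Sum>i\<in>I. L i X) + (\<Sum>i\<in>I. L i Y)"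
    unfolding sum.distrib[symmetric] by (intro sum.cong refl tensorial_add[OF assms] XY)
next
  fix f X assume X: "X \<in> vector_fields A" and f: "smooth_fun_on A UNIV f"
  show "(\<Sum>i\<in>I. L i (scale_field f X)) = f p * (\<Sum>i\<in>I. L i X)"
    unfolding sum_distrib_left by (intro sum.cong refl tensorial_scale[OF assms] X f)
qed

text \<open>If \<open>\<psi>\<close> is a bump function at \<open>p\<close> supported in \<open>V\<close>, then \<open>\<psi> X = 0\<close>, and
  \<open>L (\<psi> X) = \<psi>(p) L X = L X\<close>.\<close>

lemma tensorial_local:
  assumes L: "tensorial_at p L" and X: "X \<in> vector_fields A"
    and V: "open V" "p \<in> V" "\<And>q. q \<in> V \<Longrightarrow> X q = zero_vec"
  shows "L X = 0"
proof -
  obtain \<psi> W K where b: "smooth_fun_on A UNIV \<psi>" "open W" "p \<in> W" "W \<subseteq> K" "K \<subseteq> V" "closed K"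
    "\<And>q. q \<in> W \<Longrightarrow> \<psi> q = 1" "\<And>q. q \<notin> K \<Longrightarrow> \<psi> q = 0"
    using bump_function[OF V(1,2)] by metis
  have "scale_vec (\<psi> q) (X q) = scale_vec 0 (X q)" for q
  proof (cases "q \<in> K")
    case True
    then have "X q = zero_vec" using b(5) V(3) by blast
    then show ?thesis by (simp add: scale_vec_def zero_vec_def)
  next
    case False
    then show ?thesis using b(8) by simp
  qed
  then have "scale_field \<psi> X = scale_field (\<lambda>_. 0) X" by (simp add: scale_field_def)
  then have "\<psi> p * L X = 0 * L X"
    using tensorial_scale[OF L X b(1)] tensorial_scale[OF L X smooth_UNIV_const[of 0]] by simp
  then show ?thesis using b(3,7) by simp
qed

text \<open>Near \<open>p\<close>, the field \<open>X\<close> is a combination of the extended coordinate fields with globally defined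
  smooth coefficients, and \<open>L\<close> does not see the difference by \<open>tensorial_local\<close>.\<close>

lemma tensorial_expansion:
  assumes L: "tensorial_at p L" and X: "X \<in> vector_fields A" and c: "c \<in> A" "p \<in> fst c"
  shows "L X = X p (coord c 1) * L (extend_coord A c p 1) + X p (coord c 2) * L (extend_coord A c p 2)"
proof -
  let ?E = "extend_coord A c p"
  obtain V where V: "open V" "p \<in> V" "V \<subseteq> fst c" "\<And>q i. q \<in> V \<Longrightarrow> ?E i q = coord_vec A c i q"
    using extend_coord_frame[OF c] by metis
  have "\<exists>g W. smooth_fun_on A UNIV g \<and> open W \<and> p \<in> W \<and> (\<forall>q\<in>W. g q = X q (coord c i))" for i
    using extend_smooth_function[OF field_smooth_near[OF X smooth_near_coord[OF c, of i]]] by metis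
  then obtain g W where g: "smooth_fun_on A UNIV (g i)" "open (W i)" "p \<in> W i"
    "\<And>q. q \<in> W i \<Longrightarrow> g i q = X q (coord c i)" for i by metis
  let ?Y = "add_field (scale_field (g 1) (?E 1)) (scale_field (g 2) (?E 2))"
  let ?Z = "add_field X (scale_field (\<lambda>_. - 1) ?Y)"
  have cl: "?E i \<in> vector_fields A" "?Y \<in> vector_fields A" "?Z \<in> vector_fields A" for i
    by (intro add_field_closed scale_field_closed smooth_UNIV_const extend_coord c X g)+
  have "L ?Z = 0"
  proof (rule tensorial_local[OF L cl(3), of "V \<inter> W 1 \<inter> W 2"])
    fix q assume q: "q \<in> V \<inter> W 1 \<inter> W 2"
    then have "X q = comb (X q (coord c 1)) (coord_vec A c 1 q) (X q (coord c 2)) (coord_vec A c 2 q)"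
      using V(3) by (intro tangent_expansion field_tangent X c) auto
    then have Y: "?Y q = X q" using q g(4) V(4) by (simp add: add_field_def scale_field_def)
    have "?Z q = add_vec (X q) (scale_vec (- 1) (?Y q))"
      by (simp only: add_field_def[of X] scale_field_def[of "\<lambda>_. - 1"])
    then show "?Z q = zero_vec"
      unfolding Y by (simp add: add_vec_def scale_vec_def zero_vec_def)
  qed (use open_Int[OF open_Int[OF V(1) g(2)] g(2)] V(2) g(3) in auto)
  moreover have "L ?Z = L X + - 1 * (g 1 p * L (?E 1) + g 2 p * L (?E 2))"
    by (simp add: tensorial_add[OF L] tensorial_scale[OF L] cl X g(1) scale_field_closed smooth_UNIV_const)
  ultimately show ?thesis using g(3,4) by simp
qed

lemma tensorial_comb:
  assumes L: "tensorial_at p L" and "X \<in> vector_fields A" "Y \<in> vector_fields A" "Z \<in> vector_fields A"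
    and "X p = comb a (Y p) b (Z p)"
  shows "L X = a * L Y + b * L Z"
  unfolding tensorial_expansion[OF L assms(2) chart_at] tensorial_expansion[OF L assms(3) chart_at]
    tensorial_expansion[OF L assms(4) chart_at] assms(5)
  by (simp add: add_vec_def scale_vec_def algebra_simps)

lemma tensorial_cong:
  assumes "tensorial_at p L" "X \<in> vector_fields A" "Y \<in> vector_fields A" "X p = Y p"
  shows "L X = L Y"
  using tensorial_comb[OF assms(1-3,3), of 1 0] assms(4) by (simp add: add_vec_def scale_vec_def)

text \<open>In a plane two spanning vectors are a basis; spanning is the part that is used directly.\<close>

definition frame_at :: "'a \<Rightarrow> 'a tangent \<Rightarrow> 'a tangent \<Rightarrow> bool" where
  "frame_at p u v \<longleftrightarrow> u \<in> tangent_space A p \<and> v \<in> tangent_space A p \<and>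
     (\<forall>w\<in>tangent_space A p. \<exists>a b. w = comb a u b v)"

lemma frame_coord: "c \<in> A \<Longrightarrow> p \<in> fst c \<Longrightarrow> frame_at p (coord_vec A c 1 p) (coord_vec A c 2 p)"
  unfolding frame_at_def using tangent_expansion coord_vec_tangent by blast

lemma frame_comb:
  assumes "frame_at p u v" "w \<in> tangent_space A p"
  obtains a b where "w = comb a u b v"
  using assms by (auto simp: frame_at_def)

text \<open>The trace is defined with the chart chosen at \<open>p\<close>; it may be computed in any basis instead.\<close>

lemma trace_frame:
  assumes fr: "frame_at p u v"
    and lin: "\<And>a b. L (comb a u b v) = comb a (L u) b (L v)"
    and Lu: "L u = comb \<alpha> u \<beta> v" and Lv: "L v = comb \<gamma> u \<delta> v"
  shows "tangent_trace A p L = \<alpha> + \<delta>"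
proof -
  let ?c = "chart_at A p"
  have "coord_vec A ?c 1 p \<in> tangent_space A p" "coord_vec A ?c 2 p \<in> tangent_space A p"
    by (intro coord_vec_tangent chart_at)+
  then obtain a1 b1 a2 b2 where e: "coord_vec A ?c 1 p = comb a1 u b1 v" "coord_vec A ?c 2 p = comb a2 u b2 v"
    using fr by (metis frame_at_def)
  let ?x = "u (coord ?c 1)" and ?y = "v (coord ?c 1)" and ?z = "u (coord ?c 2)" and ?w = "v (coord ?c 2)"
  have "coord_vec A ?c i p (coord ?c j) = (if i = j then 1 else 0)" for i j
    by (rule coord_vec_coord[OF chart_at])
  from this[of 1 1] this[of 1 2] this[of 2 1] this[of 2 2]
  have i: "a1 * ?x + b1 * ?y = 1" "a1 * ?z + b1 * ?w = 0" "a2 * ?x + b2 * ?y = 0" "a2 * ?z + b2 * ?w = 1"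
    by (simp_all add: e add_vec_def scale_vec_def)
  \<comment> \<open>A right inverse of a matrix is also a left inverse.\<close>
  then have j: "a1 * ?x + a2 * ?z = 1" "a1 * ?y + a2 * ?w = 0" "b1 * ?x + b2 * ?z = 0" "b1 * ?y + b2 * ?w = 1"
    by algebra+
  have "tangent_trace A p L = L (coord_vec A ?c 1 p) (coord ?c 1) + L (coord_vec A ?c 2 p) (coord ?c 2)"
    by (simp add: tangent_trace_def sum_2)
  also have "\<dots> = \<alpha> * (a1 * ?x + a2 * ?z) + \<beta> * (a1 * ?y + a2 * ?w) + \<gamma> * (b1 * ?x + b2 * ?z) + \<delta> * (b1 * ?y + b2 * ?w)"
    unfolding e lin Lu Lv by (simp add: add_vec_def scale_vec_def algebra_simps)
  finally show ?thesis unfolding j by simp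
qed

end

section \<open>Connections and their curvature\<close>

locale affine_surface = surface A
  for A :: "'a::{t2_space,second_countable_topology} chart set" +
  fixes D :: "'a field \<Rightarrow> 'a field \<Rightarrow> 'a field"
  assumes connection: "affine_connection A D"
    and torsion_free: "torsion_free A D"
begin

lemma D_closed: "X \<in> vector_fields A \<Longrightarrow> Y \<in> vector_fields A \<Longrightarrow> D X Y \<in> vector_fields A"
  using connection by (simp add: affine_connection_def)

lemma D_add_left:
  "X \<in> vector_fields A \<Longrightarrow> X' \<in> vector_fields A \<Longrightarrow> Y \<in> vector_fields A \<Longrightarrow>
    D (add_field X X') Y = add_field (D X Y) (D X' Y)"
  using connection by (simp add: affine_connection_def)

lemma D_scale_left:
  "X \<in> vector_fields A \<Longrightarrow> Y \<in> vector_fields A \<Longrightarrow> smooth_fun_on A UNIV f \<Longrightarrow>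
    D (scale_field f X) Y = scale_field f (D X Y)"
  using connection by (simp add: affine_connection_def)

lemma D_add_right:
  "X \<in> vector_fields A \<Longrightarrow> Y \<in> vector_fields A \<Longrightarrow> Y' \<in> vector_fields A \<Longrightarrow>
    D X (add_field Y Y') = add_field (D X Y) (D X Y')"
  using connection by (simp add: affine_connection_def)

lemma D_scale_right:
  "X \<in> vector_fields A \<Longrightarrow> Y \<in> vector_fields A \<Longrightarrow> smooth_fun_on A UNIV f \<Longrightarrow>
    D X (scale_field f Y) = add_field (scale_field (\<lambda>p. X p f) Y) (scale_field f (D X Y))"
  using connection by (simp add: affine_connection_def)

text \<open>Without torsion, brackets can be eliminated in favour of the connection. In particular, brackets
  of vector fields are vector fields, without any computation in coordinates.\<close>

lemma bracket_torsion_free: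
  assumes "X \<in> vector_fields A" "Y \<in> vector_fields A"
  shows "lie_bracket A X Y = add_field (D X Y) (scale_field (\<lambda>_. - 1) (D Y X))"
  using torsion_free assms
  by (auto simp: torsion_free_def add_field_def scale_field_def add_vec_def scale_vec_def intro!: ext)

lemma bracket_closed:
  "X \<in> vector_fields A \<Longrightarrow> Y \<in> vector_fields A \<Longrightarrow> lie_bracket A X Y \<in> vector_fields A"
  by (simp add: bracket_torsion_free add_field_closed scale_field_closed smooth_UNIV_const D_closed)

lemmas field_defs = add_field_def scale_field_def add_vec_def scale_vec_def

lemma tensorial_D: "Y \<in> vector_fields A \<Longrightarrow> tensorial_at p (\<lambda>X. D X Y p f)"
  by (rule tensorial_atI, simp_all add: D_add_left D_scale_left) (simp_all add: field_defs)

lemma D_zero: "X \<in> vector_fields A \<Longrightarrow> D X (\<lambda>q. zero_vec) p = zero_vec"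
proof -
  assume X: "X \<in> vector_fields A"
  have z: "(\<lambda>q. zero_vec) = scale_field (\<lambda>_. 0) X" by (simp add: field_defs zero_vec_def)
  have "D X (\<lambda>q. zero_vec) = add_field (scale_field (\<lambda>p. X p (\<lambda>_. 0)) X) (scale_field (\<lambda>_. 0) (D X X))"
    unfolding z by (rule D_scale_right[OF X X smooth_UNIV_const])
  then show ?thesis using tangent_fun_const[OF field_tangent[OF X]] by (simp add: field_defs zero_vec_def)
qed

text \<open>Locality of connections: if \<open>\<psi>\<close> is a bump function at \<open>p\<close> supported in \<open>V\<close>, then \<open>\<psi> Y = 0\<close>, and the
  product rule at \<open>p\<close>, where \<open>Y\<close> vanishes, gives \<open>0 = D\<^sub>X Y\<close>.\<close>

lemma D_local_zero:
  assumes X: "X \<in> vector_fields A" and Y: "Y \<in> vector_fields A"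
    and V: "open V" "p \<in> V" "\<And>q. q \<in> V \<Longrightarrow> Y q = zero_vec"
  shows "D X Y p = zero_vec"
proof -
  obtain \<psi> W K where b: "smooth_fun_on A UNIV \<psi>" "open W" "p \<in> W" "W \<subseteq> K" "K \<subseteq> V" "closed K"
    "\<And>q. q \<in> W \<Longrightarrow> \<psi> q = 1" "\<And>q. q \<notin> K \<Longrightarrow> \<psi> q = 0"
    using bump_function[OF V(1,2)] by metis
  have "scale_vec (\<psi> q) (Y q) = zero_vec" for q
  proof (cases "q \<in> K")
    case True
    then have "Y q = zero_vec" using b(5) V(3) by blast
    then show ?thesis by (simp add: scale_vec_def zero_vec_def)
  next
    case False
    then show ?thesis using b(8) by (simp add: scale_vec_def zero_vec_def)
  qed
  then have "scale_field \<psi> Y = (\<lambda>q. zero_vec)" by (simp add: scale_field_def)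
  then have "add_field (scale_field (\<lambda>p. X p \<psi>) Y) (scale_field \<psi> (D X Y)) p = zero_vec"
    using D_scale_right[OF X Y b(1)] D_zero[OF X] by simp
  then show ?thesis using b(3,7) V(3)[OF V(2)] by (simp add: field_defs zero_vec_def)
qed

lemma D_local:
  assumes X: "X \<in> vector_fields A" and Y: "Y \<in> vector_fields A" "Y' \<in> vector_fields A"
    and V: "open V" "p \<in> V" "\<And>q. q \<in> V \<Longrightarrow> Y q = Y' q"
  shows "D X Y p = D X Y' p"
proof -
  let ?N = "scale_field (\<lambda>_. - 1) Y'"
  have N: "?N \<in> vector_fields A" by (intro scale_field_closed smooth_UNIV_const Y)
  have "D X (add_field Y ?N) p = zero_vec"
    by (rule D_local_zero[OF X add_field_closed[OF Y(1) N] V(1,2)]) (simp add: V(3) field_defs zero_vec_def)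
  then have "\<And>f. D X Y p f - D X Y' p f = 0"
    unfolding D_add_right[OF X Y(1) N] D_scale_right[OF X Y(2) smooth_UNIV_const]
    using tangent_fun_const[OF field_tangent[OF X]]
    by (auto simp: field_defs zero_vec_def dest: fun_cong)
  then show ?thesis by (intro ext) simp
qed

text \<open>The product rule for coefficients that are only defined near \<open>p\<close>, as the components of \<open>Y\<close> in a
  local frame are.\<close>

lemma D_expansion:
  assumes X: "X \<in> vector_fields A" and Y: "Y \<in> vector_fields A"
    and F: "F1 \<in> vector_fields A" "F2 \<in> vector_fields A"
    and V: "open V" "p \<in> V" "\<And>q. q \<in> V \<Longrightarrow> Y q = comb (h1 q) (F1 q) (h2 q) (F2 q)"
    and h: "smooth_near A p h1" "smooth_near A p h2"
  shows "D X Y p f = X p h1 * F1 p f + h1 p * D X F1 p f + X p h2 * F2 p f + h2 p * D X F2 p f"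
proof -
  obtain g1 W1 where g1: "smooth_fun_on A UNIV g1" "open W1" "p \<in> W1" "\<And>q. q \<in> W1 \<Longrightarrow> g1 q = h1 q"
    using extend_smooth_function[OF h(1)] by metis
  obtain g2 W2 where g2: "smooth_fun_on A UNIV g2" "open W2" "p \<in> W2" "\<And>q. q \<in> W2 \<Longrightarrow> g2 q = h2 q"
    using extend_smooth_function[OF h(2)] by metis
  let ?Y = "add_field (scale_field g1 F1) (scale_field g2 F2)"
  have cl: "scale_field g1 F1 \<in> vector_fields A" "scale_field g2 F2 \<in> vector_fields A"
    by (intro scale_field_closed g1 g2 F)+
  have "D X Y p = D X ?Y p"
    by (rule D_local[OF X Y add_field_closed[OF cl], of "V \<inter> W1 \<inter> W2"])
      (use V g1 g2 in \<open>auto simp: add_field_def scale_field_def\<close>)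
  moreover have "X p g1 = X p h1" by (rule tangent_cong[OF field_tangent[OF X] g1(2-4)])
  moreover have "X p g2 = X p h2" by (rule tangent_cong[OF field_tangent[OF X] g2(2-4)])
  ultimately show ?thesis
    using g1(3,4) g2(3,4)
    by (simp add: D_add_right[OF X cl] D_scale_right[OF X F(1) g1(1)] D_scale_right[OF X F(2) g2(1)])
      (simp add: field_defs)
qed

lemma bracket_add:
  assumes "X \<in> vector_fields A" "X' \<in> vector_fields A" "Y \<in> vector_fields A"
  shows "lie_bracket A (add_field X X') Y = add_field (lie_bracket A X Y) (lie_bracket A X' Y)"
  using assms by (simp add: bracket_torsion_free add_field_closed D_add_left D_add_right)
    (simp add: field_defs fun_eq_iff)

lemma bracket_scale:
  assumes "X \<in> vector_fields A" "Y \<in> vector_fields A" "smooth_fun_on A UNIV h"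
  shows "lie_bracket A (scale_field h X) Y
    = add_field (scale_field h (lie_bracket A X Y)) (scale_field (\<lambda>p. - Y p h) X)"
  using assms by (simp add: bracket_torsion_free scale_field_closed D_scale_left D_scale_right)
    (simp add: field_defs fun_eq_iff algebra_simps)

lemma bracket_anti:
  "X \<in> vector_fields A \<Longrightarrow> Y \<in> vector_fields A \<Longrightarrow> lie_bracket A Y X = scale_field (\<lambda>_. - 1) (lie_bracket A X Y)"
  by (simp add: bracket_torsion_free) (simp add: field_defs fun_eq_iff)

lemma curvature_eq:
  "curvature A D X Y Z = add_field (add_field (D X (D Y Z)) (scale_field (\<lambda>_. - 1) (D Y (D X Z))))
     (scale_field (\<lambda>_. - 1) (D (lie_bracket A X Y) Z))"
  by (simp add: curvature_def field_defs fun_eq_iff)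

lemma curvature_closed:
  "X \<in> vector_fields A \<Longrightarrow> Y \<in> vector_fields A \<Longrightarrow> Z \<in> vector_fields A \<Longrightarrow> curvature A D X Y Z \<in> vector_fields A"
  unfolding curvature_eq
  by (intro add_field_closed scale_field_closed smooth_UNIV_const D_closed bracket_closed)

lemma curvature_anti:
  assumes "X \<in> vector_fields A" "Y \<in> vector_fields A" "Z \<in> vector_fields A"
  shows "curvature A D Y X Z p f = - curvature A D X Y Z p f"
  using assms by (simp add: curvature_def bracket_anti[of X Y] D_scale_left bracket_closed smooth_UNIV_const)
    (simp add: field_defs)

lemma smooth_UNIV_field: "X \<in> vector_fields A \<Longrightarrow> smooth_fun_on A UNIV h \<Longrightarrow> smooth_fun_on A UNIV (\<lambda>p. X p h)"
  by (simp add: smooth_fun_on_iff_near field_smooth_near)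

lemma smooth_UNIV_minus: "smooth_fun_on A UNIV h \<Longrightarrow> smooth_fun_on A UNIV (\<lambda>p. - h p)"
  by (simp add: smooth_fun_on_iff_near smooth_near_minus)

text \<open>In \<open>R(hX,Y)Z\<close> the derivative \<open>Y h\<close> occurs in \<open>D\<^sub>Y D\<^bsub>hX\<^esub> Z\<close> and in
  \<open>[hX,Y] = h [X,Y] - (Y h) X\<close>, and cancels.\<close>

lemma tensorial_curvature_1:
  assumes YZ: "Y \<in> vector_fields A" "Z \<in> vector_fields A"
  shows "tensorial_at p (\<lambda>X. curvature A D X Y Z p f)"
proof (rule tensorial_atI)
  fix X X' assume X: "X \<in> vector_fields A" "X' \<in> vector_fields A"
  show "curvature A D (add_field X X') Y Z p f = curvature A D X Y Z p f + curvature A D X' Y Z p f"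
    using X YZ by (simp add: curvature_def bracket_add D_add_left D_add_right D_closed bracket_closed)
      (simp add: field_defs)
next
  fix h X assume X: "X \<in> vector_fields A" and h: "smooth_fun_on A UNIV h"
  have c: "scale_field h (lie_bracket A X Y) \<in> vector_fields A" "scale_field (\<lambda>p. - Y p h) X \<in> vector_fields A"
    by (intro scale_field_closed smooth_UNIV_minus smooth_UNIV_field[OF _ h] bracket_closed X YZ h)+
  show "curvature A D (scale_field h X) Y Z p f = h p * curvature A D X Y Z p f"
    using X YZ h
    by (simp add: curvature_def bracket_scale D_add_left[OF c] D_scale_left D_scale_right D_closed bracket_closed
        smooth_UNIV_minus smooth_UNIV_field)
      (simp add: field_defs algebra_simps)
qed

lemma tensorial_curvature_2:
  assumes "X \<in> vector_fields A" "Z \<in> vector_fields A"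
  shows "tensorial_at p (\<lambda>Y. curvature A D X Y Z p f)"
proof (rule tensorial_atI)
  fix Y Y' assume Y: "Y \<in> vector_fields A" "Y' \<in> vector_fields A"
  show "curvature A D X (add_field Y Y') Z p f = curvature A D X Y Z p f + curvature A D X Y' Z p f"
    using curvature_anti[OF _ assms(1,2)] tensorial_add[OF tensorial_curvature_1[OF assms] Y] Y
    by (simp add: add_field_closed)
next
  fix h Y assume Y: "Y \<in> vector_fields A" and h: "smooth_fun_on A UNIV h"
  show "curvature A D X (scale_field h Y) Z p f = h p * curvature A D X Y Z p f"
    using curvature_anti[OF _ assms(1,2)] tensorial_scale[OF tensorial_curvature_1[OF assms] Y h] Y h
    by (simp add: scale_field_closed)
qed

text \<open>The second derivatives of \<open>h\<close> in \<open>R(X,Y)(hZ)\<close> add up to \<open>X(Y h) - Y(X h) - [X,Y] h = 0\<close>.\<close>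

lemma tensorial_curvature_3:
  assumes XY: "X \<in> vector_fields A" "Y \<in> vector_fields A"
  shows "tensorial_at p (\<lambda>Z. curvature A D X Y Z p f)"
proof (rule tensorial_atI)
  fix Z Z' assume "Z \<in> vector_fields A" "Z' \<in> vector_fields A"
  then show "curvature A D X Y (add_field Z Z') p f = curvature A D X Y Z p f + curvature A D X Y Z' p f"
    using XY by (simp add: curvature_def D_add_right D_closed bracket_closed) (simp add: field_defs)
next
  fix h Z assume Z: "Z \<in> vector_fields A" and h: "smooth_fun_on A UNIV h"
  have c: "scale_field (\<lambda>p. W p h) Z \<in> vector_fields A" "scale_field h (D W Z) \<in> vector_fields A"
    if "W \<in> vector_fields A" for W
    by (intro scale_field_closed smooth_UNIV_field[OF _ h] D_closed that Z h)+
  have D2: "D V (D W (scale_field h Z)) p f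
      = V p (\<lambda>q. W q h) * Z p f + W p h * D V Z p f + V p h * D W Z p f + h p * D V (D W Z) p f"
    if V: "V \<in> vector_fields A" and W: "W \<in> vector_fields A" for V W
    using V W Z h by (simp add: D_scale_right D_add_right[OF V c[OF W]] smooth_UNIV_field D_closed)
      (simp add: field_defs)
  have br: "lie_bracket A X Y p h = X p (\<lambda>q. Y q h) - Y p (\<lambda>q. X q h)"
    using h by (simp add: lie_bracket_def smooth_UNIV_near)
  show "curvature A D X Y (scale_field h Z) p f = h p * curvature A D X Y Z p f"
    unfolding curvature_def D2[OF XY] D2[OF XY(2,1)] D_scale_right[OF bracket_closed[OF XY] Z h]
    by (simp add: field_defs br algebra_simps)
qed

section \<open>The Ricci tensor\<close>

lemma ricci_eq:
  "ricci A D X Y p = (\<Sum>i\<in>UNIV. curvature A D (extend_vec A p (coord_vec A (chart_at A p) i p)) X Y p (coord (chart_at A p) i))"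
  by (simp add: ricci_def tangent_trace_def)

lemma ext_coord_closed: "extend_vec A p (coord_vec A (chart_at A p) i p) \<in> vector_fields A"
  by (intro extend_vec coord_vec_tangent chart_at)

lemma tensorial_ricci_1: "Y \<in> vector_fields A \<Longrightarrow> tensorial_at p (\<lambda>X. ricci A D X Y p)"
  unfolding ricci_eq by (intro tensorial_sum tensorial_curvature_2 ext_coord_closed)

lemma tensorial_ricci_2: "X \<in> vector_fields A \<Longrightarrow> tensorial_at p (\<lambda>Y. ricci A D X Y p)"
  unfolding ricci_eq by (intro tensorial_sum tensorial_curvature_3 ext_coord_closed)

lemma ricci_frame:
  assumes F: "F1 \<in> vector_fields A" "F2 \<in> vector_fields A" "frame_at p (F1 p) (F2 p)"
    and XY: "X \<in> vector_fields A" "Y \<in> vector_fields A"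
    and R: "curvature A D F1 X Y p = comb \<alpha> (F1 p) \<beta> (F2 p)" "curvature A D F2 X Y p = comb \<gamma> (F1 p) \<delta> (F2 p)"
  shows "ricci A D X Y p = \<alpha> + \<delta>"
  unfolding ricci_def
proof (rule trace_frame[OF F(3)])
  have t: "F1 p \<in> tangent_space A p" "F2 p \<in> tangent_space A p" by (intro field_tangent F)+
  have e: "curvature A D (extend_vec A p (comb a (F1 p) b (F2 p))) X Y p
      = comb a (curvature A D F1 X Y p) b (curvature A D F2 X Y p)" for a b
  proof
    fix f
    show "curvature A D (extend_vec A p (comb a (F1 p) b (F2 p))) X Y p f
      = comb a (curvature A D F1 X Y p) b (curvature A D F2 X Y p) f"
      using tensorial_comb[OF tensorial_curvature_1[OF XY] extend_vec(1) F(1,2) extend_vec(2)] t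
      by (simp add: tangent_add tangent_scale) (simp add: add_vec_def scale_vec_def)
  qed
  have c: "comb 1 u 0 v = u" "comb 0 u 1 v = v" for u v :: "'a tangent"
    by (simp_all add: add_vec_def scale_vec_def)
  have e1: "curvature A D (extend_vec A p (F1 p)) X Y p = curvature A D F1 X Y p"
    and e2: "curvature A D (extend_vec A p (F2 p)) X Y p = curvature A D F2 X Y p"
    using e[of 1 0] e[of 0 1] by (simp_all add: c)
  show "curvature A D (extend_vec A p (F1 p)) X Y p = comb \<alpha> (F1 p) \<beta> (F2 p)" by (simp add: e1 R)
  show "curvature A D (extend_vec A p (F2 p)) X Y p = comb \<gamma> (F1 p) \<delta> (F2 p)" by (simp add: e2 R)
  show "curvature A D (extend_vec A p (comb a (F1 p) b (F2 p))) X Y p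
    = comb a (curvature A D (extend_vec A p (F1 p)) X Y p) b (curvature A D (extend_vec A p (F2 p)) X Y p)" for a b
    by (simp add: e e1 e2)
qed

text \<open>The chart in the definition of the trace jumps from point to point; near \<open>p\<close> one replaces it by a
  fixed chart.\<close>

lemma ricci_smooth_near:
  assumes XY: "X \<in> vector_fields A" "Y \<in> vector_fields A"
  shows "smooth_near A p (ricci A D X Y)"
proof -
  obtain c where c: "c \<in> A" "p \<in> fst c" by (rule chart_cover)
  let ?E = "extend_coord A c p"
  obtain V where V: "open V" "p \<in> V" "V \<subseteq> fst c" "\<And>q i. q \<in> V \<Longrightarrow> ?E i q = coord_vec A c i q"
    using extend_coord_frame[OF c] by metis
  have E: "?E i \<in> vector_fields A" for i by (rule extend_coord[OF c])
  have "curvature A D (?E 1) X Y q (coord c 1) + curvature A D (?E 2) X Y q (coord c 2) = ricci A D X Y q"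
    if q: "q \<in> V" for q
  proof -
    have cq: "c \<in> A" "q \<in> fst c" using c V(3) q by auto
    have fr: "frame_at q (?E 1 q) (?E 2 q)" using frame_coord[OF cq] V(4)[OF q] by simp
    have "curvature A D (?E i) X Y q = comb (curvature A D (?E i) X Y q (coord c 1)) (?E 1 q)
        (curvature A D (?E i) X Y q (coord c 2)) (?E 2 q)" for i
      unfolding V(4)[OF q] by (intro tangent_expansion cq field_tangent curvature_closed E XY)
    from ricci_frame[OF E E fr XY this this] show ?thesis by simp
  qed
  moreover have "smooth_near A p (\<lambda>q. curvature A D (?E 1) X Y q (coord c 1) + curvature A D (?E 2) X Y q (coord c 2))"
    by (intro smooth_near_add field_smooth_near[OF curvature_closed[OF E XY] smooth_near_coord[OF c]])
  ultimately show ?thesis using smooth_near_cong[OF _ V(1,2)] by blast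
qed

lemma tensorial_sym_ricci: "Y \<in> vector_fields A \<Longrightarrow> tensorial_at p (\<lambda>X. sym_ricci A D X Y p)"
  by (rule tensorial_atI)
    (simp_all add: sym_ricci_def tensorial_add[OF tensorial_ricci_1] tensorial_scale[OF tensorial_ricci_1]
      tensorial_add[OF tensorial_ricci_2] tensorial_scale[OF tensorial_ricci_2] field_simps)

lemma sym_ricci_commute: "sym_ricci A D X Y p = sym_ricci A D Y X p"
  by (simp add: sym_ricci_def)

lemma sym_ricci_smooth_near:
  "X \<in> vector_fields A \<Longrightarrow> Y \<in> vector_fields A \<Longrightarrow> smooth_near A p (sym_ricci A D X Y)"
  unfolding sym_ricci_def
  by (intro smooth_near_divide smooth_near_add ricci_smooth_near smooth_near_const) auto

end

section \<open>A uniqueness theorem for linear systems\<close>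

text \<open>On a ball of radius \<open>\<delta>\<close>, the mean value theorem bounds the maximum \<open>M\<close> of \<open>\<Sum>\<bar>u m\<bar>\<close> by
  \<open>2 \<delta> K M card I\<close>, which is at most \<open>M / 2\<close> for small \<open>\<delta>\<close>; hence \<open>M = 0\<close>.\<close>

lemma linear_system_vanishing:
  fixes u :: "'m \<Rightarrow> real ^ 2 \<Rightarrow> real"
  assumes fin: "finite I" and S: "open S" "x0 \<in> S"
    and diff: "\<And>m x. m \<in> I \<Longrightarrow> x \<in> S \<Longrightarrow> (u m has_derivative u' m x) (at x)"
    and bound: "\<And>m x i. m \<in> I \<Longrightarrow> x \<in> S \<Longrightarrow> \<bar>u' m x (axis i 1)\<bar> \<le> K * (\<Sum>n\<in>I. \<bar>u n x\<bar>)"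
    and init: "\<And>m. m \<in> I \<Longrightarrow> u m x0 = 0"
  obtains \<delta> where "\<delta> > 0" "ball x0 \<delta> \<subseteq> S" "\<And>m x. m \<in> I \<Longrightarrow> x \<in> ball x0 \<delta> \<Longrightarrow> u m x = 0"
proof -
  obtain r where r: "r > 0" "cball x0 r \<subseteq> S" using S open_contains_cball by blast
  define N where "N = 4 * (\<bar>K\<bar> + 1) * (real (card I) + 1)"
  have N: "N > 0" by (simp add: N_def)
  define \<delta> where "\<delta> = min r (1 / N)"
  have "cball x0 \<delta> \<subseteq> cball x0 r" by (rule subset_cball) (simp add: \<delta>_def)
  then have \<delta>: "\<delta> > 0" "\<delta> * N \<le> 1" "cball x0 \<delta> \<subseteq> S"
    using r N by (auto simp: \<delta>_def min_def field_simps)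
  let ?G = "\<lambda>x. \<Sum>n\<in>I. \<bar>u n x\<bar>"
  have "continuous_on (cball x0 \<delta>) ?G"
    using \<delta>(3) diff
    by (intro continuous_on_sum continuous_on_rabs) (meson continuous_at_imp_continuous_on has_derivative_continuous subsetD)
  then obtain x1 where x1: "x1 \<in> cball x0 \<delta>" "\<And>x. x \<in> cball x0 \<delta> \<Longrightarrow> ?G x \<le> ?G x1"
    using continuous_attains_sup[of "cball x0 \<delta>" ?G] \<delta>(1) by auto
  let ?M = "?G x1"
  have M: "?M \<ge> 0" by (intro sum_nonneg) auto
  have "\<bar>u m x1\<bar> \<le> 2 * \<bar>K\<bar> * ?M * \<delta>" if m: "m \<in> I" for m
  proof -
    have "norm (u m x1 - u m x0) \<le> 2 * \<bar>K\<bar> * ?M * norm (x1 - x0)"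
    proof (rule differentiable_bound[where S = "cball x0 \<delta>" and f' = "u' m"])
      fix x assume x: "x \<in> cball x0 \<delta>"
      then have xS: "x \<in> S" using \<delta> by auto
      show "(u m has_derivative u' m x) (at x within cball x0 \<delta>)"
        using diff[OF m xS] by (rule has_derivative_at_withinI)
      have lin: "linear (u' m x)" using diff[OF m xS] has_derivative_linear by blast
      show "onorm (u' m x) \<le> 2 * \<bar>K\<bar> * ?M"
      proof (rule onorm_le)
        fix v :: "real ^ 2"
        have b: "\<bar>u' m x (axis i 1)\<bar> \<le> \<bar>K\<bar> * ?M" for i
        proof -
          have "\<bar>u' m x (axis i 1)\<bar> \<le> K * ?G x" by (rule bound[OF m xS])
          also have "\<dots> \<le> \<bar>K\<bar> * ?G x" by (intro mult_right_mono sum_nonneg) auto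
          also have "\<dots> \<le> \<bar>K\<bar> * ?M" by (intro mult_left_mono x1(2) x) auto
          finally show ?thesis .
        qed
        have "v = v $ 1 *\<^sub>R axis 1 1 + v $ 2 *\<^sub>R axis 2 1"
          by (simp add: vec_eq_iff forall_2 axis_def)
        then have "u' m x v = v $ 1 * u' m x (axis 1 1) + v $ 2 * u' m x (axis 2 1)"
          using linear_add[OF lin] linear_scale[OF lin] by (metis real_scaleR_def)
        then have "\<bar>u' m x v\<bar> \<le> \<bar>v $ 1\<bar> * \<bar>u' m x (axis 1 1)\<bar> + \<bar>v $ 2\<bar> * \<bar>u' m x (axis 2 1)\<bar>"
          by (metis abs_mult abs_triangle_ineq)
        also have "\<dots> \<le> norm v * (\<bar>K\<bar> * ?M) + norm v * (\<bar>K\<bar> * ?M)"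
          by (intro add_mono mult_mono component_le_norm_cart b) auto
        finally show "norm (u' m x v) \<le> 2 * \<bar>K\<bar> * ?M * norm v" by (simp add: algebra_simps)
      qed
    qed (use x1(1) \<delta>(1) in auto)
    also have "\<dots> \<le> 2 * \<bar>K\<bar> * ?M * \<delta>"
      using x1(1) M by (intro mult_left_mono) (auto simp: dist_norm norm_minus_commute)
    finally show ?thesis using init[OF m] by simp
  qed
  then have "?M \<le> real (card I) * (2 * \<bar>K\<bar> * ?M * \<delta>)"
    using sum_bounded_above[of I "\<lambda>m. \<bar>u m x1\<bar>"] by simp
  also have "\<dots> = (2 * \<bar>K\<bar> * real (card I)) * \<delta> * ?M" by simp
  also have "\<dots> \<le> (N / 2) * \<delta> * ?M"
  proof (intro mult_right_mono)
    show "2 * \<bar>K\<bar> * real (card I) \<le> N / 2" by (simp add: N_def algebra_simps)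
  qed (use M \<delta> in auto)
  also have "\<dots> \<le> 1 / 2 * ?M"
    using \<delta>(2) by (intro mult_right_mono M) (simp add: algebra_simps)
  finally have M0: "?M \<le> 0" by simp
  show ?thesis
  proof (rule that[OF \<delta>(1)])
    fix m x assume "m \<in> I" "x \<in> ball x0 \<delta>"
    then have "\<bar>u m x\<bar> \<le> ?G x" "?G x \<le> ?M"
      using fin x1(2)[of x] by (auto intro: member_le_sum)
    then show "u m x = 0" using M0 by simp
  qed (use \<delta> ball_subset_cball in blast)
qed

section \<open>Parallel nilpotent endomorphisms\<close>

context surface
begin

lemma field_nonzero_near:
  assumes X: "X \<in> vector_fields A" and "X p \<noteq> zero_vec"
  obtains V where "open V" "p \<in> V" "\<And>q. q \<in> V \<Longrightarrow> X q \<noteq> zero_vec"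
proof -
  obtain c where c: "c \<in> A" "p \<in> fst c" by (rule chart_cover)
  obtain k where k: "X p (coord c k) \<noteq> 0"
    by (rule tangent_nonzero_coord[OF c field_tangent[OF X] assms(2)])
  obtain U where "open U" "p \<in> U" "\<And>q. q \<in> U \<Longrightarrow> X q (coord c k) \<noteq> 0"
    by (rule smooth_near_nonzero[OF field_smooth_near[OF X smooth_near_coord[OF c]] k]) metis
  then show ?thesis by (intro that[of U]) (auto simp: zero_vec_def dest: fun_cong)
qed

lemma frame_at_of_det:
  assumes c: "c \<in> A" "p \<in> fst c" and uw: "u \<in> tangent_space A p" "w \<in> tangent_space A p"
    and d: "u (coord c 1) * w (coord c 2) - u (coord c 2) * w (coord c 1) \<noteq> 0"
  shows "frame_at p u w"
  unfolding frame_at_def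
proof (intro conjI ballI uw)
  fix v assume v: "v \<in> tangent_space A p"
  let ?d = "u (coord c 1) * w (coord c 2) - u (coord c 2) * w (coord c 1)"
  \<comment> \<open>Cramer's rule\<close>
  let ?a = "(v (coord c 1) * w (coord c 2) - v (coord c 2) * w (coord c 1)) / ?d"
  let ?b = "(u (coord c 1) * v (coord c 2) - u (coord c 2) * v (coord c 1)) / ?d"
  have "v (coord c i) = comb ?a u ?b w (coord c i)" for i
  proof -
    have cramer: "?a * u (coord c j) + ?b * w (coord c j) = v (coord c j)" for j
    proof -
      have "?a * u (coord c j) + ?b * w (coord c j) = ((v (coord c 1) * w (coord c 2) - v (coord c 2) * w (coord c 1)) * u (coord c j)
          + (u (coord c 1) * v (coord c 2) - u (coord c 2) * v (coord c 1)) * w (coord c j)) / ?d"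
        by (simp add: add_divide_distrib)
      also have "\<dots> = v (coord c j) * ?d / ?d"
        using exhaust_2[of j] by (auto simp: algebra_simps)
      finally show ?thesis using d by simp
    qed
    then show ?thesis unfolding add_vec_def scale_vec_def by (rule sym)
  qed
  then have "v = comb ?a u ?b w"
    by (intro tangent_eqI[OF c v] tangent_add tangent_scale uw)
  then show "\<exists>a b. v = comb a u b w" by blast
qed

end

locale parallel_nilpotent_surface = affine_surface A D
  for A :: "'a::{t2_space,second_countable_topology} chart set" and D +
  fixes T :: "'a \<Rightarrow> 'a tangent \<Rightarrow> 'a tangent"
  assumes endo: "endo_field A T" and nilpotent: "nilpotent_endo A T"
    and nonzero: "nonzero_endo A T" and parallel: "parallel_endo A D T"
begin

lemma T_tangent: "u \<in> tangent_space A p \<Longrightarrow> T p u \<in> tangent_space A p"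
  using endo by (simp add: endo_field_def)

lemma T_scale: "u \<in> tangent_space A p \<Longrightarrow> T p (scale_vec a u) = scale_vec a (T p u)"
  using endo by (simp add: endo_field_def)

lemma T_comb:
  "u \<in> tangent_space A p \<Longrightarrow> v \<in> tangent_space A p \<Longrightarrow> T p (comb a u b v) = comb a (T p u) b (T p v)"
  using endo by (simp add: endo_field_def tangent_scale)

lemma T_zero: "T p zero_vec = zero_vec"
  using T_scale[OF zero_tangent, of p 0] by (simp add: scale_vec_def zero_vec_def)

lemma T_T: "u \<in> tangent_space A p \<Longrightarrow> T p (T p u) = zero_vec"
  using nilpotent by (simp add: nilpotent_endo_def)

lemma T_field: "X \<in> vector_fields A \<Longrightarrow> (\<lambda>p. T p (X p)) \<in> vector_fields A"
  using endo by (simp add: endo_field_def)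

lemma D_T:
  assumes "X \<in> vector_fields A" "Y \<in> vector_fields A"
  shows "D X (\<lambda>q. T q (Y q)) = (\<lambda>p. T p (D X Y p))"
proof (intro ext)
  fix p f
  have "cov_deriv_endo D T X Y p f = 0"
    using parallel assms by (simp add: parallel_endo_def zero_vec_def)
  then show "D X (\<lambda>q. T q (Y q)) p f = T p (D X Y p) f" by (simp add: cov_deriv_endo_def)
qed

text \<open>If the determinant of \<open>u, w = T u\<close> vanishes, then \<open>w\<^sub>k u - u\<^sub>k w = 0\<close> for each component \<open>k\<close>; applying
  \<open>T\<close> gives \<open>w\<^sub>k w = 0\<close>.\<close>

lemma adapted_frame:
  assumes u: "u \<in> tangent_space A p" and nz: "T p u \<noteq> zero_vec"
  shows "frame_at p u (T p u)"
proof -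
  obtain c where c: "c \<in> A" "p \<in> fst c" by (rule chart_cover)
  let ?w = "T p u"
  let ?d = "u (coord c 1) * ?w (coord c 2) - u (coord c 2) * ?w (coord c 1)"
  have w: "?w \<in> tangent_space A p" by (rule T_tangent[OF u])
  have "?d \<noteq> 0"
  proof
    assume d: "?d = 0"
    have "?w (coord c k) = 0" for k
    proof -
      have "comb (?w (coord c k)) u (- u (coord c k)) ?w = zero_vec"
      proof (rule tangent_eqI[OF c])
        fix i :: 2
        show "comb (?w (coord c k)) u (- u (coord c k)) ?w (coord c i) = zero_vec (coord c i)"
          using d exhaust_2[of i] exhaust_2[of k] by (auto simp: add_vec_def scale_vec_def zero_vec_def algebra_simps)
      qed (intro tangent_add tangent_scale zero_tangent u w)+
      then have "comb (?w (coord c k)) ?w (- u (coord c k)) (T p ?w) = zero_vec"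
        using T_comb[OF u w] T_zero by metis
      then have "scale_vec (?w (coord c k)) ?w (coord c k) = 0"
        by (auto simp: T_T[OF u] add_vec_def scale_vec_def zero_vec_def fun_eq_iff)
      then show ?thesis by (simp add: scale_vec_def)
    qed
    then have "?w = zero_vec"
      by (intro tangent_eqI[OF c w zero_tangent]) (simp add: zero_vec_def)
    with nz show False by simp
  qed
  then show ?thesis by (rule frame_at_of_det[OF c u w])
qed

lemma kernel_adapted:
  assumes u: "u \<in> tangent_space A p" and nz: "T p u \<noteq> zero_vec"
  shows "endo_kernel A T p = {scale_vec b (T p u) | b. True}"
proof (intro equalityI subsetI)
  fix v assume "v \<in> endo_kernel A T p"
  then have v: "v \<in> tangent_space A p" "T p v = zero_vec" by (auto simp: endo_kernel_def)
  obtain a b where ab: "v = comb a u b (T p u)" by (rule frame_comb[OF adapted_frame[OF assms] v(1)])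
  have "scale_vec a (T p u) = zero_vec"
    using v(2) unfolding ab T_comb[OF u T_tangent[OF u]] T_T[OF u]
    by (simp add: add_vec_def scale_vec_def zero_vec_def)
  then have "a = 0" using nz by (auto simp: scale_vec_def zero_vec_def fun_eq_iff)
  then have "v = scale_vec b (T p u)" using ab by (simp add: add_vec_def scale_vec_def)
  then show "v \<in> {scale_vec b (T p u) | b. True}" by blast
next
  fix v assume "v \<in> {scale_vec b (T p u) | b. True}"
  then show "v \<in> endo_kernel A T p"
    using T_scale[OF T_tangent[OF u]] T_T[OF u] T_tangent[OF u]
    by (auto simp: endo_kernel_def tangent_scale) (simp add: scale_vec_def zero_vec_def)
qed

subsection \<open>The endomorphism vanishes nowhere\<close>

text \<open>The components \<open>a\<^sup>k\<^sub>j\<close> of \<open>T\<close> in a chart satisfy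
  \<open>\<partial>\<^sub>i a\<^sup>k\<^sub>j = \<Sum>\<^sub>l \<Gamma>\<^sup>l\<^sub>i\<^sub>j a\<^sup>k\<^sub>l - a\<^sup>l\<^sub>j \<Gamma>\<^sup>k\<^sub>i\<^sub>l\<close>, a linear system whose coefficients are bounded near \<open>p\<close>. In
  the proof, \<open>a (k, j)\<close> stands for \<open>a\<^sup>k\<^sub>j\<close> and \<open>\<Gamma> i j k\<close> for \<open>\<Gamma>\<^sup>k\<^sub>i\<^sub>j\<close>.\<close>

lemma T_zero_set_open:
  assumes p: "\<And>v. v \<in> tangent_space A p \<Longrightarrow> T p v = zero_vec"
  obtains W where "open W" "p \<in> W" "\<And>q v. q \<in> W \<Longrightarrow> v \<in> tangent_space A q \<Longrightarrow> T q v = zero_vec"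
proof -
  obtain c where c: "c \<in> A" "p \<in> fst c" by (rule chart_cover)
  define E where "E = extend_coord A c p"
  obtain V where V: "open V" "p \<in> V" "V \<subseteq> fst c" "\<And>q i. q \<in> V \<Longrightarrow> E i q = coord_vec A c i q"
    unfolding E_def using extend_coord_frame[OF c] by metis
  have E: "E i \<in> vector_fields A" for i unfolding E_def by (rule extend_coord[OF c])
  define a where "a = (\<lambda>m q. T q (E (snd m) q) (coord c (fst m)))"
  define \<Gamma> where "\<Gamma> = (\<lambda>i j k q. D (E i) (E j) q (coord c k))"
  have cq: "q \<in> fst c" if "q \<in> V" for q using V(3) that by auto
  have a_smooth: "smooth_near A q (a m)" if "q \<in> V" for m q
    unfolding a_def by (rule field_smooth_near[OF T_field[OF E] smooth_near_coord[OF c(1) cq[OF that]]])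
  have \<Gamma>_smooth: "smooth_near A q (\<Gamma> i j k)" if "q \<in> V" for i j k q
    unfolding \<Gamma>_def by (rule field_smooth_near[OF D_closed[OF E E] smooth_near_coord[OF c(1) cq[OF that]]])
  have system: "E i q (a (k, j)) = (\<Gamma> i j 1 q * a (k, 1) q + \<Gamma> i j 2 q * a (k, 2) q)
      - (a (1, j) q * \<Gamma> i 1 k q + a (2, j) q * \<Gamma> i 2 k q)" if q: "q \<in> V" for i j k q
  proof -
    have TE: "T r (E j r) = comb (a (1, j) r) (E 1 r) (a (2, j) r) (E 2 r)" if "r \<in> V" for r
      unfolding a_def V(4)[OF that] fst_conv snd_conv
      by (rule tangent_expansion[OF c(1) cq[OF that]]) (intro T_tangent coord_vec_tangent c(1) cq that)
    have Ek: "E l q (coord c k) = (if l = k then 1 else 0)" for l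
      by (simp add: V(4)[OF q] coord_vec_coord[OF c(1) cq[OF q]])
    have "D (E i) (\<lambda>q. T q (E j q)) q (coord c k) = E i q (a (1, j)) * E 1 q (coord c k) + a (1, j) q * \<Gamma> i 1 k q
        + E i q (a (2, j)) * E 2 q (coord c k) + a (2, j) q * \<Gamma> i 2 k q"
      unfolding \<Gamma>_def by (rule D_expansion[OF E T_field[OF E] E E V(1) q TE a_smooth[OF q] a_smooth[OF q]])
    also have "\<dots> = E i q (a (k, j)) + a (1, j) q * \<Gamma> i 1 k q + a (2, j) q * \<Gamma> i 2 k q"
      unfolding Ek using exhaust_2[of k] by auto
    finally have 1: "D (E i) (\<lambda>q. T q (E j q)) q (coord c k)
        = E i q (a (k, j)) + a (1, j) q * \<Gamma> i 1 k q + a (2, j) q * \<Gamma> i 2 k q" .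
    have DE: "D (E i) (E j) q = comb (\<Gamma> i j 1 q) (E 1 q) (\<Gamma> i j 2 q) (E 2 q)"
      unfolding \<Gamma>_def V(4)[OF q] by (rule tangent_expansion[OF c(1) cq[OF q] field_tangent[OF D_closed[OF E E]]])
    have 2: "D (E i) (\<lambda>q. T q (E j q)) q (coord c k) = \<Gamma> i j 1 q * a (k, 1) q + \<Gamma> i j 2 q * a (k, 2) q"
      unfolding D_T[OF E E] DE T_comb[OF field_tangent[OF E] field_tangent[OF E]]
      by (simp add: a_def add_vec_def scale_vec_def)
    show ?thesis using 1 2 by simp
  qed
  let ?N = "\<lambda>q. \<Sum>t\<in>UNIV. \<bar>\<Gamma> (fst t) (fst (snd t)) (snd (snd t)) q\<bar>"
  have "continuous_on V ?N"
    using \<Gamma>_smooth V(1)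
    by (intro continuous_on_sum continuous_on_rabs) (auto simp: continuous_on_eq_continuous_at smooth_near_isCont)
  then have oW: "open (V \<inter> ?N -` {..< ?N p + 1})"
    by (rule continuous_open_preimage[OF _ V(1)]) simp
  define W where "W = V \<inter> ?N -` {..< ?N p + 1}"
  have W: "open W" "p \<in> W" "W \<subseteq> V" using oW V(2) by (auto simp: W_def)
  define K where "K = ?N p + 1"
  have K: "\<bar>\<Gamma> i j k q\<bar> \<le> K" if "q \<in> W" for i j k q
  proof -
    have "\<bar>\<Gamma> (fst (i, j, k)) (fst (snd (i, j, k))) (snd (snd (i, j, k))) q\<bar> \<le> ?N q" by (rule member_le_sum) auto
    then show ?thesis using that by (simp add: W_def K_def)
  qed
  have K0: "K \<ge> 0" using K[OF W(2)] by (meson abs_ge_zero order_trans)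
  have bound: "\<bar>E i q (a m)\<bar> \<le> (4 * K) * (\<Sum>n\<in>UNIV. \<bar>a n q\<bar>)" if q: "q \<in> W" for i m q
  proof -
    let ?G = "\<Sum>n\<in>UNIV. \<bar>a n q\<bar>"
    have t: "\<bar>\<Gamma> i' j' k' q * a n q\<bar> \<le> K * ?G" for i' j' k' n
      unfolding abs_mult by (intro mult_mono K q member_le_sum K0) auto
    obtain k j where m: "m = (k, j)" by (cases m)
    have "\<bar>E i q (a m)\<bar> \<le> \<bar>\<Gamma> i j 1 q * a (k, 1) q\<bar> + \<bar>\<Gamma> i j 2 q * a (k, 2) q\<bar>
        + \<bar>\<Gamma> i 1 k q * a (1, j) q\<bar> + \<bar>\<Gamma> i 2 k q * a (2, j) q\<bar>"
      unfolding m system[OF subsetD[OF W(3) q]] mult.commute[of "a _ q"] by linarith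
    also have "\<dots> \<le> K * ?G + K * ?G + K * ?G + K * ?G" by (intro add_mono t)
    finally show ?thesis by simp
  qed
  let ?S = "snd c ` W"
  have Wc: "W \<subseteq> fst c" using W(3) V(3) by auto
  have oS: "open ?S" using open_chart_image[OF c(1) W(1)] Wc by (simp add: Int_absorb2)
  let ?u' = "\<lambda>m x. frechet_derivative (a m \<circ> chart_inv c) (at x)"
  obtain \<delta> where \<delta>: "\<delta> > 0" "ball (snd c p) \<delta> \<subseteq> ?S"
    "\<And>m x. m \<in> (UNIV :: (2 \<times> 2) set) \<Longrightarrow> x \<in> ball (snd c p) \<delta> \<Longrightarrow> (a m \<circ> chart_inv c) x = 0"
  proof (rule linear_system_vanishing[of UNIV ?S "snd c p" "\<lambda>m. a m \<circ> chart_inv c" ?u' "4 * K"])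
    fix m :: "2 \<times> 2" and x i assume "x \<in> ?S"
    then obtain q where q: "q \<in> W" "x = snd c q" by auto
    have qc: "q \<in> fst c" and qV: "q \<in> V" using q Wc W(3) by auto
    show "(a m \<circ> chart_inv c has_derivative ?u' m x) (at x)"
      unfolding q(2) by (rule smooth_near_has_derivative[OF a_smooth[OF qV] c(1) qc])
    have "?u' m x (axis i 1) = E i q (a m)"
      by (simp add: V(4)[OF qV] coord_vec_def dir_deriv_def a_smooth[OF qV] q(2))
    then show "\<bar>?u' m x (axis i 1)\<bar> \<le> 4 * K * (\<Sum>n\<in>UNIV. \<bar>(a n \<circ> chart_inv c) x\<bar>)"
      using bound[OF q(1), of i m] by (simp add: q(2) chart_inv_left[OF c(1) qc])
  next
    fix m :: "2 \<times> 2"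
    show "(a m \<circ> chart_inv c) (snd c p) = 0"
      using p[OF field_tangent[OF E]] by (simp add: chart_inv_left[OF c] a_def zero_vec_def)
  qed (use oS W(2) in auto)
  show ?thesis
  proof (rule that)
    have "open (fst c \<inter> snd c -` ball (snd c p) \<delta>)"
      using chart_homeomorphism[OF c(1)] open_chart_domain[OF c(1)]
      by (intro continuous_open_preimage) (auto simp: homeomorphism_def)
    then show "open (W \<inter> (fst c \<inter> snd c -` ball (snd c p) \<delta>))" using W(1) by blast
    show "p \<in> W \<inter> (fst c \<inter> snd c -` ball (snd c p) \<delta>)" using W(2) c(2) \<delta>(1) by simp
  next
    fix q v assume q: "q \<in> W \<inter> (fst c \<inter> snd c -` ball (snd c p) \<delta>)" and v: "v \<in> tangent_space A q"
    have qV: "q \<in> V" and qc: "q \<in> fst c" using q W(3) by auto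
    have a0: "a m q = 0" for m
      using \<delta>(3)[of m "snd c q"] q by (simp add: chart_inv_left[OF c(1) qc])
    have TE: "T q (E j q) = zero_vec" for j
      by (rule tangent_eqI[OF c(1) qc T_tangent[OF field_tangent[OF E]] zero_tangent])
        (use a0[of "(_, j)"] in \<open>simp add: a_def zero_vec_def\<close>)
    have "v = comb (v (coord c 1)) (E 1 q) (v (coord c 2)) (E 2 q)"
      unfolding V(4)[OF qV] by (rule tangent_expansion[OF c(1) qc v])
    then have "T q v = comb (v (coord c 1)) zero_vec (v (coord c 2)) zero_vec"
      by (metis T_comb[OF field_tangent[OF E] field_tangent[OF E]] TE)
    then show "T q v = zero_vec" by (simp add: add_vec_def scale_vec_def zero_vec_def)
  qed
qed

lemma T_nonzero_near:
  assumes v: "v \<in> tangent_space A p" and nz: "T p v \<noteq> zero_vec"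
  obtains X V where "X \<in> vector_fields A" "X p = v" "open V" "p \<in> V" "\<And>q. q \<in> V \<Longrightarrow> T q (X q) \<noteq> zero_vec"
proof -
  let ?X = "extend_vec A p v"
  have X: "?X \<in> vector_fields A" "?X p = v" by (rule extend_vec[OF v])+
  obtain V where "open V" "p \<in> V" "\<And>q. q \<in> V \<Longrightarrow> T q (?X q) \<noteq> zero_vec"
    using field_nonzero_near[OF T_field[OF X(1)], of p] nz X(2) by metis
  with X show ?thesis by (intro that[of ?X V])
qed

text \<open>The set of zeros of \<open>T\<close> is open and closed, hence a union of connected components.\<close>

lemma T_nonzero: "\<exists>v\<in>tangent_space A p. T p v \<noteq> zero_vec"
proof -
  let ?Z = "{q. \<forall>v\<in>tangent_space A q. T q v = zero_vec}"
  have 1: "open ?Z"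
  proof (subst open_subopen, intro ballI)
    fix q assume "q \<in> ?Z"
    then have q: "T q v = zero_vec" if "v \<in> tangent_space A q" for v using that by blast
    obtain W where "open W" "q \<in> W" "\<And>r v. r \<in> W \<Longrightarrow> v \<in> tangent_space A r \<Longrightarrow> T r v = zero_vec"
      by (rule T_zero_set_open[OF q]) (assumption, rule that)
    then show "\<exists>W. open W \<and> q \<in> W \<and> W \<subseteq> ?Z" by (intro exI[of _ W]) blast
  qed
  have 2: "open (- ?Z)"
  proof (subst open_subopen, intro ballI)
    fix q assume "q \<in> - ?Z"
    then obtain v where v: "v \<in> tangent_space A q" "T q v \<noteq> zero_vec" by auto
    obtain X V where "X \<in> vector_fields A" "open V" "q \<in> V" "\<And>r. r \<in> V \<Longrightarrow> T r (X r) \<noteq> zero_vec"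
      using T_nonzero_near[OF v] by metis
    then show "\<exists>W. open W \<and> q \<in> W \<and> W \<subseteq> - ?Z"
      by (intro exI[of _ V]) (auto dest: field_tangent)
  qed
  let ?C = "connected_component_set UNIV p"
  have "?C \<inter> ?Z = {} \<or> ?C \<inter> - ?Z = {}"
    using connectedD[OF connected_connected_component 1 2] by auto
  moreover have "p \<in> ?C" by simp
  moreover obtain q v where "q \<in> ?C" "v \<in> tangent_space A q" "T q v \<noteq> zero_vec"
    using nonzero unfolding nonzero_endo_def by blast
  ultimately show ?thesis by blast
qed

lemma adapted_field:
  obtains F V where "F \<in> vector_fields A" "open V" "p \<in> V" "\<And>q. q \<in> V \<Longrightarrow> T q (F q) \<noteq> zero_vec"
  using T_nonzero T_nonzero_near by metis

subsection \<open>The kernel is a parallel line distribution\<close>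

lemma line_distribution_kernel: "line_distribution A (endo_kernel A T)"
  unfolding line_distribution_def
proof
  fix p
  obtain F V where F: "F \<in> vector_fields A" "open V" "p \<in> V" "\<And>q. q \<in> V \<Longrightarrow> T q (F q) \<noteq> zero_vec"
    using adapted_field[of p] by metis
  then show "\<exists>X\<in>vector_fields A. \<exists>V. open V \<and> p \<in> V \<and>
      (\<forall>q\<in>V. X q \<noteq> zero_vec \<and> endo_kernel A T q = {scale_vec a (X q) |a. True})"
    using kernel_adapted[OF field_tangent[OF F(1)] F(4)] T_field[OF F(1)]
    by (intro bexI[of _ "\<lambda>q. T q (F q)"] exI[of _ V]) auto
qed

lemma D_kernel:
  assumes "X \<in> vector_fields A" "Y \<in> vector_fields A" "\<And>q. Y q \<in> endo_kernel A T q"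
  shows "D X Y p \<in> endo_kernel A T p"
proof -
  have "(\<lambda>q. T q (Y q)) = (\<lambda>q. zero_vec)" using assms(3) by (simp add: endo_kernel_def)
  then have "T p (D X Y p) = zero_vec"
    using D_T[OF assms(1,2)] D_zero[OF assms(1), of p] by metis
  then show ?thesis by (simp add: endo_kernel_def field_tangent[OF D_closed[OF assms(1,2)]])
qed

lemma parallel_distribution_kernel: "parallel_distribution A D (endo_kernel A T)"
  unfolding parallel_distribution_def using D_kernel by blast

end

context parallel_nilpotent_surface
begin

section \<open>The symmetric Ricci tensor\<close>

lemma curvature_T:
  assumes "X \<in> vector_fields A" "Y \<in> vector_fields A" "Z \<in> vector_fields A"
  shows "curvature A D X Y (\<lambda>q. T q (Z q)) p = T p (curvature A D X Y Z p)"
proof -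
  have c: "curvature A D X Y W p = comb 1 (comb 1 (D X (D Y W) p) (- 1) (D Y (D X W) p)) (- 1) (D (lie_bracket A X Y) W p)" for W
    by (simp add: curvature_def field_defs fun_eq_iff)
  have t: "D X (D Y Z) p \<in> tangent_space A p" "D Y (D X Z) p \<in> tangent_space A p"
    "D (lie_bracket A X Y) Z p \<in> tangent_space A p"
    by (intro field_tangent D_closed bracket_closed assms)+
  show ?thesis
    unfolding c D_T[OF assms(1,3)] D_T[OF assms(2,3)] D_T[OF bracket_closed[OF assms(1,2)] assms(3)]
      D_T[OF assms(1) D_closed[OF assms(2,3)]] D_T[OF assms(2) D_closed[OF assms(1,3)]]
    using t by (simp add: T_comb tangent_add tangent_scale)
qed

lemma curvature_diag:
  assumes "X \<in> vector_fields A" "Z \<in> vector_fields A"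
  shows "curvature A D X X Z p = zero_vec"
proof
  fix f show "curvature A D X X Z p f = zero_vec f"
    using curvature_anti[OF assms(1,1,2), of p f] by (simp add: zero_vec_def)
qed

text \<open>With \<open>e\<^sub>2 = T e\<^sub>1\<close> and \<open>R(e\<^sub>1,e\<^sub>2)e\<^sub>1 = \<alpha> e\<^sub>1 + \<beta> e\<^sub>2\<close>, \<open>R(e\<^sub>1,e\<^sub>2)e\<^sub>2 = \<alpha> e\<^sub>2\<close> as \<open>R\<close> commutes
  with \<open>T\<close>.  Hence \<open>\<rho>(e\<^sub>2,e\<^sub>1) = \<alpha> = - \<rho>(e\<^sub>1,e\<^sub>2)\<close> and \<open>\<rho>(e\<^sub>2,e\<^sub>2) = 0\<close>.\<close>

lemma sym_ricci_T_frame: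
  assumes F: "F \<in> vector_fields A" and nz: "T p (F p) \<noteq> zero_vec"
  defines "G \<equiv> \<lambda>q. T q (F q)"
  shows "sym_ricci A D G F p = 0" "sym_ricci A D G G p = 0"
proof -
  have G: "G \<in> vector_fields A" unfolding G_def by (rule T_field[OF F])
  have fr: "frame_at p (F p) (G p)" unfolding G_def by (rule adapted_frame[OF field_tangent[OF F] nz])
  have TG: "T p (G p) = zero_vec" unfolding G_def by (rule T_T[OF field_tangent[OF F]])
  obtain \<alpha> \<beta> where 1: "curvature A D F G F p = comb \<alpha> (F p) \<beta> (G p)"
    by (rule frame_comb[OF fr field_tangent[OF curvature_closed[OF F G F]]])
  have "curvature A D F G G p = T p (curvature A D F G F p)"
    unfolding G_def by (rule curvature_T[OF F G[unfolded G_def] F])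
  also have "\<dots> = comb 0 (F p) \<alpha> (G p)"
    unfolding 1 T_comb[OF field_tangent[OF F] field_tangent[OF G]] TG
    by (simp add: G_def add_vec_def scale_vec_def zero_vec_def)
  finally have 2: "curvature A D F G G p = comb 0 (F p) \<alpha> (G p)" .
  have 3: "curvature A D G F G p = comb 0 (F p) (- \<alpha>) (G p)"
    using curvature_anti[OF F G G] 2 by (auto simp: add_vec_def scale_vec_def)
  have 0: "curvature A D X X Y p = comb 0 (F p) 0 (G p)" if "X \<in> vector_fields A" "Y \<in> vector_fields A" for X Y
    using curvature_diag[OF that] by (simp add: add_vec_def scale_vec_def zero_vec_def)
  have "ricci A D G F p = \<alpha>"
    using ricci_frame[OF F G fr G F 1 0[OF G F]] by simp
  moreover have "ricci A D F G p = - \<alpha>"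
    using ricci_frame[OF F G fr F G 0[OF F G] 3] by simp
  moreover have "ricci A D G G p = 0"
    using ricci_frame[OF F G fr G G 2 0[OF G G]] by simp
  ultimately show "sym_ricci A D G F p = 0" "sym_ricci A D G G p = 0"
    by (simp_all add: sym_ricci_def)
qed

text \<open>In a basis \<open>e, g\<close> of the plane, a symmetric bilinear form that vanishes on \<open>g\<close> depends only on the
  \<open>e\<close>-components of its arguments.\<close>

lemma form_frame:
  assumes t: "\<And>Z. Z \<in> vector_fields A \<Longrightarrow> tensorial_at p (\<lambda>Y. B Y Z)"
    and s: "\<And>Y Z. B Y Z = B Z Y"
    and F: "F \<in> vector_fields A" "G \<in> vector_fields A"
    and B: "\<And>Z. Z \<in> vector_fields A \<Longrightarrow> B G Z = 0"
    and Y: "Y \<in> vector_fields A" "Y p = comb y (F p) y' (G p)"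
    and Z: "Z \<in> vector_fields A" "Z p = comb z (F p) z' (G p)"
  shows "B Y Z = y * z * B F F"
proof -
  have "B Y Z = y * B F Z + y' * B G Z" by (rule tensorial_comb[OF t[OF Z(1)] Y(1) F Y(2)])
  also have "B F Z = B Z F" by (rule s)
  also have "B Z F = z * B F F + z' * B G F" by (rule tensorial_comb[OF t[OF F(1)] Z(1) F Z(2)])
  finally show ?thesis using B F Z by simp
qed

lemma sym_ricci_kernel:
  assumes X: "X \<in> vector_fields A" "X p \<in> endo_kernel A T p" and Z: "Z \<in> vector_fields A"
  shows "sym_ricci A D X Z p = 0"
proof -
  obtain F where F: "F \<in> vector_fields A" "T p (F p) \<noteq> zero_vec"
    using adapted_field[of p] by metis
  let ?G = "\<lambda>q. T q (F q)"
  have G: "?G \<in> vector_fields A" by (rule T_field[OF F(1)])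
  obtain a b where Zp: "Z p = comb a (F p) b (?G p)"
    by (rule frame_comb[OF adapted_frame[OF field_tangent[OF F(1)] F(2)] field_tangent[OF Z]])
  obtain s where "X p = scale_vec s (?G p)"
    using X(2) kernel_adapted[OF field_tangent[OF F(1)] F(2)] by auto
  then have Xp: "X p = comb s (?G p) 0 (?G p)" by (simp add: add_vec_def scale_vec_def)
  have "sym_ricci A D X Z p = s * sym_ricci A D ?G Z p"
    using tensorial_comb[OF tensorial_sym_ricci[OF Z] X(1) G G Xp] by simp
  also have "sym_ricci A D ?G Z p = sym_ricci A D Z ?G p" by (rule sym_ricci_commute)
  also have "\<dots> = 0"
    using tensorial_comb[OF tensorial_sym_ricci[OF G] Z F(1) G Zp] sym_ricci_T_frame[OF F]
      sym_ricci_commute by simp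
  finally show ?thesis by simp
qed

text \<open>The coordinates of a nonzero vector of \<open>ker T\<close> are a nontrivial linear relation between the
  rows of the matrix of the form.\<close>

lemma sym_ricci_rank:
  assumes "\<not> form_zero_at A (sym_ricci A D) p"
  shows "form_rank A (sym_ricci A D) p = 1"
proof -
  let ?c = "chart_at A p" and ?h = "sym_ricci A D"
  define E where "E = (\<lambda>i. extend_vec A p (coord_vec A ?c i p))"
  have E: "E i \<in> vector_fields A" "E i p = coord_vec A ?c i p" for i
    unfolding E_def by (intro extend_vec coord_vec_tangent chart_at)+
  let ?H = "(\<chi> i j. ?h (E i) (E j) p) :: real ^ 2 ^ 2"
  have expand: "?h X Y p = X p (coord ?c 1) * ?h (E 1) Y p + X p (coord ?c 2) * ?h (E 2) Y p"
    if "X \<in> vector_fields A" "Y \<in> vector_fields A" for X Y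
    by (rule tensorial_comb[OF tensorial_sym_ricci[OF that(2)] that(1) E(1) E(1)])
      (unfold E(2), rule tangent_expansion[OF chart_at field_tangent[OF that(1)]])
  have "?H \<noteq> 0"
  proof
    assume "?H = 0"
    then have H0: "?h (E i) (E j) p = 0" for i j by (simp add: vec_eq_iff)
    have "?h X Y p = 0" if X: "X \<in> vector_fields A" and Y: "Y \<in> vector_fields A" for X Y
    proof -
      have "?h (E i) Y p = 0" for i
        using expand[OF Y E(1), of i] H0 by (simp add: sym_ricci_commute[of "E i" Y])
      then show ?thesis using expand[OF X Y] by simp
    qed
    with assms show False by (simp add: form_zero_at_def)
  qed
  then have "rank ?H \<noteq> 0" by (simp add: rank_eq_0)
  moreover have "rank ?H < CARD(2)"
  proof -
    obtain v where v: "v \<in> tangent_space A p" "T p v \<noteq> zero_vec" using T_nonzero by blast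
    let ?W = "extend_vec A p (T p v)"
    have W: "?W \<in> vector_fields A" "?W p = T p v" by (intro extend_vec T_tangent v)+
    have k: "?W p \<in> endo_kernel A T p" unfolding W(2) by (simp add: endo_kernel_def T_tangent T_T v)
    have "?W p \<noteq> zero_vec" using v(2) W(2) by simp
    then obtain k where "?W p (coord ?c k) \<noteq> 0"
      by (rule tangent_nonzero_coord[OF chart_at field_tangent[OF W(1)]])
    then have w: "?W p (coord ?c 1) \<noteq> 0 \<or> ?W p (coord ?c 2) \<noteq> 0" by (metis exhaust_2)
    have "?W p (coord ?c 1) * ?h (E 1) (E j) p + ?W p (coord ?c 2) * ?h (E 2) (E j) p = 0" for j
      using expand[OF W(1) E(1), of j] sym_ricci_kernel[OF W(1) k E(1), of j] by simp
    from this[of 1] this[of 2] w have "?h (E 1) (E 1) p * ?h (E 2) (E 2) p - ?h (E 1) (E 2) p * ?h (E 2) (E 1) p = 0"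
      by algebra
    then have "det ?H = 0" by (simp add: det_2)
    then show ?thesis by (simp add: det_eq_0_rank)
  qed
  ultimately have "rank ?H = 1" by simp
  then show ?thesis unfolding form_rank_def E_def .
qed

subsection \<open>Recurrence\<close>

abbreviation D_sym_ricci :: "'a field \<Rightarrow> 'a field \<Rightarrow> 'a field \<Rightarrow> 'a \<Rightarrow> real" where
  "D_sym_ricci \<equiv> cov_deriv_form D (sym_ricci A D)"

lemma D_sym_ricci_smooth_near:
  assumes XYZ: "X \<in> vector_fields A" "Y \<in> vector_fields A" "Z \<in> vector_fields A"
  shows "smooth_near A p (D_sym_ricci X Y Z)"
  unfolding cov_deriv_form_def
  by (intro smooth_near_diff sym_ricci_smooth_near field_smooth_near[OF XYZ(1) sym_ricci_smooth_near] D_closed XYZ)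

lemma D_sym_ricci_commute: "D_sym_ricci X Y Z p = D_sym_ricci X Z Y p"
proof -
  have "sym_ricci A D Y Z = sym_ricci A D Z Y" using sym_ricci_commute by blast
  then show ?thesis
    by (simp add: cov_deriv_form_def sym_ricci_commute[of "D X Y" Z] sym_ricci_commute[of Y "D X Z"])
qed

lemma tensorial_D_sym_ricci_1:
  assumes "Y \<in> vector_fields A" "Z \<in> vector_fields A"
  shows "tensorial_at p (\<lambda>X. D_sym_ricci X Y Z p)"
proof (rule tensorial_atI)
  fix X X' assume X: "X \<in> vector_fields A" "X' \<in> vector_fields A"
  show "D_sym_ricci (add_field X X') Y Z p = D_sym_ricci X Y Z p + D_sym_ricci X' Y Z p"
    using tensorial_add[OF tensorial_sym_ricci[OF assms(2)] D_closed[OF X(1) assms(1)] D_closed[OF X(2) assms(1)]]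
      tensorial_add[OF tensorial_sym_ricci[OF assms(1)] D_closed[OF X(1) assms(2)] D_closed[OF X(2) assms(2)]]
    by (simp add: cov_deriv_form_def D_add_left X assms sym_ricci_commute[of Y])
      (simp add: add_field_def add_vec_def)
next
  fix f X assume X: "X \<in> vector_fields A" and f: "smooth_fun_on A UNIV f"
  show "D_sym_ricci (scale_field f X) Y Z p = f p * D_sym_ricci X Y Z p"
    using tensorial_scale[OF tensorial_sym_ricci[OF assms(2)] D_closed[OF X assms(1)] f]
      tensorial_scale[OF tensorial_sym_ricci[OF assms(1)] D_closed[OF X assms(2)] f]
    by (simp add: cov_deriv_form_def D_scale_left X assms f sym_ricci_commute[of Y])
      (simp add: scale_field_def scale_vec_def algebra_simps)
qed

lemma tensorial_D_sym_ricci_2: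
  assumes X: "X \<in> vector_fields A" and Z: "Z \<in> vector_fields A"
  shows "tensorial_at p (\<lambda>Y. D_sym_ricci X Y Z p)"
proof (rule tensorial_atI)
  note h_add = tensorial_add[OF tensorial_sym_ricci]
  note DZ = D_closed[OF X Z]
  fix Y Y' assume Y: "Y \<in> vector_fields A" "Y' \<in> vector_fields A"
  have "sym_ricci A D (add_field Y Y') Z = (\<lambda>q. sym_ricci A D Y Z q + sym_ricci A D Y' Z q)"
    using h_add[OF Z Y] by blast
  then have "X p (sym_ricci A D (add_field Y Y') Z) = X p (sym_ricci A D Y Z) + X p (sym_ricci A D Y' Z)"
    by (simp add: tangent_fun_add[OF field_tangent[OF X]] sym_ricci_smooth_near Y Z)
  then show "D_sym_ricci X (add_field Y Y') Z p = D_sym_ricci X Y Z p + D_sym_ricci X Y' Z p"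
    by (simp add: cov_deriv_form_def D_add_right[OF X Y] h_add[OF Z D_closed[OF X Y(1)] D_closed[OF X Y(2)]]
        h_add[OF DZ Y])
next
  note h_add = tensorial_add[OF tensorial_sym_ricci] and h_scale = tensorial_scale[OF tensorial_sym_ricci]
  note DZ = D_closed[OF X Z]
  fix f Y assume Y: "Y \<in> vector_fields A" and f: "smooth_fun_on A UNIV f"
  have "sym_ricci A D (scale_field f Y) Z = (\<lambda>q. f q * sym_ricci A D Y Z q)"
    using h_scale[OF Z Y f] by blast
  then have 1: "X p (sym_ricci A D (scale_field f Y) Z) = f p * X p (sym_ricci A D Y Z) + X p f * sym_ricci A D Y Z p"
    by (simp add: tangent_fun_mult[OF field_tangent[OF X]] sym_ricci_smooth_near Y Z smooth_UNIV_near[OF f])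
  have Xf: "smooth_fun_on A UNIV (\<lambda>p. X p f)" by (rule smooth_UNIV_field[OF X f])
  have 2: "sym_ricci A D (D X (scale_field f Y)) Z p = X p f * sym_ricci A D Y Z p + f p * sym_ricci A D (D X Y) Z p"
    unfolding D_scale_right[OF X Y f]
    by (simp add: h_add[OF Z scale_field_closed[OF Xf Y] scale_field_closed[OF f D_closed[OF X Y]]]
        h_scale[OF Z Y Xf] h_scale[OF Z D_closed[OF X Y] f])
  show "D_sym_ricci X (scale_field f Y) Z p = f p * D_sym_ricci X Y Z p"
    unfolding cov_deriv_form_def 1 2 h_scale[OF DZ Y f] by (simp add: algebra_simps)
qed

text \<open>A field of the form \<open>T F\<close> is in the kernel everywhere, so that its covariant derivatives are, too, and each of
  the three terms of \<open>(D\<^sub>X \<rho>\<^sub>s\<^sub>y\<^sub>m)(T F, Z)\<close> vanishes.\<close>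

lemma D_sym_ricci_kernel:
  assumes X: "X \<in> vector_fields A" and F: "F \<in> vector_fields A" and Z: "Z \<in> vector_fields A"
  shows "D_sym_ricci X (\<lambda>q. T q (F q)) Z p = 0"
proof -
  let ?G = "\<lambda>q. T q (F q)"
  have G: "?G \<in> vector_fields A" "?G q \<in> endo_kernel A T q" for q
    by (rule T_field[OF F]) (simp add: endo_kernel_def T_tangent T_T field_tangent[OF F])
  have "sym_ricci A D ?G Z = (\<lambda>q. 0)" using sym_ricci_kernel[OF G Z] by blast
  then show ?thesis
    by (simp add: cov_deriv_form_def tangent_fun_const[OF field_tangent[OF X]]
        sym_ricci_kernel[OF D_closed[OF X G(1)] D_kernel[OF X G] Z] sym_ricci_kernel[OF G D_closed[OF X Z]])
qed

text \<open>Two symmetric bilinear forms that vanish on a common line of a plane are proportional.\<close>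

lemma D_sym_ricci_proportional:
  assumes X: "X \<in> vector_fields A" and YZ: "Y \<in> vector_fields A" "Z \<in> vector_fields A"
    and YZ': "Y' \<in> vector_fields A" "Z' \<in> vector_fields A"
  shows "D_sym_ricci X Y Z p * sym_ricci A D Y' Z' p = D_sym_ricci X Y' Z' p * sym_ricci A D Y Z p"
proof -
  obtain F where F: "F \<in> vector_fields A" "T p (F p) \<noteq> zero_vec"
    using adapted_field[of p] by metis
  let ?G = "\<lambda>q. T q (F q)"
  have G: "?G \<in> vector_fields A" "?G p \<in> endo_kernel A T p"
    by (rule T_field[OF F(1)]) (simp add: endo_kernel_def T_tangent T_T field_tangent[OF F(1)])
  note fr = adapted_frame[OF field_tangent[OF F(1)] F(2)]
  obtain y y' where y: "Y p = comb y (F p) y' (?G p)" by (rule frame_comb[OF fr field_tangent[OF YZ(1)]])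
  obtain z z' where z: "Z p = comb z (F p) z' (?G p)" by (rule frame_comb[OF fr field_tangent[OF YZ(2)]])
  obtain r r' where r: "Y' p = comb r (F p) r' (?G p)" by (rule frame_comb[OF fr field_tangent[OF YZ'(1)]])
  obtain s s' where s: "Z' p = comb s (F p) s' (?G p)" by (rule frame_comb[OF fr field_tangent[OF YZ'(2)]])
  have h: "sym_ricci A D V W p = v * w * sym_ricci A D F F p"
    if "V \<in> vector_fields A" "V p = comb v (F p) v' (?G p)" "W \<in> vector_fields A" "W p = comb w (F p) w' (?G p)"
    for V W v v' w w'
    by (rule form_frame[of p "\<lambda>Y Z. sym_ricci A D Y Z p", OF _ _ F(1) G(1) _ that])
      (intro tensorial_sym_ricci sym_ricci_commute sym_ricci_kernel[OF G], assumption?)+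
  have Dh: "D_sym_ricci X V W p = v * w * D_sym_ricci X F F p"
    if "V \<in> vector_fields A" "V p = comb v (F p) v' (?G p)" "W \<in> vector_fields A" "W p = comb w (F p) w' (?G p)"
    for V W v v' w w'
    by (rule form_frame[of p "\<lambda>Y Z. D_sym_ricci X Y Z p", OF _ _ F(1) G(1) _ that])
      (intro tensorial_D_sym_ricci_2[OF X] D_sym_ricci_commute D_sym_ricci_kernel[OF X F(1)], assumption?)+
  show ?thesis
    by (simp add: h[OF YZ(1) y YZ(2) z] h[OF YZ'(1) r YZ'(2) s] Dh[OF YZ(1) y YZ(2) z] Dh[OF YZ'(1) r YZ'(2) s])
qed

text \<open>Where \<open>h = \<rho>\<^sub>s\<^sub>y\<^sub>m\<close> does not vanish, \<open>\<eta>(X) = (D\<^sub>X h)(Y,Z) / h(Y,Z)\<close> for any \<open>Y, Z\<close> with \<open>h(Y,Z) \<noteq> 0\<close>.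
  By proportionality the quotient does not depend on \<open>Y, Z\<close>; so it is smooth, as one may use fixed \<open>Y, Z\<close> near
  a point.\<close>

lemma sym_ricci_recurrent: "recurrent_on A D (sym_ricci A D) {p. \<not> form_zero_at A (sym_ricci A D) p}"
proof -
  let ?h = "sym_ricci A D" and ?U = "{p. \<not> form_zero_at A (sym_ricci A D) p}"
  have "\<exists>Y Z. Y \<in> vector_fields A \<and> Z \<in> vector_fields A \<and> ?h Y Z p \<noteq> 0" if "p \<in> ?U" for p
    using that by (auto simp: form_zero_at_def)
  then obtain Y Z where YZ: "\<And>p. p \<in> ?U \<Longrightarrow> Y p \<in> vector_fields A"
    "\<And>p. p \<in> ?U \<Longrightarrow> Z p \<in> vector_fields A" "\<And>p. p \<in> ?U \<Longrightarrow> ?h (Y p) (Z p) p \<noteq> 0"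
    by metis
  define \<eta> where "\<eta> = (\<lambda>p v. D_sym_ricci (extend_vec A p v) (Y p) (Z p) p / ?h (Y p) (Z p) p)"
  have \<eta>: "\<eta> p (X p) * ?h Y' Z' p = D_sym_ricci X Y' Z' p"
    if p: "p \<in> ?U" and X: "X \<in> vector_fields A" and YZ': "Y' \<in> vector_fields A" "Z' \<in> vector_fields A" for p X Y' Z'
  proof -
    have "D_sym_ricci (extend_vec A p (X p)) (Y p) (Z p) p = D_sym_ricci X (Y p) (Z p) p"
      by (rule tensorial_cong[OF tensorial_D_sym_ricci_1]) (intro YZ p extend_vec field_tangent X)+
    then show ?thesis
      using D_sym_ricci_proportional[OF X YZ' YZ(1)[OF p] YZ(2)[OF p], of p] YZ(3)[OF p]
      by (simp add: \<eta>_def field_simps)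
  qed
  have near: "\<exists>V. open V \<and> p \<in> V \<and> V \<subseteq> ?U \<and> (\<forall>q\<in>V. ?h (Y p) (Z p) q \<noteq> 0)" if p: "p \<in> ?U" for p
  proof -
    note c = YZ(1)[OF p] YZ(2)[OF p]
    obtain V where "open V" "p \<in> V" "\<And>q. q \<in> V \<Longrightarrow> ?h (Y p) (Z p) q \<noteq> 0"
      by (rule smooth_near_nonzero[OF sym_ricci_smooth_near[OF c] YZ(3)[OF p]]) metis
    then show ?thesis using c by (intro exI[of _ V]) (auto simp: form_zero_at_def)
  qed
  have U: "open ?U" by (subst open_subopen) (use near in blast)
  have lin: "\<eta> p (comb a u b v) = a * \<eta> p u + b * \<eta> p v"
    if "p \<in> ?U" "u \<in> tangent_space A p" "v \<in> tangent_space A p" for p a b u v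
  proof -
    have "D_sym_ricci (extend_vec A p (comb a u b v)) (Y p) (Z p) p
        = a * D_sym_ricci (extend_vec A p u) (Y p) (Z p) p + b * D_sym_ricci (extend_vec A p v) (Y p) (Z p) p"
      by (rule tensorial_comb[OF tensorial_D_sym_ricci_1])
        (simp_all add: YZ that extend_vec tangent_add tangent_scale del: mem_Collect_eq)
    then show ?thesis by (simp add: \<eta>_def add_divide_distrib)
  qed
  have "one_form_on A ?U \<eta>"
    unfolding one_form_on_def
  proof (intro conjI ballI allI)
    fix p u v assume "p \<in> ?U" "u \<in> tangent_space A p" "v \<in> tangent_space A p"
    from lin[OF this, of 1 1] show "\<eta> p (add_vec u v) = \<eta> p u + \<eta> p v" by (simp add: scale_vec_def)
  next
    fix p a u assume p: "p \<in> ?U" and u: "u \<in> tangent_space A p"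
    from lin[OF p u u, of a 0] show "\<eta> p (scale_vec a u) = a * \<eta> p u" by (simp add: scale_vec_def add_vec_def)
  next
    fix X assume X: "X \<in> vector_fields A"
    show "smooth_fun_on A ?U (\<lambda>p. \<eta> p (X p))"
      unfolding smooth_fun_on_iff_near
    proof (intro conjI ballI U)
      fix p assume p: "p \<in> ?U"
      note c = YZ(1)[OF p] YZ(2)[OF p]
      obtain V where V: "open V" "p \<in> V" "V \<subseteq> ?U" "\<And>q. q \<in> V \<Longrightarrow> ?h (Y p) (Z p) q \<noteq> 0"
        using near[OF p] by blast
      have "smooth_near A p (\<lambda>q. D_sym_ricci X (Y p) (Z p) q / ?h (Y p) (Z p) q)"
        by (intro smooth_near_divide D_sym_ricci_smooth_near sym_ricci_smooth_near X c YZ(3) p)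
      then show "smooth_near A p (\<lambda>q. \<eta> q (X q))"
      proof (rule smooth_near_cong[OF _ V(1,2)])
        fix q assume q: "q \<in> V"
        then show "D_sym_ricci X (Y p) (Z p) q / ?h (Y p) (Z p) q = \<eta> q (X q)"
          using \<eta>[OF subsetD[OF V(3) q] X c] V(4)[OF q] by (simp add: field_simps)
      qed
    qed
  qed
  then show ?thesis unfolding recurrent_on_def using \<eta> by (intro exI[of _ \<eta>]) auto
qed

end

section \<open>Reparametrization of curves\<close>

lemma smooth_on_DERIV:
  fixes g :: "real \<Rightarrow> real"
  assumes "smooth_on S g" "x \<in> S"
  shows "(g has_real_derivative deriv g x) (at x)"
proof -
  have "g differentiable (at x)"
    using smooth_on_has_derivative[OF assms] by (auto simp: differentiable_def)
  then show ?thesis by (simp add: DERIV_deriv_iff_real_differentiable)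
qed

lemma smooth_on_deriv:
  fixes g :: "real \<Rightarrow> real"
  assumes "open S" "smooth_on S g"
  shows "smooth_on S (deriv g)"
proof (rule smooth_on_cong[OF assms(1) _ smooth_on_frechet[OF assms(2), of 1]])
  fix x assume "x \<in> S"
  then have "(g has_derivative (*) (deriv g x)) (at x)"
    using smooth_on_DERIV[OF assms(2)] by (simp add: has_field_derivative_def)
  from frechet_derivative_eqI[OF this] show "frechet_derivative g (at x) 1 = deriv g x" by simp
qed

lemma deriv_cong_open:
  assumes "open V" "x \<in> V" "\<And>y. y \<in> V \<Longrightarrow> f y = g y"
  shows "deriv f x = deriv g x"
  by (rule deriv_cong_ev[OF eventually_mono[OF eventually_nhds_in_open[OF assms(1,2)] assms(3)] refl])

lemma smooth_on_antiderivative: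
  fixes F f :: "real \<Rightarrow> real"
  assumes "open S" "smooth_on S f" "\<And>x. x \<in> S \<Longrightarrow> (F has_real_derivative f x) (at x)"
  shows "smooth_on S F"
  unfolding smooth_on_def
proof
  fix k show "times_diff_on k S F"
  proof (cases k)
    case 0
    then show ?thesis using assms(3) by (auto intro: DERIV_isCont continuous_at_imp_continuous_on)
  next
    case (Suc n)
    show ?thesis unfolding Suc
    proof (rule times_diff_on_SucI[OF assms(1)])
      show "(F has_derivative (*) (f x)) (at x)" if "x \<in> S" for x
        using assms(3)[OF that] by (simp add: has_field_derivative_def)
      show "times_diff_on n S (\<lambda>x. f x * v)" for v
        using assms(1,2) by (intro times_diff_on_mult times_diff_on_const) (auto simp: smooth_on_def)
    qed
  qed
qed

text \<open>For \<open>t0\<close> in \<open>I\<close>, one of the two integrals in the definition of \<open>F\<close> is over at most one point; their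
  difference is the oriented integral from \<open>t0\<close> to \<open>x\<close>.\<close>

lemma antiderivative_open_interval:
  fixes f :: "real \<Rightarrow> real"
  assumes I: "open I" "is_interval I" and f: "continuous_on I f"
  obtains F where "\<And>x. x \<in> I \<Longrightarrow> (F has_real_derivative f x) (at x)"
proof (cases "I = {}")
  case True then show ?thesis using that[of f] by simp
next
  case False
  then obtain t0 where t0: "t0 \<in> I" by auto
  define F where "F x = integral {t0..x} f - integral {x..t0} f" for x
  have "(F has_real_derivative f x) (at x)" if x: "x \<in> I" for x
  proof -
    have below: "\<exists>a\<in>I. a < y" and above: "\<exists>b\<in>I. y < b" if "y \<in> I" for y
    proof -
      obtain e where "e > 0" "ball y e \<subseteq> I" using I(1) \<open>y \<in> I\<close> by (meson openE)
      then have "y - e/2 \<in> I" "y + e/2 \<in> I" by (auto simp: dist_real_def subset_iff)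
      then show "\<exists>a\<in>I. a < y" "\<exists>b\<in>I. y < b" using \<open>e > 0\<close> by force+
    qed
    have "min t0 x \<in> I" "max t0 x \<in> I" using t0 x by (auto simp: min_def max_def)
    then obtain a b where ab: "a \<in> I" "b \<in> I" "a < t0" "a < x" "t0 < b" "x < b"
      using below above by (metis max_less_iff_conj min_less_iff_conj)
    have sub: "{a..b} \<subseteq> I" using I(2)[unfolded is_interval_1, rule_format, OF ab(1,2)] by auto
    then have c: "continuous_on {a..b} f" by (rule continuous_on_subset[OF f])
    then have i: "f integrable_on {u..v}" if "a \<le> u" "v \<le> b" for u v
      using that by (intro integrable_continuous_real continuous_on_subset[OF c]) auto
    have "F y = integral {a..y} f - integral {a..t0} f" if y: "y \<in> {a..b}" for y
    proof (cases "t0 \<le> y")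
      case True
      have "integral {a..t0} f + integral {t0..y} f = integral {a..y} f"
        by (rule Henstock_Kurzweil_Integration.integral_combine) (use True ab y i in auto)
      moreover have "integral {y..t0} f = 0" using True by (cases "y = t0") auto
      ultimately show ?thesis by (simp add: F_def)
    next
      case False
      have "integral {a..y} f + integral {y..t0} f = integral {a..t0} f"
        by (rule Henstock_Kurzweil_Integration.integral_combine) (use False ab y i in auto)
      then show ?thesis using False by (simp add: F_def)
    qed
    moreover have "((\<lambda>y. integral {a..y} f - integral {a..t0} f) has_real_derivative f x) (at x)"
    proof -
      have "((\<lambda>y. integral {a..y} f) has_real_derivative f x) (at x within {a..b})"
        by (rule integral_has_real_derivative[OF c]) (use ab in auto)
      then have "((\<lambda>y. integral {a..y} f) has_real_derivative f x) (at x)"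
        using ab by (simp add: at_within_Icc_at)
      then show ?thesis by (auto intro!: derivative_eq_intros)
    qed
    ultimately show ?thesis
      using ab by (intro has_field_derivative_transform_within_open[of _ _ _ "{a<..<b}" F]) auto
  qed
  then show ?thesis by (rule that)
qed

text \<open>The inverse \<open>S\<close> of a solution \<open>s\<close> of \<open>s'' = - f(s) s'\<^sup>2\<close> satisfies the linear equation \<open>S'' = f S'\<close>,
  which two integrations solve: \<open>S' = exp F\<close> with \<open>F' = f\<close>. Then \<open>s' = exp(- F(s))\<close>, and this equation also
  shows inductively that \<open>s\<close> is smooth.\<close>

lemma reparametrization:
  fixes f :: "real \<Rightarrow> real"
  assumes I: "open I" "is_interval I" and f: "smooth_on I f"
  obtains J s where "open J" "is_interval J" "bij_betw s J I" "smooth_on J s"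
    "\<And>t. t \<in> J \<Longrightarrow> deriv s t \<noteq> 0" "\<And>t. t \<in> J \<Longrightarrow> deriv (deriv s) t = - f (s t) * (deriv s t)\<^sup>2"
proof -
  obtain F where F: "\<And>x. x \<in> I \<Longrightarrow> (F has_real_derivative f x) (at x)"
    by (rule antiderivative_open_interval[OF I smooth_on_imp_continuous_on[OF f]]) (rule that)
  have F_smooth: "smooth_on I F" by (rule smooth_on_antiderivative[OF I(1) f F])
  have "continuous_on I (\<lambda>x. exp (F x))"
    by (intro continuous_on_exp smooth_on_imp_continuous_on F_smooth)
  then obtain S where S: "\<And>x. x \<in> I \<Longrightarrow> (S has_real_derivative exp (F x)) (at x)"
    using antiderivative_open_interval[OF I] by metis
  have mono: "S x < S y" if "x \<in> I" "y \<in> I" "x < y" for x y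
  proof (rule DERIV_pos_imp_increasing[OF that(3)])
    fix z assume "x \<le> z" "z \<le> y"
    then have "z \<in> I" using I(2) that(1,2) unfolding is_interval_1 by blast
    then show "\<exists>d. (S has_real_derivative d) (at z) \<and> 0 < d" using S by (intro exI[of _ "exp (F z)"]) auto
  qed
  have inj: "inj_on S I"
    by (rule inj_onI) (metis mono linorder_neq_iff)
  have S_cont: "continuous_on I S" using S by (auto intro: DERIV_isCont continuous_at_imp_continuous_on)
  define J where "J = S ` I"
  obtain s where hom: "homeomorphism I J S s"
    unfolding J_def using invariance_of_domain_homeomorphism[OF I(1) S_cont _ inj] by auto
  have J: "open J" "is_interval J"
    using invariance_of_domain[OF S_cont I(1) inj] connected_continuous_image[OF S_cont] I(2)
    by (auto simp: J_def is_interval_connected_1)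
  have sJ: "s t \<in> I" "S (s t) = t" if "t \<in> J" for t
    using hom that by (auto simp: homeomorphism_def)
  have s_cont: "continuous_on J s" using hom by (simp add: homeomorphism_def)
  have s_deriv: "(s has_real_derivative exp (- F (s t))) (at t)" if t: "t \<in> J" for t
  proof -
    obtain e where e: "e > 0" "ball t e \<subseteq> J" using J(1) t by (meson openE)
    have "(s has_real_derivative inverse (exp (F (s t)))) (at t)"
    proof (rule DERIV_inverse_function[of S])
      show "(S has_real_derivative exp (F (s t))) (at (s t))" by (rule S[OF sJ(1)[OF t]])
      show "t - e < t" "t < t + e" using e by auto
      show "S (s y) = y" if "t - e < y" "y < t + e" for y
        using that e(2) by (intro sJ) (auto simp: dist_real_def subset_iff)
      show "isCont s t" using s_cont J(1) t by (simp add: continuous_on_eq_continuous_at)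
    qed simp
    then show ?thesis by (simp add: exp_minus)
  qed
  have E_smooth: "smooth_on I (\<lambda>x. exp (- F x))"
    using smooth_on_linear[OF bounded_linear_minus[OF bounded_linear_ident] I(1) F_smooth]
    by (intro smooth_on_compose[OF I(1) _ _ smooth_on_exp]) auto
  have s_smooth: "smooth_on J s"
    unfolding smooth_on_def
  proof
    fix k show "times_diff_on k J s"
    proof (induction k)
      case 0 then show ?case using s_cont by simp
    next
      case (Suc k)
      show ?case
      proof (rule times_diff_on_SucI[OF J(1)])
        show "(s has_derivative (*) (exp (- F (s t)))) (at t)" if "t \<in> J" for t
          using s_deriv[OF that] by (simp add: has_field_derivative_def)
        have "times_diff_on k J (\<lambda>t. exp (- F (s t)))"
          by (rule times_diff_on_compose[OF J(1) I(1) _ _ Suc]) (use sJ E_smooth in \<open>auto simp: smooth_on_def\<close>)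
        then show "times_diff_on k J (\<lambda>t. exp (- F (s t)) * v)" for v
          using J(1) by (intro times_diff_on_mult times_diff_on_const)
      qed
    qed
  qed
  show ?thesis
  proof (rule that[OF J _ s_smooth])
    show "bij_betw s J I"
      using hom by (intro bij_betw_byWitness[of _ S]) (auto simp: homeomorphism_def)
    have ds: "deriv s t = exp (- F (s t))" if "t \<in> J" for t by (rule DERIV_imp_deriv[OF s_deriv[OF that]])
    show "deriv s t \<noteq> 0" if "t \<in> J" for t by (simp add: ds[OF that])
    fix t assume t: "t \<in> J"
    have "((\<lambda>t. exp (- F (s t))) has_real_derivative exp (- F (s t)) * - (f (s t) * exp (- F (s t)))) (at t)"
      by (intro DERIV_chain2[OF DERIV_exp] DERIV_minus DERIV_chain2[OF F[OF sJ(1)[OF t]] s_deriv[OF t]])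
    then have "deriv (\<lambda>t. exp (- F (s t))) t = - f (s t) * (exp (- F (s t)))\<^sup>2"
      by (simp add: DERIV_imp_deriv power2_eq_square algebra_simps)
    then show "deriv (deriv s) t = - f (s t) * (deriv s t)\<^sup>2"
      using deriv_cong_open[OF J(1) t ds] by (simp add: ds[OF t])
  qed
qed

section \<open>Integral curves of the kernel\<close>

context surface
begin

lemma smooth_curve_local:
  assumes \<gamma>: "smooth_curve A I \<gamma>" and t: "t \<in> I" and f: "smooth_near A (\<gamma> t) f"
  obtains V where "open V" "t \<in> V" "V \<subseteq> I" "smooth_on V (f \<circ> \<gamma>)"
proof -
  obtain U where U: "\<gamma> t \<in> U" "smooth_fun_on A U f" using f by (auto simp: smooth_near_def)
  have "open (I \<inter> \<gamma> -` U)"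
    using \<gamma> U(2) by (intro continuous_open_preimage) (auto simp: smooth_curve_def smooth_fun_on_def)
  moreover have eq: "I \<inter> \<gamma> -` U = {t\<in>I. \<gamma> t \<in> U}" by auto
  moreover have "smooth_on {t\<in>I. \<gamma> t \<in> U} (f \<circ> \<gamma>)" using \<gamma> U(2) by (simp add: smooth_curve_def)
  ultimately show ?thesis using U(1) t by (intro that[of "I \<inter> \<gamma> -` U"]) auto
qed

lemma velocity_DERIV:
  assumes "smooth_curve A I \<gamma>" "t \<in> I" "smooth_near A (\<gamma> t) f"
  shows "((f \<circ> \<gamma>) has_real_derivative velocity A \<gamma> t f) (at t)"
proof -
  obtain V where "open V" "t \<in> V" "smooth_on V (f \<circ> \<gamma>)"
    using smooth_curve_local[OF assms] by metis
  then show ?thesis using smooth_on_DERIV[of V "f \<circ> \<gamma>" t] assms(3) by (simp add: velocity_def)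
qed

lemma open_curve_preimage:
  assumes "smooth_curve A I \<gamma>" "open U"
  shows "open {t\<in>I. \<gamma> t \<in> U}"
proof -
  have "open (I \<inter> \<gamma> -` U)"
    using assms by (intro continuous_open_preimage) (auto simp: smooth_curve_def)
  moreover have "{t\<in>I. \<gamma> t \<in> U} = I \<inter> \<gamma> -` U" by auto
  ultimately show ?thesis by simp
qed

end

text \<open>\<open>D\<^bsub>\<gamma>'\<^esub> \<gamma>' = y \<gamma>'\<close> at time \<open>t\<close>, in all charts.\<close>

definition (in affine_surface) pregeodesic_at :: "(real \<Rightarrow> 'a) \<Rightarrow> real \<Rightarrow> real \<Rightarrow> bool" where
  "pregeodesic_at \<gamma> t y \<longleftrightarrow>
     (\<forall>c\<in>A. \<gamma> t \<in> fst c \<longrightarrow>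
        (\<forall>k. deriv (deriv (coord c k \<circ> \<gamma>)) t +
             (\<Sum>i\<in>UNIV. \<Sum>j\<in>UNIV. christoffel A D c (\<gamma> t) i j k *
                deriv (coord c i \<circ> \<gamma>) t * deriv (coord c j \<circ> \<gamma>) t) = y * deriv (coord c k \<circ> \<gamma>) t))"

context affine_surface
begin

text \<open>Evaluated along a curve with velocity \<open>X\<close>, the right-hand side is the left-hand side of the geodesic equation.\<close>

lemma D_christoffel:
  assumes X: "X \<in> vector_fields A" and c: "c \<in> A" "p \<in> fst c"
  shows "D X X p (coord c k) = X p (\<lambda>q. X q (coord c k)) +
    (\<Sum>i\<in>UNIV. \<Sum>j\<in>UNIV. christoffel A D c p i j k * X p (coord c i) * X p (coord c j))"
proof -
  let ?E = "extend_coord A c p"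
  obtain V where V: "open V" "p \<in> V" "V \<subseteq> fst c" "\<And>q i. q \<in> V \<Longrightarrow> ?E i q = coord_vec A c i q"
    using extend_coord_frame[OF c] by metis
  have E: "?E i \<in> vector_fields A" for i by (rule extend_coord[OF c])
  have Xe: "X q = comb (X q (coord c 1)) (?E 1 q) (X q (coord c 2)) (?E 2 q)" if "q \<in> V" for q
    unfolding V(4)[OF that] by (rule tangent_expansion) (use c V(3) that X field_tangent in auto)
  have DE: "D X (?E j) p (coord c k) = X p (coord c 1) * christoffel A D c p 1 j k + X p (coord c 2) * christoffel A D c p 2 j k" for j
    unfolding christoffel_def by (rule tensorial_expansion[OF tensorial_D[OF E] X c])
  have Ek: "?E l p (coord c k) = (if l = k then 1 else 0)" for l
    by (simp add: V(4)[OF V(2)] coord_vec_coord[OF c])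
  have s: "smooth_near A p (\<lambda>q. X q (coord c j))" for j
    by (rule field_smooth_near[OF X smooth_near_coord[OF c]])
  have "D X X p (coord c k) = X p (\<lambda>q. X q (coord c 1)) * ?E 1 p (coord c k) + X p (coord c 1) * D X (?E 1) p (coord c k)
     + X p (\<lambda>q. X q (coord c 2)) * ?E 2 p (coord c k) + X p (coord c 2) * D X (?E 2) p (coord c k)"
    by (rule D_expansion[OF X X E E V(1,2) Xe s s])
  then show ?thesis
    unfolding DE Ek sum_2 using exhaust_2[of k] by (auto simp: algebra_simps)
qed

text \<open>If \<open>\<gamma>' = b X\<close> along \<open>\<gamma>\<close> and \<open>D\<^sub>X X = a X\<close>, then \<open>D\<^bsub>\<gamma>'\<^esub> \<gamma>' = (b'/b + a b) \<gamma>'\<close>.\<close>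

lemma pregeodesic_of_field:
  assumes \<gamma>: "smooth_curve A I \<gamma>" and X: "X \<in> vector_fields A"
    and V: "open V" "V \<subseteq> I" "t \<in> V"
    and vel: "\<And>u. u \<in> V \<Longrightarrow> velocity A \<gamma> u = scale_vec (b u) (X (\<gamma> u))"
    and b: "(b has_real_derivative b') (at t)" "b t \<noteq> 0"
    and a: "D X X (\<gamma> t) = scale_vec a (X (\<gamma> t))"
  shows "pregeodesic_at \<gamma> t (b' / b t + b t * a)"
  unfolding pregeodesic_at_def
proof (intro ballI impI allI)
  fix c k assume c: "c \<in> A" "\<gamma> t \<in> fst c"
  have s: "smooth_near A (\<gamma> t) (\<lambda>q. X q (coord c k))"
    by (rule field_smooth_near[OF X smooth_near_coord[OF c]])
  have t: "t \<in> I" using V by auto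
  let ?W = "V \<inter> {t\<in>I. \<gamma> t \<in> fst c}"
  have W: "open ?W" "t \<in> ?W"
    using open_curve_preimage[OF \<gamma> open_chart_domain[OF c(1)]] V t c by auto
  have d: "deriv (coord c i \<circ> \<gamma>) u = b u * X (\<gamma> u) (coord c i)" if "u \<in> ?W" for i u
  proof -
    have "deriv (coord c i \<circ> \<gamma>) u = velocity A \<gamma> u (coord c i)"
      using that smooth_near_coord[OF c(1), of "\<gamma> u" i] by (simp add: velocity_def)
    then show ?thesis using vel[of u] that by (simp add: scale_vec_def)
  qed
  have "((\<lambda>u. b u * ((\<lambda>q. X q (coord c k)) \<circ> \<gamma>) u) has_real_derivative
      b' * ((\<lambda>q. X q (coord c k)) \<circ> \<gamma>) t + velocity A \<gamma> t (\<lambda>q. X q (coord c k)) * b t) (at t)"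
    by (rule DERIV_mult[OF b(1) velocity_DERIV[OF \<gamma> t s]])
  then have "deriv (\<lambda>u. b u * X (\<gamma> u) (coord c k)) t
      = b' * X (\<gamma> t) (coord c k) + velocity A \<gamma> t (\<lambda>q. X q (coord c k)) * b t"
    by (intro DERIV_imp_deriv) (simp add: comp_def)
  then have dd: "deriv (deriv (coord c k \<circ> \<gamma>)) t
      = b' * X (\<gamma> t) (coord c k) + b t * b t * X (\<gamma> t) (\<lambda>q. X q (coord c k))"
    using deriv_cong_open[OF W d] by (simp add: vel[OF V(3)] scale_vec_def)
  have "X (\<gamma> t) (\<lambda>q. X q (coord c k)) + (\<Sum>i\<in>UNIV. \<Sum>j\<in>UNIV. christoffel A D c (\<gamma> t) i j k * X (\<gamma> t) (coord c i) * X (\<gamma> t) (coord c j))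
      = a * X (\<gamma> t) (coord c k)"
    using D_christoffel[OF X c, of k] by (simp add: a scale_vec_def)
  then have "b t * b t * (X (\<gamma> t) (\<lambda>q. X q (coord c k)) + (\<Sum>i\<in>UNIV. \<Sum>j\<in>UNIV. christoffel A D c (\<gamma> t) i j k * X (\<gamma> t) (coord c i) * X (\<gamma> t) (coord c j)))
      = b t * b t * (a * X (\<gamma> t) (coord c k))" by simp
  then show "deriv (deriv (coord c k \<circ> \<gamma>)) t +
      (\<Sum>i\<in>UNIV. \<Sum>j\<in>UNIV. christoffel A D c (\<gamma> t) i j k * deriv (coord c i \<circ> \<gamma>) t * deriv (coord c j \<circ> \<gamma>) t)
      = (b' / b t + b t * a) * deriv (coord c k \<circ> \<gamma>) t"
    unfolding dd d[OF W(2)] sum_2 using b(2) by (simp add: field_simps)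
qed

lemma pregeodesic_unique:
  assumes "pregeodesic_at \<gamma> t y" "pregeodesic_at \<gamma> t z"
    and v: "velocity A \<gamma> t \<in> tangent_space A (\<gamma> t)" "velocity A \<gamma> t \<noteq> zero_vec"
  shows "y = z"
proof -
  obtain c where c: "c \<in> A" "\<gamma> t \<in> fst c" by (rule chart_cover)
  obtain k where "velocity A \<gamma> t (coord c k) \<noteq> 0" by (rule tangent_nonzero_coord[OF c v])
  then have k: "deriv (coord c k \<circ> \<gamma>) t \<noteq> 0"
    using smooth_near_coord[OF c] by (auto simp: velocity_def)
  have "y * deriv (coord c k \<circ> \<gamma>) t = z * deriv (coord c k \<circ> \<gamma>) t"
    using assms(1)[unfolded pregeodesic_at_def, rule_format, OF c, of k]
      assms(2)[unfolded pregeodesic_at_def, rule_format, OF c, of k] by linarith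
  then show ?thesis using k by simp
qed

text \<open>In coordinates, \<open>(\<gamma> \<circ> s)'' + \<Gamma> (\<gamma> \<circ> s)' (\<gamma> \<circ> s)' = s'\<^sup>2 (\<gamma>'' + \<Gamma> \<gamma>' \<gamma>')(s) + s'' \<gamma>'(s)
  = (f(s) s'\<^sup>2 + s'') \<gamma>'(s)\<close>.\<close>

lemma unparam_geodesic_of_pregeodesic:
  assumes \<gamma>: "smooth_curve A I \<gamma>" and f: "smooth_on I f" and pre: "\<And>t. t \<in> I \<Longrightarrow> pregeodesic_at \<gamma> t (f t)"
  shows "unparam_geodesic A D I \<gamma>"
proof -
  have I: "open I" "is_interval I" using \<gamma> by (auto simp: smooth_curve_def)
  obtain J s where J: "open J" "is_interval J" "bij_betw s J I" "smooth_on J s"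
    "\<And>t. t \<in> J \<Longrightarrow> deriv s t \<noteq> 0" "\<And>t. t \<in> J \<Longrightarrow> deriv (deriv s) t = - f (s t) * (deriv s t)\<^sup>2"
    using reparametrization[OF I f] by metis
  have sI: "s t \<in> I" if "t \<in> J" for t using J(3) that by (auto simp: bij_betw_def)
  have s_cont: "continuous_on J s" by (rule smooth_on_imp_continuous_on[OF J(4)])
  have curve: "smooth_curve A J (\<gamma> \<circ> s)"
    unfolding smooth_curve_def
  proof (intro conjI allI impI J)
    show cont: "continuous_on J (\<gamma> \<circ> s)"
      using \<gamma> sI by (intro continuous_on_compose s_cont) (auto simp: smooth_curve_def intro: continuous_on_subset)
    fix U g assume g: "smooth_fun_on A U g"
    then have U: "open U" by (simp add: smooth_fun_on_def)
    have "open (J \<inter> (\<gamma> \<circ> s) -` U)" by (rule continuous_open_preimage[OF cont J(1) U])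
    moreover have "J \<inter> (\<gamma> \<circ> s) -` U = {t\<in>J. (\<gamma> \<circ> s) t \<in> U}" by auto
    ultimately have o: "open {t\<in>J. (\<gamma> \<circ> s) t \<in> U}" by simp
    have "smooth_on {t\<in>J. (\<gamma> \<circ> s) t \<in> U} (\<lambda>t. (g \<circ> \<gamma>) (s t))"
    proof (rule smooth_on_compose[where f = "g \<circ> \<gamma>" and g = s, OF o open_curve_preimage[OF \<gamma> U]])
      show "smooth_on {t\<in>I. \<gamma> t \<in> U} (g \<circ> \<gamma>)" using \<gamma> g by (auto simp: smooth_curve_def)
      show "smooth_on {t\<in>J. (\<gamma> \<circ> s) t \<in> U} s" by (rule smooth_on_subset[OF _ J(4)]) auto
    qed (use sI in auto)
    then show "smooth_on {t\<in>J. (\<gamma> \<circ> s) t \<in> U} (g \<circ> (\<gamma> \<circ> s))" by (simp add: comp_def)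
  qed
  have "geodesic A D J (\<gamma> \<circ> s)"
    unfolding geodesic_def
  proof (intro conjI curve ballI impI allI)
    fix t c k assume t: "t \<in> J" and c: "c \<in> A" "(\<gamma> \<circ> s) t \<in> fst c"
    let ?W = "{t\<in>J. (\<gamma> \<circ> s) t \<in> fst c}"
    have W: "open ?W" "t \<in> ?W" using open_curve_preimage[OF curve open_chart_domain[OF c(1)]] t c by auto
    let ?g = "\<lambda>i. coord c i \<circ> \<gamma>" and ?S = "{t\<in>I. \<gamma> t \<in> fst c}"
    have S: "open ?S" "u \<in> ?W \<Longrightarrow> s u \<in> ?S" for u
      using open_curve_preimage[OF \<gamma> open_chart_domain[OF c(1)]] sI by auto
    have "smooth_fun_on A (fst c) (coord c i)" for i
      using smooth_near_coord[OF c(1)] open_chart_domain[OF c(1)] by (simp add: smooth_fun_on_iff_near)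
    then have g: "smooth_on ?S (?g i)" for i using \<gamma> by (auto simp: smooth_curve_def)
    have ds: "(s has_real_derivative deriv s u) (at u)" if "u \<in> ?W" for u
      using smooth_on_DERIV[OF J(4)] that by auto
    have d: "deriv (coord c i \<circ> (\<gamma> \<circ> s)) u = deriv (?g i) (s u) * deriv s u" if "u \<in> ?W" for i u
      using DERIV_chain[OF smooth_on_DERIV[OF g[of i] S(2)[OF that]] ds[OF that]]
      by (simp add: DERIV_imp_deriv comp_assoc)
    have "((\<lambda>u. deriv (?g k) (s u) * deriv s u) has_real_derivative
        deriv (deriv (?g k)) (s t) * deriv s t * deriv s t + deriv (deriv s) t * deriv (?g k) (s t)) (at t)"
      by (rule DERIV_mult[OF DERIV_chain2[OF smooth_on_DERIV[OF smooth_on_deriv[OF S(1) g] S(2)[OF W(2)]] ds[OF W(2)]]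
          smooth_on_DERIV[OF smooth_on_deriv[OF J(1,4)] t]])
    then have dd: "deriv (deriv (coord c k \<circ> (\<gamma> \<circ> s))) t
        = deriv (deriv (?g k)) (s t) * deriv s t * deriv s t + deriv (deriv s) t * deriv (?g k) (s t)"
      using deriv_cong_open[OF W d] by (simp add: DERIV_imp_deriv)
    have "deriv (deriv (?g k)) (s t) + (\<Sum>i\<in>UNIV. \<Sum>j\<in>UNIV. christoffel A D c (\<gamma> (s t)) i j k * deriv (?g i) (s t) * deriv (?g j) (s t))
        = f (s t) * deriv (?g k) (s t)"
      using pre[OF sI[OF t]] c unfolding pregeodesic_at_def by simp
    then have "(deriv s t)\<^sup>2 * (deriv (deriv (?g k)) (s t) + (\<Sum>i\<in>UNIV. \<Sum>j\<in>UNIV. christoffel A D c (\<gamma> (s t)) i j k * deriv (?g i) (s t) * deriv (?g j) (s t)))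
        = (deriv s t)\<^sup>2 * (f (s t) * deriv (?g k) (s t))" by simp
    then show "deriv (deriv (coord c k \<circ> (\<gamma> \<circ> s))) t +
        (\<Sum>i\<in>UNIV. \<Sum>j\<in>UNIV. christoffel A D c ((\<gamma> \<circ> s) t) i j k *
           deriv (coord c i \<circ> (\<gamma> \<circ> s)) t * deriv (coord c j \<circ> (\<gamma> \<circ> s)) t) = 0"
      unfolding dd d[OF W(2)] J(6)[OF t] sum_2 comp_apply by (simp add: power2_eq_square algebra_simps)
  qed
  then show ?thesis using J unfolding unparam_geodesic_def by blast
qed

end

context parallel_nilpotent_surface
begin

text \<open>Near \<open>\<gamma>(t0)\<close> a single field \<open>X = T F\<close> spans the kernel, and the coefficients of \<open>\<gamma>' = b X\<close> and
  \<open>D\<^sub>X X = a X\<close> are quotients of components in a chart, hence smooth along \<open>\<gamma>\<close>.\<close>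

lemma integral_curve_locally_pregeodesic:
  assumes \<gamma>: "integral_curve A (endo_kernel A T) I \<gamma>" and t0: "t0 \<in> I"
  obtains V f where "open V" "t0 \<in> V" "V \<subseteq> I" "smooth_on V f" "\<And>t. t \<in> V \<Longrightarrow> pregeodesic_at \<gamma> t (f t)"
proof -
  have curve: "smooth_curve A I \<gamma>"
    and vel: "\<And>t. t \<in> I \<Longrightarrow> velocity A \<gamma> t \<in> endo_kernel A T (\<gamma> t)" "\<And>t. t \<in> I \<Longrightarrow> velocity A \<gamma> t \<noteq> zero_vec"
    using \<gamma> by (auto simp: integral_curve_def)
  obtain F W where F: "F \<in> vector_fields A" "open W" "\<gamma> t0 \<in> W" "\<And>q. q \<in> W \<Longrightarrow> T q (F q) \<noteq> zero_vec"
    using adapted_field[of "\<gamma> t0"] by metis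
  define X where "X = (\<lambda>q. T q (F q))"
  have X: "X \<in> vector_fields A" unfolding X_def by (rule T_field[OF F(1)])
  have XK: "X q \<in> endo_kernel A T q" for q
    by (simp add: X_def endo_kernel_def T_tangent T_T field_tangent[OF F(1)])
  have K: "endo_kernel A T q = {scale_vec s (X q) | s. True}" if "q \<in> W" for q
    unfolding X_def by (rule kernel_adapted[OF field_tangent[OF F(1)] F(4)[OF that]])
  obtain c where c: "c \<in> A" "\<gamma> t0 \<in> fst c" by (rule chart_cover)
  have "X (\<gamma> t0) \<noteq> zero_vec" using F(3,4) by (simp add: X_def)
  then obtain k where k: "X (\<gamma> t0) (coord c k) \<noteq> 0"
    by (rule tangent_nonzero_coord[OF c field_tangent[OF X]])
  obtain U where U: "open U" "\<gamma> t0 \<in> U" "\<And>q. q \<in> U \<Longrightarrow> X q (coord c k) \<noteq> 0"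
    by (rule smooth_near_nonzero[OF field_smooth_near[OF X smooth_near_coord[OF c]] k]) metis
  define V where "V = {t\<in>I. \<gamma> t \<in> U \<inter> W \<inter> fst c}"
  have "open V"
    unfolding V_def by (intro open_curve_preimage[OF curve] open_Int U F open_chart_domain c)
  then have V: "open V" "t0 \<in> V" "V \<subseteq> I"
    using U(2) F(3) c t0 by (auto simp: V_def)
  have Vc: "\<gamma> t \<in> U" "\<gamma> t \<in> W" "\<gamma> t \<in> fst c" "t \<in> I" if "t \<in> V" for t using that by (auto simp: V_def)
  have along: "smooth_on V (g \<circ> \<gamma>)" if "\<And>q. q \<in> fst c \<Longrightarrow> smooth_near A q g" for g
  proof -
    have "smooth_fun_on A (fst c) g" using that open_chart_domain[OF c(1)] by (simp add: smooth_fun_on_iff_near)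
    then have "smooth_on {t\<in>I. \<gamma> t \<in> fst c} (g \<circ> \<gamma>)" using curve by (auto simp: smooth_curve_def)
    then show ?thesis by (rule smooth_on_subset[rotated]) (use Vc in auto)
  qed
  define b where "b = (\<lambda>t. deriv (coord c k \<circ> \<gamma>) t / ((\<lambda>q. X q (coord c k)) \<circ> \<gamma>) t)"
  define a where "a = (\<lambda>t. ((\<lambda>q. D X X q (coord c k)) \<circ> \<gamma>) t / ((\<lambda>q. X q (coord c k)) \<circ> \<gamma>) t)"
  have X_smooth: "smooth_on V ((\<lambda>q. X q (coord c k)) \<circ> \<gamma>)"
    by (rule along) (rule field_smooth_near[OF X smooth_near_coord[OF c(1)]])
  have b_smooth: "smooth_on V b"
    unfolding b_def by (intro smooth_on_divide X_smooth smooth_on_deriv along V(1) smooth_near_coord c(1))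
      (use U(3) Vc in auto)
  have a_smooth: "smooth_on V a"
    unfolding a_def
    by (intro smooth_on_divide X_smooth V(1) along field_smooth_near[OF D_closed[OF X X] smooth_near_coord[OF c(1)]])
      (use U(3) Vc in auto)
  have b_vel: "velocity A \<gamma> t = scale_vec (b t) (X (\<gamma> t))" if t: "t \<in> V" for t
  proof -
    obtain s where s: "velocity A \<gamma> t = scale_vec s (X (\<gamma> t))"
      using vel(1)[OF Vc(4)[OF t]] K[OF Vc(2)[OF t]] by auto
    have "deriv (coord c k \<circ> \<gamma>) t = velocity A \<gamma> t (coord c k)"
      using smooth_near_coord[OF c(1) Vc(3)[OF t]] by (simp add: velocity_def)
    then have "b t = s" using U(3)[OF Vc(1)[OF t]] by (simp add: b_def s scale_vec_def)
    with s show ?thesis by simp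
  qed
  have b_nz: "b t \<noteq> 0" if t: "t \<in> V" for t
    using vel(2)[OF Vc(4)[OF t]] b_vel[OF t] by (auto simp: scale_vec_def zero_vec_def)
  have a_D: "D X X (\<gamma> t) = scale_vec (a t) (X (\<gamma> t))" if t: "t \<in> V" for t
  proof -
    obtain s where s: "D X X (\<gamma> t) = scale_vec s (X (\<gamma> t))"
      using D_kernel[OF X X XK] K[OF Vc(2)[OF t]] by auto
    then have "a t = s" using U(3)[OF Vc(1)[OF t]] by (simp add: a_def scale_vec_def)
    with s show ?thesis by simp
  qed
  show ?thesis
  proof (rule that[OF V])
    show "smooth_on V (\<lambda>t. deriv b t / b t + b t * a t)"
      by (intro smooth_on_add smooth_on_divide smooth_on_mult smooth_on_deriv V(1) a_smooth b_smooth b_nz)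
    fix t assume t: "t \<in> V"
    show "pregeodesic_at \<gamma> t (deriv b t / b t + b t * a t)"
      by (rule pregeodesic_of_field[OF curve X V(1,3) t b_vel smooth_on_DERIV[OF b_smooth t] b_nz[OF t] a_D[OF t]])
  qed
qed

text \<open>The proportionality factor at each time is unique, so the local factors agree with one globally
  defined smooth function.\<close>

lemma integral_curve_geodesic:
  assumes \<gamma>: "integral_curve A (endo_kernel A T) I \<gamma>"
  shows "unparam_geodesic A D I \<gamma>"
proof -
  have curve: "smooth_curve A I \<gamma>"
    and vel: "\<And>t. t \<in> I \<Longrightarrow> velocity A \<gamma> t \<in> tangent_space A (\<gamma> t)" "\<And>t. t \<in> I \<Longrightarrow> velocity A \<gamma> t \<noteq> zero_vec"
    using \<gamma> by (auto simp: integral_curve_def endo_kernel_def)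
  have I: "open I" using curve by (simp add: smooth_curve_def)
  define f where "f t = (SOME y. pregeodesic_at \<gamma> t y)" for t
  have f_eq: "f t = y" "pregeodesic_at \<gamma> t (f t)" if "t \<in> I" "pregeodesic_at \<gamma> t y" for t y
    using someI[of "pregeodesic_at \<gamma> t", OF that(2)] pregeodesic_unique[OF _ that(2) vel[OF that(1)]]
    by (auto simp: f_def)
  have "smooth_on I f"
  proof (rule smooth_on_local[OF I])
    fix t0 assume "t0 \<in> I"
    then obtain V g where V: "open V" "t0 \<in> V" "V \<subseteq> I" "smooth_on V g" "\<And>t. t \<in> V \<Longrightarrow> pregeodesic_at \<gamma> t (g t)"
      using integral_curve_locally_pregeodesic[OF \<gamma>] by metis
    have "smooth_on V f" by (rule smooth_on_cong[OF V(1) _ V(4)]) (use f_eq V(3,5) in force)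
    then show "\<exists>U. open U \<and> t0 \<in> U \<and> smooth_on U f" using V by blast
  qed
  moreover have "pregeodesic_at \<gamma> t (f t)" if "t \<in> I" for t
    using integral_curve_locally_pregeodesic[OF \<gamma> that] f_eq(2)[OF that] by metis
  ultimately show ?thesis by (rule unparam_geodesic_of_pregeodesic[OF curve])
qed

end

theorem proposition3p3:
  fixes A :: "'a::{t2_space,second_countable_topology} chart set"
    and D :: "'a field \<Rightarrow> 'a field \<Rightarrow> 'a field"
    and T :: "'a \<Rightarrow> 'a tangent \<Rightarrow> 'a tangent"
  assumes "smooth_surface A"
    and "affine_connection A D"
    and "torsion_free A D"
    and "endo_field A T"
    and "nilpotent_endo A T"
    and "nonzero_endo A T"
    and "parallel_endo A D T"
  shows "(line_distribution A (endo_kernel A T) \<and>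
          parallel_distribution A D (endo_kernel A T) \<and>
          (\<forall>I \<gamma>. integral_curve A (endo_kernel A T) I \<gamma> \<longrightarrow> unparam_geodesic A D I \<gamma>)) \<and>
         ((\<forall>p. form_zero_at A (sym_ricci A D) p \<or> form_rank A (sym_ricci A D) p = 1) \<and>
          recurrent_on A D (sym_ricci A D) {p. \<not> form_zero_at A (sym_ricci A D) p})"
proof -
  interpret parallel_nilpotent_surface A D T
    by unfold_locales (fact assms)+
  show ?thesis
    using line_distribution_kernel parallel_distribution_kernel integral_curve_geodesic
      sym_ricci_rank sym_ricci_recurrent by blast
qed

end
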